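(* Let $X$ be a scheme and let $\mathscr{C}=(U_i)$ be an affine open covering of $X$. For each $U\in\mathscr{C}$ let $S_U$ be the set of ideals of the ring $\mathscr{O}_X(U)$. Then the function $\eta: M(X)\to\prod_{U\in\mathscr{C}}S_U$ given by $[\phi]\mapsto\big(\operatorname{Ker}\phi_U^{\sharp}\big)_{U\in\mathscr{C}}$ is injective.
   Context: A closed immersion of schemes is a morphism of schemes $\phi: Y\to X$ such that the map on underlying spaces is injective and closed, and for each $y\in Y$ the ring map $\phi_y^{\sharp}:\mathscr{O}_{X,\phi(y)}\to\mathscr{O}_{Y,y}$ is surjective. For a scheme $X$, two closed immersions of schemes $\phi: Y\to X$ and $\psi: Z\to X$ are called equivalent, $\phi\sim\psi$, if there is an isomorphism of schemes $\theta: Y\to Z$ with $\phi=\psi\circ\theta$. $M(X)$ denotes the collection of equivalence (isomorphism) classes $[\phi]$ of closed immersions of schemes $\phi$ with target $X$. For a closed immersion $\phi: Y\to X$ and an open $U\subseteq X$, $\phi_U^{\sharp}:\mathscr{O}_X(U)\to\mathscr{O}_Y(\phi^{-1}(U))$ denotes the induced ring map on sections. *)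

theory Defs
  imports "HOL-Analysis.Abstract_Topology" "HOL-Algebra.RingHom"
begin

section \<open>Sheaves of rings and their stalks\<close>

text \<open>A topological space with ring-valued data on its subsets. Only the values of
  \<open>sections\<close> and \<open>restr\<close> at open sets matter; \<open>restr X U V\<close> is the map
  from the sections on \<open>U\<close> to those on \<open>V\<close>, for \<open>V \<subseteq> U\<close>.\<close>

record ('a, 'r) ringed_space =
  space_top :: "'a topology"
  sections :: "'a set \<Rightarrow> 'r ring"
  restr :: "'a set \<Rightarrow> 'a set \<Rightarrow> 'r \<Rightarrow> 'r"

abbreviation points :: "('a, 'r) ringed_space \<Rightarrow> 'a set"
  where "points X \<equiv> topspace (space_top X)"

abbreviation is_open :: "('a, 'r) ringed_space \<Rightarrow> 'a set \<Rightarrow> bool"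
  where "is_open X U \<equiv> openin (space_top X) U"

definition ring_presheaf :: "('a, 'r) ringed_space \<Rightarrow> bool"
  where "ring_presheaf X \<longleftrightarrow>
    (\<forall>U. is_open X U \<longrightarrow> cring (sections X U)) \<and>
    (\<forall>U V. is_open X U \<and> is_open X V \<and> V \<subseteq> U \<longrightarrow>
       restr X U V \<in> ring_hom (sections X U) (sections X V)) \<and>
    (\<forall>U s. is_open X U \<and> s \<in> carrier (sections X U) \<longrightarrow> restr X U U s = s) \<and>
    (\<forall>U V W s. is_open X U \<and> is_open X V \<and> is_open X W \<and> W \<subseteq> V \<and> V \<subseteq> U \<and>
       s \<in> carrier (sections X U) \<longrightarrow> restr X V W (restr X U V s) = restr X U W s)"

text \<open>The empty cover of the empty set is allowed, so that there is exactly one section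
  on the empty set.\<close>

definition ring_sheaf :: "('a, 'r) ringed_space \<Rightarrow> bool"
  where "ring_sheaf X \<longleftrightarrow> ring_presheaf X \<and>
    (\<forall>\<U> s. (\<forall>U\<in>\<U>. is_open X U \<and> s U \<in> carrier (sections X U)) \<and>
       (\<forall>U\<in>\<U>. \<forall>V\<in>\<U>. restr X U (U \<inter> V) (s U) = restr X V (U \<inter> V) (s V)) \<longrightarrow>
       (\<exists>!t. t \<in> carrier (sections X (\<Union>\<U>)) \<and> (\<forall>U\<in>\<U>. restr X (\<Union>\<U>) U t = s U)))"

definition germ :: "('a, 'r) ringed_space \<Rightarrow> 'a \<Rightarrow> 'a set \<Rightarrow> 'r \<Rightarrow> ('a set \<times> 'r) set"
  where "germ X x U s = {(V, t). is_open X V \<and> x \<in> V \<and> t \<in> carrier (sections X V) \<and>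
    (\<exists>W. is_open X W \<and> x \<in> W \<and> W \<subseteq> U \<inter> V \<and> restr X U W s = restr X V W t)}"

text \<open>The direct limit of the rings of sections over the open neighbourhoods of \<open>x\<close>. Since germs
  are equivalence classes, the unions below are unions of equal sets.\<close>

definition stalk :: "('a, 'r) ringed_space \<Rightarrow> 'a \<Rightarrow> ('a set \<times> 'r) set ring"
  where "stalk X x =
    \<lparr>carrier = {germ X x U s | U s. is_open X U \<and> x \<in> U \<and> s \<in> carrier (sections X U)},
     mult = (\<lambda>a b. \<Union>(U, s)\<in>a. \<Union>(V, t)\<in>b. germ X x (U \<inter> V)
       (restr X U (U \<inter> V) s \<otimes>\<^bsub>sections X (U \<inter> V)\<^esub> restr X V (U \<inter> V) t)),
     one = germ X x (points X) \<one>\<^bsub>sections X (points X)\<^esub>,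
     zero = germ X x (points X) \<zero>\<^bsub>sections X (points X)\<^esub>,
     add = (\<lambda>a b. \<Union>(U, s)\<in>a. \<Union>(V, t)\<in>b. germ X x (U \<inter> V)
       (restr X U (U \<inter> V) s \<oplus>\<^bsub>sections X (U \<inter> V)\<^esub> restr X V (U \<inter> V) t))\<rparr>"

section \<open>Locally ringed spaces and their morphisms\<close>

definition local_ring :: "'r ring \<Rightarrow> bool"
  where "local_ring R \<longleftrightarrow> cring R \<and> (\<exists>!I. maximalideal I R)"

definition local_hom :: "'r ring \<Rightarrow> 's ring \<Rightarrow> ('r \<Rightarrow> 's) \<Rightarrow> bool"
  where "local_hom R S h \<longleftrightarrow> h \<in> ring_hom R S \<and>
    (\<forall>I J. maximalideal I R \<and> maximalideal J S \<longrightarrow> h ` I \<subseteq> J)"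

definition locally_ringed_space :: "('a, 'r) ringed_space \<Rightarrow> bool"
  where "locally_ringed_space X \<longleftrightarrow> ring_sheaf X \<and> (\<forall>x\<in>points X. local_ring (stalk X x))"

text \<open>A map from \<open>Y\<close> to \<open>X\<close> consists of a map of points and, for each open \<open>U\<close> in \<open>X\<close>, a map
  from the sections of \<open>X\<close> on \<open>U\<close> to the sections of \<open>Y\<close> on the preimage of \<open>U\<close>.\<close>

record ('b, 's, 'a, 'r) space_map =
  point_map :: "'b \<Rightarrow> 'a"
  section_map :: "'a set \<Rightarrow> 'r \<Rightarrow> 's"

definition preimage ::
    "('b, 's) ringed_space \<Rightarrow> ('b, 's, 'a, 'r) space_map \<Rightarrow> 'a set \<Rightarrow> 'b set"
  where "preimage Y \<phi> U = {y \<in> points Y. point_map \<phi> y \<in> U}"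

definition stalk_map :: "('b, 's) ringed_space \<Rightarrow> ('b, 's, 'a, 'r) space_map \<Rightarrow> 'b \<Rightarrow>
    ('a set \<times> 'r) set \<Rightarrow> ('b set \<times> 's) set"
  where "stalk_map Y \<phi> y a = (\<Union>(U, s)\<in>a. germ Y y (preimage Y \<phi> U) (section_map \<phi> U s))"

definition morphism ::
    "('b, 's) ringed_space \<Rightarrow> ('a, 'r) ringed_space \<Rightarrow> ('b, 's, 'a, 'r) space_map \<Rightarrow> bool"
  where "morphism Y X \<phi> \<longleftrightarrow>
    continuous_map (space_top Y) (space_top X) (point_map \<phi>) \<and>
    (\<forall>U. is_open X U \<longrightarrow>
       section_map \<phi> U \<in> ring_hom (sections X U) (sections Y (preimage Y \<phi> U))) \<and>
    (\<forall>U V s. is_open X U \<and> is_open X V \<and> V \<subseteq> U \<and> s \<in> carrier (sections X U) \<longrightarrow>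
       section_map \<phi> V (restr X U V s) =
       restr Y (preimage Y \<phi> U) (preimage Y \<phi> V) (section_map \<phi> U s)) \<and>
    (\<forall>y\<in>points Y. local_hom (stalk X (point_map \<phi> y)) (stalk Y y) (stalk_map Y \<phi> y))"

text \<open>Functions in HOL are total; equality of morphisms from \<open>Y\<close> to \<open>X\<close> disregards values
  outside the points of \<open>Y\<close> and outside the sections over open subsets of \<open>X\<close>.\<close>

definition morphism_eq :: "('b, 's) ringed_space \<Rightarrow> ('a, 'r) ringed_space \<Rightarrow>
    ('b, 's, 'a, 'r) space_map \<Rightarrow> ('b, 's, 'a, 'r) space_map \<Rightarrow> bool"
  where "morphism_eq Y X \<phi> \<psi> \<longleftrightarrow>
    (\<forall>y\<in>points Y. point_map \<phi> y = point_map \<psi> y) \<and>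
    (\<forall>U s. is_open X U \<and> s \<in> carrier (sections X U) \<longrightarrow> section_map \<phi> U s = section_map \<psi> U s)"

definition identity_map :: "('a, 'r, 'a, 'r) space_map"
  where "identity_map = \<lparr>point_map = id, section_map = (\<lambda>U. id)\<rparr>"

text \<open>\<open>compose_map Z \<psi> \<theta>\<close> is \<open>\<psi>\<close> after \<open>\<theta>\<close>, where \<open>Z\<close> is the target of \<open>\<theta>\<close> and the source of
  \<open>\<psi>\<close>.\<close>

definition compose_map :: "('c, 't) ringed_space \<Rightarrow> ('c, 't, 'a, 'r) space_map \<Rightarrow>
    ('b, 's, 'c, 't) space_map \<Rightarrow> ('b, 's, 'a, 'r) space_map"
  where "compose_map Z \<psi> \<theta> =
    \<lparr>point_map = point_map \<psi> \<circ> point_map \<theta>,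
     section_map = (\<lambda>U. section_map \<theta> (preimage Z \<psi> U) \<circ> section_map \<psi> U)\<rparr>"

definition isomorphism ::
    "('b, 's) ringed_space \<Rightarrow> ('a, 'r) ringed_space \<Rightarrow> ('b, 's, 'a, 'r) space_map \<Rightarrow> bool"
  where "isomorphism Y X \<theta> \<longleftrightarrow> morphism Y X \<theta> \<and>
    (\<exists>\<theta>'. morphism X Y \<theta>' \<and>
       morphism_eq Y Y (compose_map X \<theta>' \<theta>) identity_map \<and>
       morphism_eq X X (compose_map Y \<theta> \<theta>') identity_map)"

section \<open>Affine schemes\<close>

definition zariski_topology :: "'r ring \<Rightarrow> 'r set topology"
  where "zariski_topology A =
    topology (\<lambda>U. \<exists>E. E \<subseteq> carrier A \<and> U = {P. primeideal P A \<and> \<not> E \<subseteq> P})"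

lemma openin_zariski_topology:
  "openin (zariski_topology A) U \<longleftrightarrow>
    (\<exists>E. E \<subseteq> carrier A \<and> U = {P. primeideal P A \<and> \<not> E \<subseteq> P})"
proof -
  let ?D = "\<lambda>E. {P. primeideal P A \<and> \<not> E \<subseteq> P}"
  let ?open = "\<lambda>U. \<exists>E. E \<subseteq> carrier A \<and> U = ?D E"
  have Int: "?D E \<inter> ?D F = ?D {e \<otimes>\<^bsub>A\<^esub> f | e f. e \<in> E \<and> f \<in> F}"
    if EF: "E \<subseteq> carrier A" "F \<subseteq> carrier A" for E F
  proof (rule Set.set_eqI)
    fix P
    show "P \<in> ?D E \<inter> ?D F \<longleftrightarrow> P \<in> ?D {e \<otimes>\<^bsub>A\<^esub> f | e f. e \<in> E \<and> f \<in> F}"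
    proof (cases "primeideal P A")
      case True
      then interpret primeideal P A .
      have mem: "e \<otimes>\<^bsub>A\<^esub> f \<in> P \<longleftrightarrow> e \<in> P \<or> f \<in> P" if "e \<in> E" "f \<in> F" for e f
      proof -
        have "e \<in> carrier A" "f \<in> carrier A" using that EF by auto
        then show ?thesis using I_prime I_l_closed I_r_closed by metis
      qed
      have "\<not> {e \<otimes>\<^bsub>A\<^esub> f | e f. e \<in> E \<and> f \<in> F} \<subseteq> P \<longleftrightarrow> (\<exists>e\<in>E. \<exists>f\<in>F. e \<otimes>\<^bsub>A\<^esub> f \<notin> P)"
        by blast
      also have "\<dots> \<longleftrightarrow> (\<exists>e\<in>E. \<exists>f\<in>F. e \<notin> P \<and> f \<notin> P)"
        using mem by meson
      also have "\<dots> \<longleftrightarrow> \<not> E \<subseteq> P \<and> \<not> F \<subseteq> P"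
        by blast
      finally show ?thesis using True by simp
    qed simp
  qed
  have "istopology ?open"
    unfolding istopology_def
  proof (intro conjI allI impI)
    fix U V assume "?open U" "?open V"
    then obtain E F where E: "E \<subseteq> carrier A" "U = ?D E" and F: "F \<subseteq> carrier A" "V = ?D F"
      by (elim exE conjE)
    show "?open (U \<inter> V)"
    proof (cases "\<exists>P. primeideal P A")
      case True
      then obtain P where "primeideal P A" ..
      then interpret primeideal P A .
      have "{e \<otimes>\<^bsub>A\<^esub> f | e f. e \<in> E \<and> f \<in> F} \<subseteq> carrier A"
        using E(1) F(1) by (auto simp: subset_iff)
      then show ?thesis using Int[OF E(1) F(1)] unfolding E(2) F(2) by (intro exI conjI)
    next
      case False
      then have "U \<inter> V = ?D {}" using E(2) by simp
      then show ?thesis by (intro exI[of _ "{}"] conjI empty_subsetI)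
    qed
  next
    fix \<K> assume "\<forall>U\<in>\<K>. ?open U"
    then have "\<exists>E. \<forall>U\<in>\<K>. E U \<subseteq> carrier A \<and> U = ?D (E U)" by (rule bchoice)
    then obtain E where *: "\<forall>U\<in>\<K>. E U \<subseteq> carrier A \<and> U = ?D (E U)" ..
    have E: "E U \<subseteq> carrier A" "?D (E U) = U" if "U \<in> \<K>" for U
      by (rule conjunct1[OF bspec[OF * that]], rule conjunct2[OF bspec[OF * that], symmetric])
    have "\<Union>\<K> = (\<Union>U\<in>\<K>. ?D (E U))" by (simp only: E(2) cong: SUP_cong) simp
    also have "\<dots> = ?D (\<Union>U\<in>\<K>. E U)" by blast
    finally have "\<Union>\<K> = ?D (\<Union>U\<in>\<K>. E U)" .
    moreover have "(\<Union>U\<in>\<K>. E U) \<subseteq> carrier A" by (rule UN_least) (rule E(1))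
    ultimately show "?open (\<Union>\<K>)" by (intro exI conjI)
  qed
  then show ?thesis unfolding zariski_topology_def by (simp only: topology_inverse')
qed

text \<open>The fraction \<open>a / f\<close> in the localization of \<open>A\<close> at the prime ideal \<open>P\<close>.\<close>

definition fraction :: "'r ring \<Rightarrow> 'r set \<Rightarrow> 'r \<Rightarrow> 'r \<Rightarrow> ('r \<times> 'r) set"
  where "fraction A P a f = {(b, g). b \<in> carrier A \<and> g \<in> carrier A - P \<and>
    (\<exists>h \<in> carrier A - P. h \<otimes>\<^bsub>A\<^esub> (g \<otimes>\<^bsub>A\<^esub> a) = h \<otimes>\<^bsub>A\<^esub> (f \<otimes>\<^bsub>A\<^esub> b))}"

definition localization :: "'r ring \<Rightarrow> 'r set \<Rightarrow> ('r \<times> 'r) set ring"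
  where "localization A P =
    \<lparr>carrier = {fraction A P a f | a f. a \<in> carrier A \<and> f \<in> carrier A - P},
     mult = (\<lambda>x y. \<Union>(a, f)\<in>x. \<Union>(b, g)\<in>y. fraction A P (a \<otimes>\<^bsub>A\<^esub> b) (f \<otimes>\<^bsub>A\<^esub> g)),
     one = fraction A P \<one>\<^bsub>A\<^esub> \<one>\<^bsub>A\<^esub>,
     zero = fraction A P \<zero>\<^bsub>A\<^esub> \<one>\<^bsub>A\<^esub>,
     add = (\<lambda>x y. \<Union>(a, f)\<in>x. \<Union>(b, g)\<in>y.
       fraction A P ((g \<otimes>\<^bsub>A\<^esub> a) \<oplus>\<^bsub>A\<^esub> (f \<otimes>\<^bsub>A\<^esub> b)) (f \<otimes>\<^bsub>A\<^esub> g))\<rparr>"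

text \<open>The structure sheaf: functions into the localizations that are locally quotients of elements
  of \<open>A\<close>.\<close>

definition spec_sections :: "'r ring \<Rightarrow> 'r set set \<Rightarrow> ('r set \<Rightarrow> ('r \<times> 'r) set) ring"
  where "spec_sections A U =
    \<lparr>carrier = {s \<in> (\<Pi>\<^sub>E P\<in>U. carrier (localization A P)).
       \<forall>P\<in>U. \<exists>V a f. openin (zariski_topology A) V \<and> P \<in> V \<and> V \<subseteq> U \<and>
         a \<in> carrier A \<and> f \<in> carrier A \<and> (\<forall>Q\<in>V. f \<notin> Q \<and> s Q = fraction A Q a f)},
     mult = (\<lambda>s t. \<lambda>P\<in>U. s P \<otimes>\<^bsub>localization A P\<^esub> t P),
     one = (\<lambda>P\<in>U. \<one>\<^bsub>localization A P\<^esub>),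
     zero = (\<lambda>P\<in>U. \<zero>\<^bsub>localization A P\<^esub>),
     add = (\<lambda>s t. \<lambda>P\<in>U. s P \<oplus>\<^bsub>localization A P\<^esub> t P)\<rparr>"

definition Spec :: "'r ring \<Rightarrow> ('r set, 'r set \<Rightarrow> ('r \<times> 'r) set) ringed_space"
  where "Spec A = \<lparr>space_top = zariski_topology A, sections = spec_sections A,
    restr = (\<lambda>U V s. restrict s V)\<rparr>"

section \<open>Schemes\<close>

definition open_subspace :: "('a, 'r) ringed_space \<Rightarrow> 'a set \<Rightarrow> ('a, 'r) ringed_space"
  where "open_subspace X U = \<lparr>space_top = subtopology (space_top X) U,
    sections = sections X, restr = restr X\<rparr>"

text \<open>It is no restriction that \<open>A\<close> lives on the type \<open>'r\<close> of sections of \<open>X\<close>: a ring with spectrum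
  \<open>X\<close> is isomorphic to the ring of global sections of \<open>X\<close>.\<close>

definition affine_scheme :: "('a, 'r) ringed_space \<Rightarrow> bool"
  where "affine_scheme X \<longleftrightarrow> (\<exists>(A :: 'r ring) \<theta>. cring A \<and> isomorphism X (Spec A) \<theta>)"

definition affine_open :: "('a, 'r) ringed_space \<Rightarrow> 'a set \<Rightarrow> bool"
  where "affine_open X U \<longleftrightarrow> is_open X U \<and> affine_scheme (open_subspace X U)"

definition scheme :: "('a, 'r) ringed_space \<Rightarrow> bool"
  where "scheme X \<longleftrightarrow> locally_ringed_space X \<and> (\<forall>x\<in>points X. \<exists>U. x \<in> U \<and> affine_open X U)"

definition affine_open_cover :: "('a, 'r) ringed_space \<Rightarrow> 'a set set \<Rightarrow> bool"
  where "affine_open_cover X \<C> \<longleftrightarrow> (\<forall>U\<in>\<C>. affine_open X U) \<and> \<Union>\<C> = points X"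

section \<open>Closed immersions\<close>

definition closed_immersion ::
    "('b, 's) ringed_space \<Rightarrow> ('a, 'r) ringed_space \<Rightarrow> ('b, 's, 'a, 'r) space_map \<Rightarrow> bool"
  where "closed_immersion Y X \<phi> \<longleftrightarrow> scheme Y \<and> scheme X \<and> morphism Y X \<phi> \<and>
    inj_on (point_map \<phi>) (points Y) \<and>
    closed_map (space_top Y) (space_top X) (point_map \<phi>) \<and>
    (\<forall>y\<in>points Y. stalk_map Y \<phi> y ` carrier (stalk X (point_map \<phi> y)) = carrier (stalk Y y))"

text \<open>A closed immersion into \<open>X\<close> is represented together with its source. The type parameters
  \<open>'b\<close> and \<open>'s\<close> for the points and sections of the sources are arbitrary. Sources
  over two different pairs of types can be compared by transporting both to the sum types.\<close>

type_synonym ('b, 's, 'a, 'r) map_into =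
  "('b, 's) ringed_space \<times> ('b, 's, 'a, 'r) space_map"

definition closed_immersions :: "('a, 'r) ringed_space \<Rightarrow> ('b, 's, 'a, 'r) map_into set"
  where "closed_immersions X = {(Y, \<phi>). closed_immersion Y X \<phi>}"

definition immersion_equiv ::
    "('a, 'r) ringed_space \<Rightarrow> (('b, 's, 'a, 'r) map_into \<times> ('b, 's, 'a, 'r) map_into) set"
  where "immersion_equiv X = {((Y, \<phi>), (Z, \<psi>)).
    closed_immersion Y X \<phi> \<and> closed_immersion Z X \<psi> \<and>
    (\<exists>\<theta>. isomorphism Y Z \<theta> \<and> morphism_eq Y X \<phi> (compose_map Z \<psi> \<theta>))}"

definition immersion_class ::
    "('a, 'r) ringed_space \<Rightarrow> ('b, 's, 'a, 'r) map_into \<Rightarrow> ('b, 's, 'a, 'r) map_into set"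
  where "immersion_class X i = immersion_equiv X `` {i}"

definition immersion_classes :: "('a, 'r) ringed_space \<Rightarrow> ('b, 's, 'a, 'r) map_into set set"
  where "immersion_classes X = closed_immersions X // immersion_equiv X"

definition section_kernel ::
    "('b, 's) ringed_space \<Rightarrow> ('a, 'r) ringed_space \<Rightarrow> ('b, 's, 'a, 'r) space_map \<Rightarrow> 'a set \<Rightarrow> 'r set"
  where "section_kernel Y X \<phi> U =
    a_kernel (sections X U) (sections Y (preimage Y \<phi> U)) (section_map \<phi> U)"

text \<open>The map on classes, obtained from the common value on all representatives.\<close>

definition kernel_map ::
    "('a, 'r) ringed_space \<Rightarrow> 'a set set \<Rightarrow> ('b, 's, 'a, 'r) map_into set \<Rightarrow> 'a set \<Rightarrow> 'r set"
  where "kernel_map X \<C> c = (\<lambda>U\<in>\<C>. the_elem ((\<lambda>(Y, \<phi>). section_kernel Y X \<phi> U) ` c))"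

end

theory Submission
  imports Defs "HOL-Algebra.Multiplicative_Group"
begin

text \<open>For an affine open set \<open>U\<close> the ideal \<open>I = Ker \<phi>\<^sub>U\<close> determines everything about \<open>\<phi>\<close> over \<open>U\<close>. Since
  \<open>U\<close> is quasi-compact, a section \<open>a\<close> over \<open>U\<close> whose pullback vanishes on the preimage of \<open>D(f)\<close>
  satisfies \<open>f\<^sup>n a \<in> I\<close> for some \<open>n\<close>. With \<open>a = 1\<close> this shows that \<open>I\<close> determines the image
  of \<open>\<phi>\<close> in \<open>U\<close>; and since every section of \<open>X\<close> near a point of \<open>U\<close> is a quotient of sections over
  \<open>U\<close>, it shows that the ideals over a cover determine the kernels over all open sets. Two closed
  immersions \<open>\<phi>\<close> and \<open>\<psi>\<close> with the same image and the same kernels are isomorphic: the points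
  correspond under \<open>\<psi>\<^bsup>-1\<^esup> \<circ> \<phi>\<close>, and a section of one source, being locally the pullback of a section
  of \<open>X\<close>, corresponds to the section of the other source glued from the pullbacks of the same
  sections of \<open>X\<close>.\<close>

section \<open>Prime ideals and localizations\<close>

text \<open>The obstacle is that nothing is known beforehand about the preimage in the source of an
  affine open set U: it is neither assumed affine nor shown to be quasi-compact, and the kernels are
  not known to be compatible with localization. The statement that some f^n a lies in I takes the
  place of that compatibility. It is proved point by point in affine charts of the source, as a
  computation with fractions. Since \<phi> is injective and closed, an open set found in the source
  is the preimage of an open set of X, so the exponents can be collected over a cover of U itself.
  Points of U off the image have a neighbourhood with empty preimage, where any exponent serves. The
  case a = 1 concerns the image because 1 vanishes over the preimage of D(f) exactly when this
  preimage is empty, the stalks being nonzero rings. Each transfer uses one inclusion of kernels and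
  is applied twice, with the roles exchanged. No quotient of the structure sheaf is formed: sections
  of the two sources are matched by having common local lifts to X.\<close>

lemma (in cring) maximal_ideal_avoiding:
  assumes I: "ideal I R" and disj: "I \<inter> S = {}"
  obtains M where "ideal M R" "I \<subseteq> M" "M \<inter> S = {}"
    "\<And>J. ideal J R \<Longrightarrow> M \<subseteq> J \<Longrightarrow> J \<inter> S = {} \<Longrightarrow> J = M"
proof -
  let ?\<F> = "{J. ideal J R \<and> I \<subseteq> J \<and> J \<inter> S = {}}"
  have "\<exists>M\<in>?\<F>. \<forall>J\<in>?\<F>. M \<subseteq> J \<longrightarrow> J = M"
  proof (rule subset_Zorn_nonempty)
    show "?\<F> \<noteq> {}" using I disj by blast
    fix \<C> assume ne: "\<C> \<noteq> {}" and ch: "subset.chain ?\<F> \<C>"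
    have mem: "\<And>J. J \<in> \<C> \<Longrightarrow> ideal J R \<and> I \<subseteq> J \<and> J \<inter> S = {}"
      and tot: "\<And>J K. J \<in> \<C> \<Longrightarrow> K \<in> \<C> \<Longrightarrow> J \<subseteq> K \<or> K \<subseteq> J"
      using ch unfolding subset_chain_def by blast+
    have "ideal (\<Union>\<C>) R"
    proof (rule idealI[OF ring_axioms])
      show "subgroup (\<Union>\<C>) (add_monoid R)"
      proof (rule add.subgroupI)
        show "\<Union>\<C> \<subseteq> carrier R" using mem ideal.Icarr by fast
        show "\<Union>\<C> \<noteq> {}"
          using ne mem additive_subgroup.zero_closed[OF ideal.axioms(1)] by fast
      next
        fix a assume "a \<in> \<Union>\<C>"
        then show "\<ominus> a \<in> \<Union>\<C>"
          using mem additive_subgroup.a_inv_closed[OF ideal.axioms(1)] by fast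
      next
        fix a b assume "a \<in> \<Union>\<C>" "b \<in> \<Union>\<C>"
        then obtain J where "J \<in> \<C>" "a \<in> J" "b \<in> J" using tot by blast
        then show "a \<oplus> b \<in> \<Union>\<C>"
          using mem additive_subgroup.a_closed[OF ideal.axioms(1)] by fast
      qed
    next
      fix a x assume "a \<in> \<Union>\<C>" "x \<in> carrier R"
      then show "x \<otimes> a \<in> \<Union>\<C>" "a \<otimes> x \<in> \<Union>\<C>"
        using mem by (meson UnionE UnionI ideal.I_l_closed ideal.I_r_closed)+
    qed
    moreover have "I \<subseteq> \<Union>\<C>" using ne mem by (meson Union_upper ex_in_conv order_trans)
    moreover have "\<Union>\<C> \<inter> S = {}" using mem by (simp add: Int_Union2)
    ultimately show "\<Union>\<C> \<in> ?\<F>" by simp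
  qed
  then obtain M where "M \<in> ?\<F>" and max: "\<forall>J\<in>?\<F>. M \<subseteq> J \<longrightarrow> J = M" ..
  then have M: "ideal M R" "I \<subseteq> M" "M \<inter> S = {}" by simp_all
  show ?thesis
  proof (rule that[OF M])
    fix J assume "ideal J R" "M \<subseteq> J" "J \<inter> S = {}"
    then have "J \<in> ?\<F>" using M(2) by auto
    with max \<open>M \<subseteq> J\<close> show "J = M" by blast
  qed
qed

text \<open>An ideal \<open>M\<close> maximal among those missing a multiplicative set is prime: if
  \<open>a\<close> and \<open>b\<close> lie outside \<open>M\<close>, then both M + (a) and M + (b)
  meet \<open>S\<close>, and the product of the two elements of \<open>S\<close> would lie in
  \<open>M\<close> as soon as ab does.\<close>

lemma (in cring) prime_avoiding:
  assumes I: "ideal I R" and disj: "I \<inter> S = {}"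
    and S: "S \<subseteq> carrier R" "\<one> \<in> S" "\<And>s t. s \<in> S \<Longrightarrow> t \<in> S \<Longrightarrow> s \<otimes> t \<in> S"
  obtains P where "primeideal P R" "I \<subseteq> P" "P \<inter> S = {}"
proof -
  obtain M where M: "ideal M R" "I \<subseteq> M" "M \<inter> S = {}"
    "\<And>J. ideal J R \<Longrightarrow> M \<subseteq> J \<Longrightarrow> J \<inter> S = {} \<Longrightarrow> J = M"
    using maximal_ideal_avoiding[OF I disj] by blast
  interpret M: ideal M R by (rule M)
  have hit: "\<exists>m\<in>M. \<exists>x\<in>carrier R. m \<oplus> x \<otimes> a \<in> S" if "a \<in> carrier R" "a \<notin> M" for a
  proof (rule ccontr)
    assume none: "\<not> ?thesis"
    let ?J = "M <+>\<^bsub>R\<^esub> PIdl a"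
    have J: "ideal ?J R" by (rule add_ideals[OF M(1) cgenideal_ideal[OF that(1)]])
    have Jel: "y \<in> ?J \<longleftrightarrow> (\<exists>m\<in>M. \<exists>x\<in>carrier R. y = m \<oplus> x \<otimes> a)" for y
      unfolding set_add_def' cgenideal_def by blast
    have "M \<subseteq> ?J"
    proof
      fix m assume "m \<in> M"
      moreover from this have "m = m \<oplus> \<zero> \<otimes> a" using M.Icarr that by simp
      ultimately show "m \<in> ?J" unfolding Jel by blast
    qed
    moreover have "?J \<inter> S = {}"
    proof (rule equals0I)
      fix y assume "y \<in> ?J \<inter> S"
      with none show False unfolding Int_iff Jel by auto
    qed
    ultimately have "?J = M" using M(4) J by blast
    moreover have "a \<in> ?J"
    proof -
      have "a = \<zero> \<oplus> \<one> \<otimes> a" using that by simp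
      then show ?thesis unfolding Jel using M.zero_closed by blast
    qed
    ultimately show False using that by blast
  qed
  have "primeideal M R"
  proof (rule primeidealI[OF M(1) is_cring])
    show "carrier R \<noteq> M" using M(3) S(1,2) by blast
    fix a b assume ab: "a \<in> carrier R" "b \<in> carrier R" "a \<otimes> b \<in> M"
    show "a \<in> M \<or> b \<in> M"
    proof (rule ccontr)
      assume "\<not> ?thesis"
      then obtain m x n y where h: "m \<in> M" "x \<in> carrier R" "m \<oplus> x \<otimes> a \<in> S"
        "n \<in> M" "y \<in> carrier R" "n \<oplus> y \<otimes> b \<in> S" using hit ab by meson
      have c: "m \<in> carrier R" "n \<in> carrier R" using h M.Icarr by auto
      \<comment> \<open>The terms are grouped so that each contains \<open>m\<close>,
        \<open>n\<close> or the product ab as a factor.\<close>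
      have "(m \<oplus> x \<otimes> a) \<otimes> (n \<oplus> y \<otimes> b) =
          m \<otimes> (n \<oplus> y \<otimes> b) \<oplus> ((x \<otimes> a) \<otimes> n \<oplus> (x \<otimes> y) \<otimes> (a \<otimes> b))"
        using h(2,5) c ab by algebra
      also have "\<dots> \<in> M"
        using h(2,5) c ab(1,2)
        by (intro M.a_closed M.I_r_closed[OF h(1)] M.I_l_closed[OF h(4)] M.I_l_closed[OF ab(3)]) auto
      finally show False using S(3)[OF h(3,6)] M(3) by blast
    qed
  qed
  then show ?thesis using that M by blast
qed

text \<open>The case S = {1} of \<open>maximal_ideal_avoiding\<close>, which for this reason lets
  \<open>S\<close> be any set: an ideal that is maximal among those missing 1 is a maximal
  ideal.\<close>

lemma (in cring) nonunit_in_maximalideal: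
  assumes a: "a \<in> carrier R" and n: "\<And>b. b \<in> carrier R \<Longrightarrow> a \<otimes> b \<noteq> \<one>"
  obtains M where "maximalideal M R" "a \<in> M"
proof -
  have el: "y \<in> PIdl a \<longleftrightarrow> (\<exists>x\<in>carrier R. y = x \<otimes> a)" for y
    unfolding cgenideal_def by blast
  have "PIdl a \<inter> {\<one>} = {}" using n a m_comm el by (metis disjoint_insert(1) inf_bot_right)
  then obtain M where M: "ideal M R" "PIdl a \<subseteq> M" "M \<inter> {\<one>} = {}"
    "\<And>J. ideal J R \<Longrightarrow> M \<subseteq> J \<Longrightarrow> J \<inter> {\<one>} = {} \<Longrightarrow> J = M"
    using maximal_ideal_avoiding[OF cgenideal_ideal[OF a]] by blast
  have "maximalideal M R"
  proof (rule maximalidealI[OF M(1)])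
    show "carrier R \<noteq> M" using M(3) by auto
    fix J assume "ideal J R" "M \<subseteq> J"
    then show "J = M \<or> J = carrier R" using M(4) ideal.one_imp_carrier by auto
  qed
  moreover have "a \<in> M" using cgenideal_self[OF a] M(2) by blast
  ultimately show ?thesis using that by blast
qed

text \<open>Otherwise some prime ideal contains the annihilator of \<open>b\<close> and avoids the powers of \<open>f\<close>.\<close>

lemma (in cring) power_annihilates:
  assumes f: "f \<in> carrier R" and b: "b \<in> carrier R"
    and loc: "\<And>P. primeideal P R \<Longrightarrow> f \<notin> P \<Longrightarrow> \<exists>q\<in>carrier R - P. q \<otimes> b = \<zero>"
  obtains n :: nat where "f [^] n \<otimes> b = \<zero>"
proof (rule ccontr)
  assume none: "\<not> thesis"
  let ?I = "{q \<in> carrier R. q \<otimes> b = \<zero>}" and ?S = "{f [^] n | n::nat. True}"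
  have I: "ideal ?I R"
  proof (rule idealI[OF ring_axioms])
    show "subgroup ?I (add_monoid R)"
    proof (rule add.subgroupI)
      show "?I \<noteq> {}" using b l_null by blast
    qed (use b in \<open>auto simp: l_minus l_distr\<close>)
  qed (use b in \<open>auto simp: m_assoc, metis m_lcomm r_null\<close>)
  have "?I \<inter> ?S = {}" using none that by blast
  then obtain P where P: "primeideal P R" "?I \<subseteq> P" "P \<inter> ?S = {}"
  proof (rule prime_avoiding[OF I])
    show "?S \<subseteq> carrier R" using f by blast
    show "\<one> \<in> ?S" by (rule CollectI, rule exI[of _ 0]) simp
    show "s \<otimes> t \<in> ?S" if "s \<in> ?S" "t \<in> ?S" for s t
      using that nat_pow_mult[OF f] by blast
  qed
  have "f [^] (1::nat) \<in> ?S" by blast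
  then have "f \<notin> P" using P(3) f by auto
  then show False using loc[OF P(1)] P(2) by blast
qed

section \<open>Fractions at a prime ideal\<close>

lemma (in primeideal) one_notin: "\<one> \<notin> I"
  using one_imp_carrier I_notcarr by blast

lemma (in primeideal) mult_notin:
  "a \<in> carrier R - I \<Longrightarrow> b \<in> carrier R - I \<Longrightarrow> a \<otimes> b \<in> carrier R - I"
  using I_prime by blast

text \<open>A prime ideal regarded as a point of the spectrum: \<open>primeideal\<close> with the
  names used in \<open>fraction\<close> and with \<open>A\<close> as the implicit structure.\<close>

locale spec_point = primeideal P A for P and A :: "'r ring" (structure)

text \<open>A fraction is by definition the set of all pairs related to (a, f), so the point is that
  this relation is an equivalence; the work lies in transitivity.\<close>

lemma (in spec_point) fraction_eq_iff:
  assumes "a \<in> carrier A" "f \<in> carrier A - P" "b \<in> carrier A" "g \<in> carrier A - P"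
  shows "fraction A P a f = fraction A P b g \<longleftrightarrow>
    (\<exists>h \<in> carrier A - P. h \<otimes> (g \<otimes> a) = h \<otimes> (f \<otimes> b))"
proof
  assume "fraction A P a f = fraction A P b g"
  moreover have "(b, g) \<in> fraction A P b g"
    using assms one_notin unfolding fraction_def by blast
  ultimately show "\<exists>h \<in> carrier A - P. h \<otimes> (g \<otimes> a) = h \<otimes> (f \<otimes> b)"
    unfolding fraction_def by blast
next
  assume "\<exists>h \<in> carrier A - P. h \<otimes> (g \<otimes> a) = h \<otimes> (f \<otimes> b)"
  then obtain h where h: "h \<in> carrier A - P" "h \<otimes> (g \<otimes> a) = h \<otimes> (f \<otimes> b)" by blast
  have sub: "fraction A P a f \<subseteq> fraction A P b g"
    if "a \<in> carrier A" "f \<in> carrier A - P" "b \<in> carrier A" "g \<in> carrier A - P"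
      "h \<otimes> (g \<otimes> a) = h \<otimes> (f \<otimes> b)" for a f b g
  proof (clarsimp simp: fraction_def)
    fix c k q assume c: "c \<in> carrier A" "k \<in> carrier A" "k \<notin> P" "q \<in> carrier A" "q \<notin> P"
      "q \<otimes> (k \<otimes> a) = q \<otimes> (f \<otimes> c)"
    note car = c(1,2,4) h(1)[THEN DiffD1] that(1,3) that(2,4)[THEN DiffD1]
    \<comment> \<open>The multiplier qhf lets the relation for (a, f) and (b, g), witnessed by
      \<open>h\<close>, be composed with the one for (a, f) and (c, k), witnessed by
      \<open>q\<close>.\<close>
    have "(q \<otimes> h \<otimes> f) \<otimes> (k \<otimes> b) = (q \<otimes> k) \<otimes> (h \<otimes> (f \<otimes> b))" using car by algebra
    also have "\<dots> = (q \<otimes> k) \<otimes> (h \<otimes> (g \<otimes> a))" using that by simp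
    also have "\<dots> = (h \<otimes> g) \<otimes> (q \<otimes> (k \<otimes> a))" using car by algebra
    also have "\<dots> = (h \<otimes> g) \<otimes> (q \<otimes> (f \<otimes> c))" using c by simp
    also have "\<dots> = (q \<otimes> h \<otimes> f) \<otimes> (g \<otimes> c)" using car by algebra
    finally have "(q \<otimes> h \<otimes> f) \<otimes> (k \<otimes> b) = (q \<otimes> h \<otimes> f) \<otimes> (g \<otimes> c)" .
    moreover have "q \<otimes> h \<otimes> f \<in> carrier A - P" using c h that by (intro mult_notin) auto
    ultimately show "\<exists>h\<in>carrier A - P. h \<otimes> (k \<otimes> b) = h \<otimes> (g \<otimes> c)" by blast
  qed
  show "fraction A P a f = fraction A P b g"
    using sub[OF assms h(2)] sub[OF assms(3,4,1,2) h(2)[symmetric]] by blast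
qed

lemma (in spec_point) fraction_mem:
  assumes "(b, g) \<in> fraction A P a f" "a \<in> carrier A" "f \<in> carrier A - P"
  shows "b \<in> carrier A" "g \<in> carrier A - P" "fraction A P b g = fraction A P a f"
proof -
  show bg: "b \<in> carrier A" "g \<in> carrier A - P" using assms(1) unfolding fraction_def by auto
  show "fraction A P b g = fraction A P a f"
    using assms(1) unfolding fraction_eq_iff[OF bg assms(2,3)] unfolding fraction_def
    by (auto intro: sym)
qed

lemma (in spec_point) fraction_self:
  assumes "a \<in> carrier A" "f \<in> carrier A - P"
  shows "(a, f) \<in> fraction A P a f"
  using assms one_notin unfolding fraction_def by blast

text \<open>The product in \<open>localization\<close> is a union over all representatives of both
  factors; it collapses because every pair of representatives yields the same fraction, the two
  witnesses being multiplied.\<close>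

lemma (in spec_point) fraction_mult:
  assumes "a \<in> carrier A" "f \<in> carrier A - P" "b \<in> carrier A" "g \<in> carrier A - P"
  shows "fraction A P a f \<otimes>\<^bsub>localization A P\<^esub> fraction A P b g = fraction A P (a \<otimes> b) (f \<otimes> g)"
proof -
  have eq: "fraction A P (c \<otimes> d) (k \<otimes> l) = fraction A P (a \<otimes> b) (f \<otimes> g)"
    if "(c, k) \<in> fraction A P a f" "(d, l) \<in> fraction A P b g" for c k d l
  proof -
    note c = fraction_mem[OF that(1) assms(1,2)] and d = fraction_mem[OF that(2) assms(3,4)]
    obtain h where h: "h \<in> carrier A - P" "h \<otimes> (f \<otimes> c) = h \<otimes> (k \<otimes> a)"
      using c fraction_eq_iff[OF c(1,2) assms(1,2)] by blast
    obtain q where q: "q \<in> carrier A - P" "q \<otimes> (g \<otimes> d) = q \<otimes> (l \<otimes> b)"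
      using d fraction_eq_iff[OF d(1,2) assms(3,4)] by blast
    note car = h(1)[THEN DiffD1] q(1)[THEN DiffD1] assms(1,3) assms(2,4)[THEN DiffD1]
      c(1) d(1) c(2)[THEN DiffD1] d(2)[THEN DiffD1]
    have "(h \<otimes> q) \<otimes> ((f \<otimes> g) \<otimes> (c \<otimes> d)) = (h \<otimes> (f \<otimes> c)) \<otimes> (q \<otimes> (g \<otimes> d))"
      using car by algebra
    also have "\<dots> = (h \<otimes> (k \<otimes> a)) \<otimes> (q \<otimes> (l \<otimes> b))" using h q by simp
    also have "\<dots> = (h \<otimes> q) \<otimes> ((k \<otimes> l) \<otimes> (a \<otimes> b))" using car by algebra
    finally have "(h \<otimes> q) \<otimes> ((f \<otimes> g) \<otimes> (c \<otimes> d)) = (h \<otimes> q) \<otimes> ((k \<otimes> l) \<otimes> (a \<otimes> b))" .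
    then show ?thesis
      using mult_notin[OF h(1) q(1)] c d assms
      by (subst fraction_eq_iff) (auto dest: I_prime)
  qed
  have "fraction A P a f \<otimes>\<^bsub>localization A P\<^esub> fraction A P b g =
    (\<Union>x\<in>fraction A P a f. \<Union>y\<in>fraction A P b g. fraction A P (fst x \<otimes> fst y) (snd x \<otimes> snd y))"
    unfolding localization_def by (simp add: case_prod_beta)
  also have "\<dots> = (\<Union>x\<in>fraction A P a f. \<Union>y\<in>fraction A P b g. fraction A P (a \<otimes> b) (f \<otimes> g))"
    using eq by (intro SUP_cong refl) auto
  also have "\<dots> = fraction A P (a \<otimes> b) (f \<otimes> g)"
    using fraction_self[OF assms(1,2)] fraction_self[OF assms(3,4)] by blast
  finally show ?thesis .
qed

text \<open>The one sum of fractions that has to be evaluated: a section z with z + z = z must be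
  zero, and this is how the zero section is recognized in a chart.\<close>

lemma (in spec_point) zero_fraction_add:
  "fraction A P \<zero> \<one> \<oplus>\<^bsub>localization A P\<^esub> fraction A P \<zero> \<one> = fraction A P \<zero> \<one>"
proof -
  let ?z = "fraction A P \<zero> \<one>"
  have one: "\<one> \<in> carrier A - P" using one_notin by simp
  have eq: "fraction A P ((l \<otimes> c) \<oplus> (k \<otimes> d)) (k \<otimes> l) = ?z"
    if "(c, k) \<in> ?z" "(d, l) \<in> ?z" for c k d l
  proof -
    note c = fraction_mem[OF that(1) zero_closed one] and d = fraction_mem[OF that(2) zero_closed one]
    obtain h where h: "h \<in> carrier A - P" "h \<otimes> c = \<zero>"
      using c fraction_eq_iff[OF c(1,2) zero_closed one] by auto
    obtain q where q: "q \<in> carrier A - P" "q \<otimes> d = \<zero>"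
      using d fraction_eq_iff[OF d(1,2) zero_closed one] by auto
    note car = h(1)[THEN DiffD1] q(1)[THEN DiffD1] c(1) d(1) c(2)[THEN DiffD1] d(2)[THEN DiffD1]
    have "(h \<otimes> q) \<otimes> ((l \<otimes> c) \<oplus> (k \<otimes> d)) = (q \<otimes> l) \<otimes> (h \<otimes> c) \<oplus> (h \<otimes> k) \<otimes> (q \<otimes> d)"
      using car by algebra
    also have "\<dots> = \<zero>" using h q car by simp
    finally have "(h \<otimes> q) \<otimes> (\<one> \<otimes> ((l \<otimes> c) \<oplus> (k \<otimes> d))) = (h \<otimes> q) \<otimes> ((k \<otimes> l) \<otimes> \<zero>)"
      using car by simp
    then show ?thesis
      using mult_notin[OF h(1) q(1)] mult_notin[OF c(2) d(2)] c d one
      by (subst fraction_eq_iff) auto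
  qed
  have "?z \<oplus>\<^bsub>localization A P\<^esub> ?z =
    (\<Union>x\<in>?z. \<Union>y\<in>?z. fraction A P ((snd y \<otimes> fst x) \<oplus> (snd x \<otimes> fst y)) (snd x \<otimes> snd y))"
    unfolding localization_def by (simp add: case_prod_beta)
  also have "\<dots> = (\<Union>x\<in>?z. \<Union>y\<in>?z. ?z)"
    using eq by (intro SUP_cong refl) auto
  also have "\<dots> = ?z" using fraction_self[OF zero_closed one] by blast
  finally show ?thesis .
qed

section \<open>Presheaves, stalks and local rings\<close>

locale presheaf =
  fixes X :: "('a, 'r) ringed_space"
  assumes ring_presheaf: "ring_presheaf X"
begin

lemma sections_cring: "is_open X U \<Longrightarrow> cring (sections X U)"
  using ring_presheaf[unfolded ring_presheaf_def, THEN conjunct1] by simp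

lemma sections_ring: "is_open X U \<Longrightarrow> ring (sections X U)"
  by (rule cring.axioms(1)[OF sections_cring])

lemma restr_hom:
  "is_open X U \<Longrightarrow> is_open X V \<Longrightarrow> V \<subseteq> U \<Longrightarrow> restr X U V \<in> ring_hom (sections X U) (sections X V)"
  using ring_presheaf[unfolded ring_presheaf_def, THEN conjunct2, THEN conjunct1] by simp

lemma restr_closed:
  "is_open X U \<Longrightarrow> is_open X V \<Longrightarrow> V \<subseteq> U \<Longrightarrow> s \<in> carrier (sections X U) \<Longrightarrow>
    restr X U V s \<in> carrier (sections X V)"
  by (rule ring_hom_closed[OF restr_hom])

lemma restr_mult:
  "is_open X U \<Longrightarrow> is_open X V \<Longrightarrow> V \<subseteq> U \<Longrightarrow> s \<in> carrier (sections X U) \<Longrightarrow>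
    t \<in> carrier (sections X U) \<Longrightarrow>
    restr X U V (s \<otimes>\<^bsub>sections X U\<^esub> t) = restr X U V s \<otimes>\<^bsub>sections X V\<^esub> restr X U V t"
  by (rule ring_hom_mult[OF restr_hom])

lemma restr_add:
  "is_open X U \<Longrightarrow> is_open X V \<Longrightarrow> V \<subseteq> U \<Longrightarrow> s \<in> carrier (sections X U) \<Longrightarrow>
    t \<in> carrier (sections X U) \<Longrightarrow>
    restr X U V (s \<oplus>\<^bsub>sections X U\<^esub> t) = restr X U V s \<oplus>\<^bsub>sections X V\<^esub> restr X U V t"
  by (rule ring_hom_add[OF restr_hom])

lemma restr_one:
  "is_open X U \<Longrightarrow> is_open X V \<Longrightarrow> V \<subseteq> U \<Longrightarrow> restr X U V \<one>\<^bsub>sections X U\<^esub> = \<one>\<^bsub>sections X V\<^esub>"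
  by (rule ring_hom_one[OF restr_hom])

lemma restr_zero:
  "is_open X U \<Longrightarrow> is_open X V \<Longrightarrow> V \<subseteq> U \<Longrightarrow> restr X U V \<zero>\<^bsub>sections X U\<^esub> = \<zero>\<^bsub>sections X V\<^esub>"
  by (rule ring_hom_zero[OF restr_hom sections_ring sections_ring])

lemma restr_id: "is_open X U \<Longrightarrow> s \<in> carrier (sections X U) \<Longrightarrow> restr X U U s = s"
  using ring_presheaf[unfolded ring_presheaf_def, THEN conjunct2, THEN conjunct2, THEN conjunct1] by simp

lemma restr_restr:
  "is_open X U \<Longrightarrow> is_open X V \<Longrightarrow> is_open X W \<Longrightarrow> W \<subseteq> V \<Longrightarrow> V \<subseteq> U \<Longrightarrow>
    s \<in> carrier (sections X U) \<Longrightarrow> restr X V W (restr X U V s) = restr X U W s"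
  using ring_presheaf[unfolded ring_presheaf_def, THEN conjunct2, THEN conjunct2, THEN conjunct2] by simp

section \<open>Germs and the ring structure of stalks\<close>

lemma restr_eq_mono:
  assumes "is_open X U" "is_open X U'" "is_open X V" "is_open X W" "W \<subseteq> V" "V \<subseteq> U \<inter> U'"
    and "s \<in> carrier (sections X U)" "t \<in> carrier (sections X U')"
    and "restr X U V s = restr X U' V t"
  shows "restr X U W s = restr X U' W t"
proof -
  have "restr X U W s = restr X V W (restr X U V s)" using assms restr_restr[of U V W s] by simp
  also have "\<dots> = restr X U' W t" using assms restr_restr[of U' V W t] by simp
  finally show ?thesis .
qed

text \<open>A germ is the set of all pairs agreeing with (U, s) near \<open>x\<close>; the relation
  is transitive because two neighbourhoods of agreement can be intersected.\<close>

lemma germ_eq_iff: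
  assumes "is_open X U" "x \<in> U" "s \<in> carrier (sections X U)"
    and "is_open X V" "x \<in> V" "t \<in> carrier (sections X V)"
  shows "germ X x U s = germ X x V t \<longleftrightarrow>
    (\<exists>W. is_open X W \<and> x \<in> W \<and> W \<subseteq> U \<inter> V \<and> restr X U W s = restr X V W t)"
proof
  have "(V, t) \<in> germ X x V t" unfolding germ_def using assms by blast
  then show "\<exists>W. is_open X W \<and> x \<in> W \<and> W \<subseteq> U \<inter> V \<and> restr X U W s = restr X V W t"
    if "germ X x U s = germ X x V t"
  proof -
    have "(V, t) \<in> germ X x U s" using \<open>(V, t) \<in> germ X x V t\<close> that by simp
    then show ?thesis unfolding germ_def by simp
  qed
next
  have sub: "germ X x U s \<subseteq> germ X x V t"
    if *: "is_open X U" "s \<in> carrier (sections X U)" "is_open X V" "t \<in> carrier (sections X V)"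
    "is_open X W" "x \<in> W" "W \<subseteq> U \<inter> V" "restr X U W s = restr X V W t" for U V W s t
  proof (clarsimp simp: germ_def)
    fix T u W' assume h: "is_open X T" "x \<in> T" "u \<in> carrier (sections X T)"
      "is_open X W'" "x \<in> W'" "W' \<subseteq> U" "W' \<subseteq> T" "restr X U W' s = restr X T W' u"
    have "restr X V (W \<inter> W') t = restr X U (W \<inter> W') s"
      using * h by (intro restr_eq_mono[of V U W "W \<inter> W'"]) auto
    also have "\<dots> = restr X T (W \<inter> W') u"
      using * h by (intro restr_eq_mono[of U T W' "W \<inter> W'"]) auto
    finally show "\<exists>W. is_open X W \<and> x \<in> W \<and> W \<subseteq> V \<and> W \<subseteq> T \<and> restr X V W t = restr X T W u"
      using * h by (intro exI[of _ "W \<inter> W'"]) auto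
  qed
  assume "\<exists>W. is_open X W \<and> x \<in> W \<and> W \<subseteq> U \<inter> V \<and> restr X U W s = restr X V W t"
  then obtain W where W: "is_open X W" "x \<in> W" "W \<subseteq> U \<inter> V" "restr X U W s = restr X V W t"
    by blast
  show "germ X x U s = germ X x V t"
    using sub[OF assms(1,3,4,6) W] sub[OF assms(4,6,1,3) W(1,2) _ W(4)[symmetric]] W(3) by blast
qed

lemma germ_mem:
  assumes "(V, t) \<in> germ X x U s" "is_open X U" "x \<in> U" "s \<in> carrier (sections X U)"
  shows "is_open X V" "x \<in> V" "t \<in> carrier (sections X V)" "germ X x V t = germ X x U s"
proof -
  show *: "is_open X V" "x \<in> V" "t \<in> carrier (sections X V)"
    using assms(1) unfolding germ_def by auto
  show "germ X x V t = germ X x U s"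
    unfolding germ_eq_iff[OF * assms(2-4)] using assms(1) unfolding germ_def
    by (simp add: Int_commute) metis
qed

lemma germ_self:
  "is_open X U \<Longrightarrow> x \<in> U \<Longrightarrow> s \<in> carrier (sections X U) \<Longrightarrow> (U, s) \<in> germ X x U s"
  unfolding germ_def by blast

lemma germ_restr:
  assumes "is_open X U" "is_open X W" "W \<subseteq> U" "x \<in> W" "s \<in> carrier (sections X U)"
  shows "germ X x W (restr X U W s) = germ X x U s"
  using assms by (subst germ_eq_iff) (auto simp: restr_closed restr_id restr_restr)

lemma germ_in_stalk:
  "is_open X U \<Longrightarrow> x \<in> U \<Longrightarrow> s \<in> carrier (sections X U) \<Longrightarrow> germ X x U s \<in> carrier (stalk X x)"
  unfolding stalk_def by auto

lemma in_stalkE: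
  assumes "a \<in> carrier (stalk X x)"
  obtains U s where "is_open X U" "x \<in> U" "s \<in> carrier (sections X U)" "a = germ X x U s"
  using assms unfolding stalk_def by auto

text \<open>Bringing two germs over one neighbourhood reduces computations in the stalk to a single
  ring of sections.\<close>

lemma in_stalkE2:
  assumes "a \<in> carrier (stalk X x)" "b \<in> carrier (stalk X x)"
  obtains U s t where "is_open X U" "x \<in> U" "s \<in> carrier (sections X U)"
    "t \<in> carrier (sections X U)" "a = germ X x U s" "b = germ X x U t"
proof -
  obtain U s where U: "is_open X U" "x \<in> U" "s \<in> carrier (sections X U)" "a = germ X x U s"
    using in_stalkE[OF assms(1)] .
  obtain V t where V: "is_open X V" "x \<in> V" "t \<in> carrier (sections X V)" "b = germ X x V t"
    using in_stalkE[OF assms(2)] .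
  show ?thesis
    by (rule that[of "U \<inter> V" "restr X U (U \<inter> V) s" "restr X V (U \<inter> V) t"])
      (use U V in \<open>auto simp: restr_closed germ_restr openin_Int\<close>)
qed

text \<open>Sum and product in \<open>stalk\<close> are unions of the same shape, so both are
  treated as one family \<open>b\<close> of operations commuting with restriction. Any
  representatives agree with \<open>s\<close> and \<open>t\<close> on a small enough neighbourhood,
  where all members of the union therefore have the same germ.\<close>

lemma germ_op:
  assumes U: "is_open X U" "x \<in> U" "s \<in> carrier (sections X U)" "t \<in> carrier (sections X U)"
    and closed: "\<And>W s t. is_open X W \<Longrightarrow> s \<in> carrier (sections X W) \<Longrightarrow>
      t \<in> carrier (sections X W) \<Longrightarrow> b W s t \<in> carrier (sections X W)"
    and nat: "\<And>V W s t. is_open X V \<Longrightarrow> is_open X W \<Longrightarrow> W \<subseteq> V \<Longrightarrow> s \<in> carrier (sections X V) \<Longrightarrow>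
      t \<in> carrier (sections X V) \<Longrightarrow> restr X V W (b V s t) = b W (restr X V W s) (restr X V W t)"
  shows "(\<Union>(V, u)\<in>germ X x U s. \<Union>(W, v)\<in>germ X x U t.
      germ X x (V \<inter> W) (b (V \<inter> W) (restr X V (V \<inter> W) u) (restr X W (V \<inter> W) v))) =
    germ X x U (b U s t)"
proof -
  have eq: "germ X x (V \<inter> W) (b (V \<inter> W) (restr X V (V \<inter> W) u) (restr X W (V \<inter> W) v)) =
      germ X x U (b U s t)"
    if u: "(V, u) \<in> germ X x U s" and v: "(W, v) \<in> germ X x U t" for V u W v
  proof -
    note V = germ_mem[OF u U(1,2,3)] and W = germ_mem[OF v U(1,2,4)]
    obtain N where N: "is_open X N" "x \<in> N" "N \<subseteq> V \<inter> U" "restr X V N u = restr X U N s"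
      using V(4) germ_eq_iff[OF V(1-3) U(1-3)] by blast
    obtain M where M: "is_open X M" "x \<in> M" "M \<subseteq> W \<inter> U" "restr X W M v = restr X U M t"
      using W(4) germ_eq_iff[OF W(1-3) U(1,2,4)] by blast
    let ?P = "N \<inter> M"
    have P: "is_open X ?P" "?P \<subseteq> V \<inter> W" "?P \<subseteq> U" "x \<in> ?P" using N M by auto
    have "restr X V ?P u = restr X U ?P s"
      using N V(1-3) U P by (intro restr_eq_mono[of V U N ?P]) auto
    moreover have "restr X W ?P v = restr X U ?P t"
      using M W(1-3) U P by (intro restr_eq_mono[of W U M ?P]) auto
    ultimately have "restr X (V \<inter> W) ?P (b (V \<inter> W) (restr X V (V \<inter> W) u) (restr X W (V \<inter> W) v)) =
        restr X U ?P (b U s t)"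
      using P U V(1-3) W(1-3) by (simp add: nat restr_closed restr_restr openin_Int)
    then show ?thesis
      using P U V(1-3) W(1-3) closed
      by (subst germ_eq_iff) (auto simp: restr_closed openin_Int)
  qed
  \<comment> \<open>A union of equal sets has their common value only over a nonempty index set; (U,
    s) and (U, t) show that both germs are nonempty.\<close>
  have "(\<Union>p\<in>germ X x U s. \<Union>q\<in>germ X x U t. F p q) = germ X x U (b U s t)"
    if "\<And>V u W v. (V, u) \<in> germ X x U s \<Longrightarrow> (W, v) \<in> germ X x U t \<Longrightarrow>
      F (V, u) (W, v) = germ X x U (b U s t)" for F
  proof -
    have "(\<Union>p\<in>germ X x U s. \<Union>q\<in>germ X x U t. F p q) =
        (\<Union>p\<in>germ X x U s. \<Union>q\<in>germ X x U t. germ X x U (b U s t))"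
      using that by (intro SUP_cong refl) auto
    also have "\<dots> = germ X x U (b U s t)"
      using germ_self[OF U(1,2,3)] germ_self[OF U(1,2,4)] by blast
    finally show ?thesis .
  qed
  from this[of "\<lambda>(V, u) (W, v). germ X x (V \<inter> W)
    (b (V \<inter> W) (restr X V (V \<inter> W) u) (restr X W (V \<inter> W) v))"]
  show ?thesis using eq by (simp add: case_prod_beta)
qed

lemma germ_mult:
  assumes "is_open X U" "x \<in> U" "s \<in> carrier (sections X U)" "t \<in> carrier (sections X U)"
  shows "germ X x U s \<otimes>\<^bsub>stalk X x\<^esub> germ X x U t = germ X x U (s \<otimes>\<^bsub>sections X U\<^esub> t)"
  using germ_op[OF assms, of "\<lambda>W. mult (sections X W)"] sections_ring
  by (simp add: stalk_def restr_mult monoid.m_closed ring.is_monoid)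

lemma germ_add:
  assumes "is_open X U" "x \<in> U" "s \<in> carrier (sections X U)" "t \<in> carrier (sections X U)"
  shows "germ X x U s \<oplus>\<^bsub>stalk X x\<^esub> germ X x U t = germ X x U (s \<oplus>\<^bsub>sections X U\<^esub> t)"
  using germ_op[OF assms, of "\<lambda>W. add (sections X W)"] sections_ring
  by (simp add: stalk_def restr_add abelian_monoid.a_closed abelian_group.axioms(1) ring.axioms(1))

lemma germ_one:
  assumes "is_open X U" "x \<in> U"
  shows "\<one>\<^bsub>stalk X x\<^esub> = germ X x U \<one>\<^bsub>sections X U\<^esub>"
  using germ_restr[of "points X" U x "\<one>\<^bsub>sections X (points X)\<^esub>"] assms sections_ring
  by (simp add: stalk_def restr_one openin_subset ring.ring_simprules)

lemma germ_zero:
  assumes "is_open X U" "x \<in> U"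
  shows "\<zero>\<^bsub>stalk X x\<^esub> = germ X x U \<zero>\<^bsub>sections X U\<^esub>"
  using germ_restr[of "points X" U x "\<zero>\<^bsub>sections X (points X)\<^esub>"] assms sections_ring
  by (simp add: stalk_def restr_zero openin_subset ring.ring_simprules)

end

section \<open>Local equality and gluing of sections\<close>

locale sheaf =
  fixes X :: "('a, 'r) ringed_space"
  assumes ring_sheaf: "ring_sheaf X"

sublocale sheaf \<subseteq> presheaf
  using ring_sheaf unfolding ring_sheaf_def by unfold_locales blast

context sheaf
begin

text \<open>The open sets on which \<open>s\<close> and \<open>t\<close> agree cover
  \<open>U\<close>, and both sections glue the restrictions of \<open>s\<close> to them. Taking all
  such open sets avoids choosing one for each point.\<close>

lemma section_eqI:
  assumes "is_open X U" "s \<in> carrier (sections X U)" "t \<in> carrier (sections X U)"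
    and loc: "\<And>x. x \<in> U \<Longrightarrow> \<exists>W. is_open X W \<and> x \<in> W \<and> W \<subseteq> U \<and> restr X U W s = restr X U W t"
  shows "s = t"
proof -
  let ?\<U> = "{W. is_open X W \<and> W \<subseteq> U \<and> restr X U W s = restr X U W t}"
  have U: "\<Union>?\<U> = U" using loc by blast
  have "\<exists>!u. u \<in> carrier (sections X (\<Union>?\<U>)) \<and> (\<forall>W\<in>?\<U>. restr X (\<Union>?\<U>) W u = restr X U W s)"
    by (rule ring_sheaf[unfolded ring_sheaf_def, THEN conjunct2, rule_format])
      (use assms(1-3) in \<open>auto simp: restr_closed restr_restr openin_Int le_infI1\<close>)
  then have "\<exists>!u. u \<in> carrier (sections X U) \<and> (\<forall>W\<in>?\<U>. restr X U W u = restr X U W s)"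
    unfolding U .
  then show ?thesis using assms(2,3) by (elim ex1E) (metis (mono_tags, lifting) mem_Collect_eq)
qed

text \<open>The local condition is vacuous over the empty set. This makes pullbacks vanish over open
  sets that miss the image of an immersion.\<close>

lemma empty_section_eq:
  "s \<in> carrier (sections X {}) \<Longrightarrow> t \<in> carrier (sections X {}) \<Longrightarrow> s = t"
  by (rule section_eqI) auto

text \<open>The sheaf axiom indexes sections by the members of a cover, whereas here they are
  indexed by points. Points sharing a neighbourhood carry the same section, by compatibility on the
  whole of that neighbourhood, so any choice of index by \<open>inv_into\<close> is
  harmless.\<close>

lemma glue:
  assumes U: "is_open X U"
    and N: "\<And>x. x \<in> U \<Longrightarrow> is_open X (N x)" "\<And>x. x \<in> U \<Longrightarrow> x \<in> N x" "\<And>x. x \<in> U \<Longrightarrow> N x \<subseteq> U"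
    and s: "\<And>x. x \<in> U \<Longrightarrow> s x \<in> carrier (sections X (N x))"
    and compat: "\<And>x y. x \<in> U \<Longrightarrow> y \<in> U \<Longrightarrow>
      restr X (N x) (N x \<inter> N y) (s x) = restr X (N y) (N x \<inter> N y) (s y)"
  obtains t where "t \<in> carrier (sections X U)" "\<And>x. x \<in> U \<Longrightarrow> restr X U (N x) t = s x"
proof -
  let ?c = "inv_into U N"
  have c: "?c (N x) \<in> U" "N (?c (N x)) = N x" if "x \<in> U" for x
    using inv_into_into[OF imageI[OF that]] f_inv_into_f[OF imageI[OF that]] .
  have sc: "s (?c (N x)) = s x" if "x \<in> U" for x
    using compat[OF c(1)[OF that] that] N(1)[OF that] s[OF that] s[OF c(1)[OF that]] c(2)[OF that]
    by (simp add: restr_id)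
  have cov: "\<Union>(N ` U) = U" using N by blast
  have "\<exists>!t. t \<in> carrier (sections X (\<Union>(N ` U))) \<and>
      (\<forall>W\<in>N ` U. restr X (\<Union>(N ` U)) W t = s (?c W))"
    by (rule ring_sheaf[unfolded ring_sheaf_def, THEN conjunct2, rule_format])
      (auto simp: sc N s intro!: compat)
  then obtain t where "t \<in> carrier (sections X U)" "\<forall>W\<in>N ` U. restr X U W t = s (?c W)"
    unfolding cov by (elim ex1E conjE)
  then show ?thesis using that by (simp add: sc)
qed

end

text \<open>The basic open set \<open>D(f)\<close>, described without reference to a chart.\<close>

definition unit_locus :: "('a, 'r) ringed_space \<Rightarrow> 'a set \<Rightarrow> 'r \<Rightarrow> 'a set"
  where "unit_locus X U f = \<Union>{W. is_open X W \<and> W \<subseteq> U \<and>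
    (\<exists>g \<in> carrier (sections X W). restr X U W f \<otimes>\<^bsub>sections X W\<^esub> g = \<one>\<^bsub>sections X W\<^esub>)}"

lemma unit_locus_open: "is_open X (unit_locus X U f)"
  unfolding unit_locus_def by (rule openin_Union) blast

lemma unit_locus_subset: "unit_locus X U f \<subseteq> U"
  unfolding unit_locus_def by blast

section \<open>Maps of presheaves and their stalk maps\<close>

locale presheaf_map = Y: presheaf Y + X: presheaf X
  for Y :: "('b, 's) ringed_space" and X :: "('a, 'r) ringed_space" +
  fixes \<phi> :: "('b, 's, 'a, 'r) space_map"
  assumes continuous: "continuous_map (space_top Y) (space_top X) (point_map \<phi>)"
    and section_hom:
      "is_open X U \<Longrightarrow> section_map \<phi> U \<in> ring_hom (sections X U) (sections Y (preimage Y \<phi> U))"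
    and section_restr: "is_open X U \<Longrightarrow> is_open X V \<Longrightarrow> V \<subseteq> U \<Longrightarrow> s \<in> carrier (sections X U) \<Longrightarrow>
      section_map \<phi> V (restr X U V s) =
      restr Y (preimage Y \<phi> U) (preimage Y \<phi> V) (section_map \<phi> U s)"
begin

lemma preimage_open: "is_open X U \<Longrightarrow> is_open Y (preimage Y \<phi> U)"
  using continuous unfolding continuous_map_def preimage_def by blast

lemma point_closed: "y \<in> points Y \<Longrightarrow> point_map \<phi> y \<in> points X"
  using continuous unfolding continuous_map_def by blast

lemma section_closed: "is_open X U \<Longrightarrow> s \<in> carrier (sections X U) \<Longrightarrow>
    section_map \<phi> U s \<in> carrier (sections Y (preimage Y \<phi> U))"
  by (rule ring_hom_closed[OF section_hom])

lemma section_ring_hom: "is_open X U \<Longrightarrow>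
    ring_hom_ring (sections X U) (sections Y (preimage Y \<phi> U)) (section_map \<phi> U)"
  by (intro ring_hom_ringI2 section_hom X.sections_ring Y.sections_ring preimage_open)

text \<open>The union in \<open>stalk_map\<close> collapses since, by naturality under restriction,
  representatives of one germ of \<open>X\<close> have pullbacks with the same germ at
  \<open>y\<close>.\<close>

lemma stalk_map_germ:
  assumes y: "y \<in> points Y" and U: "is_open X U" "point_map \<phi> y \<in> U" "s \<in> carrier (sections X U)"
  shows "stalk_map Y \<phi> y (germ X (point_map \<phi> y) U s) =
    germ Y y (preimage Y \<phi> U) (section_map \<phi> U s)"
proof -
  have yU: "y \<in> preimage Y \<phi> U" using y U unfolding preimage_def by blast
  have eq: "germ Y y (preimage Y \<phi> V) (section_map \<phi> V t) =
      germ Y y (preimage Y \<phi> U) (section_map \<phi> U s)"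
    if t: "(V, t) \<in> germ X (point_map \<phi> y) U s" for V t
  proof -
    note V = X.germ_mem[OF t U]
    obtain W where W: "is_open X W" "point_map \<phi> y \<in> W" "W \<subseteq> V \<inter> U"
      "restr X V W t = restr X U W s"
      using V(4) X.germ_eq_iff[OF V(1-3) U] by blast
    have "restr Y (preimage Y \<phi> V) (preimage Y \<phi> W) (section_map \<phi> V t) =
        restr Y (preimage Y \<phi> U) (preimage Y \<phi> W) (section_map \<phi> U s)"
      using section_restr[of V W t] section_restr[of U W s] V(1-3) U W by simp
    moreover have "y \<in> preimage Y \<phi> W" "y \<in> preimage Y \<phi> V"
      "preimage Y \<phi> W \<subseteq> preimage Y \<phi> V \<inter> preimage Y \<phi> U"
      using W V(2) y unfolding preimage_def by auto
    ultimately show ?thesis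
      using V(1-3) U W yU
      by (subst Y.germ_eq_iff)
        (auto intro!: preimage_open section_closed exI[of _ "preimage Y \<phi> W"])
  qed
  have "stalk_map Y \<phi> y (germ X (point_map \<phi> y) U s) =
      (\<Union>z\<in>germ X (point_map \<phi> y) U s. germ Y y (preimage Y \<phi> U) (section_map \<phi> U s))"
    unfolding stalk_map_def using eq by (intro SUP_cong refl) auto
  also have "\<dots> = germ Y y (preimage Y \<phi> U) (section_map \<phi> U s)"
    using X.germ_self[OF U] by blast
  finally show ?thesis .
qed

text \<open>Obtained from compatibility with restriction, without locality, so that it applies to
  the comparison of two immersions before that map is known to be a morphism.\<close>

lemma stalk_map_hom:
  assumes y: "y \<in> points Y"
  shows "stalk_map Y \<phi> y \<in> ring_hom (stalk X (point_map \<phi> y)) (stalk Y y)"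
proof (rule ring_hom_memI)
  have pre: "y \<in> preimage Y \<phi> U" if "point_map \<phi> y \<in> U" for U
    using that y unfolding preimage_def by blast
  note g = stalk_map_germ[OF y]
  show "stalk_map Y \<phi> y a \<in> carrier (stalk Y y)"
    if "a \<in> carrier (stalk X (point_map \<phi> y))" for a
    using that by (elim X.in_stalkE)
      (simp add: g Y.germ_in_stalk preimage_open pre section_closed)
  show "stalk_map Y \<phi> y \<one>\<^bsub>stalk X (point_map \<phi> y)\<^esub> = \<one>\<^bsub>stalk Y y\<^esub>"
  proof -
    have P: "is_open X (points X)" "point_map \<phi> y \<in> points X" using point_closed[OF y] by auto
    have "\<one>\<^bsub>sections X (points X)\<^esub> \<in> carrier (sections X (points X))"
      using X.sections_ring[OF P(1)] by (simp add: ring.ring_simprules)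
    then show ?thesis
      using P ring_hom_one[OF section_hom[OF P(1)]]
      by (simp add: X.germ_one[OF P] g Y.germ_one[OF preimage_open[OF P(1)] pre[OF P(2)]])
  qed
  fix a b assume "a \<in> carrier (stalk X (point_map \<phi> y))" "b \<in> carrier (stalk X (point_map \<phi> y))"
  then obtain U s t where U: "is_open X U" "point_map \<phi> y \<in> U" "s \<in> carrier (sections X U)"
    "t \<in> carrier (sections X U)"
    and ab: "a = germ X (point_map \<phi> y) U s" "b = germ X (point_map \<phi> y) U t"
    by (rule X.in_stalkE2)
  interpret R: ring "sections X U" using X.sections_ring[OF U(1)] .
  note m = ring_hom_mult[OF section_hom[OF U(1)] U(3,4)]
    and a = ring_hom_add[OF section_hom[OF U(1)] U(3,4)]
  note c = preimage_open[OF U(1)] pre[OF U(2)] section_closed[OF U(1,3)] section_closed[OF U(1,4)]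
  show "stalk_map Y \<phi> y (a \<otimes>\<^bsub>stalk X (point_map \<phi> y)\<^esub> b) =
      stalk_map Y \<phi> y a \<otimes>\<^bsub>stalk Y y\<^esub> stalk_map Y \<phi> y b"
    using U by (simp add: ab X.germ_mult g Y.germ_mult[OF c] m)
  show "stalk_map Y \<phi> y (a \<oplus>\<^bsub>stalk X (point_map \<phi> y)\<^esub> b) =
      stalk_map Y \<phi> y a \<oplus>\<^bsub>stalk Y y\<^esub> stalk_map Y \<phi> y b"
    using U by (simp add: ab X.germ_add g Y.germ_add[OF c] a)
qed

end

section \<open>Local rings and the locus where a section is a unit\<close>

lemma local_ring_nonunit:
  assumes R: "local_ring R" and I: "maximalideal I R" and a: "a \<in> carrier R" "a \<notin> I"
  obtains b where "b \<in> carrier R" "a \<otimes>\<^bsub>R\<^esub> b = \<one>\<^bsub>R\<^esub>"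
proof (rule ccontr)
  note wit = that
  assume none: "\<not> thesis"
  interpret cring R using R unfolding local_ring_def by simp
  \<comment> \<open>A non-unit lies in some maximal ideal, and this can only be
    \<open>I\<close>.\<close>
  obtain M where M: "maximalideal M R" "a \<in> M"
  proof (rule nonunit_in_maximalideal[OF a(1)])
    show "a \<otimes>\<^bsub>R\<^esub> b \<noteq> \<one>\<^bsub>R\<^esub>" if "b \<in> carrier R" for b using none wit[OF that] by auto
  qed
  then have "M = I" using R I unfolding local_ring_def by auto
  then show False using M a by simp
qed

lemma maximalideal_one_notin: "maximalideal I R \<Longrightarrow> \<one>\<^bsub>R\<^esub> \<notin> I"
  by (metis ideal.one_imp_carrier maximalideal.I_notcarr maximalideal.axioms(1))

lemma local_ring_one_not_zero:
  assumes R: "local_ring R"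
  shows "\<one>\<^bsub>R\<^esub> \<noteq> \<zero>\<^bsub>R\<^esub>"
proof -
  obtain I where I: "maximalideal I R" using R unfolding local_ring_def by auto
  have "\<zero>\<^bsub>R\<^esub> \<in> I"
    using additive_subgroup.zero_closed[OF ideal.axioms(1)[OF maximalideal.axioms(1)[OF I]]] .
  then show ?thesis using maximalideal_one_notin[OF I] by auto
qed

text \<open>If h r lies outside \<open>J\<close>, it has an inverse h q by surjectivity. Then 1 - rq
  is in the kernel of \<open>h\<close>, hence no unit, hence in \<open>I\<close>; together with rq
  this puts 1 into \<open>I\<close>.\<close>

lemma local_hom_surjI:
  assumes h: "h \<in> ring_hom R S" and R: "local_ring R" and S: "local_ring S"
    and surj: "carrier S \<subseteq> h ` carrier R"
  shows "local_hom R S h"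
  unfolding local_hom_def
proof (intro conjI allI impI h subsetI)
  fix I J z assume IJ: "maximalideal I R \<and> maximalideal J S" and "z \<in> h ` I"
  then obtain r where r: "r \<in> I" "z = h r" by blast
  interpret R: cring R using R unfolding local_ring_def by simp
  interpret S: cring S using S unfolding local_ring_def by simp
  interpret h: ring_hom_ring R S h by (rule ring_hom_ringI2[OF R.ring_axioms S.ring_axioms h])
  interpret I: maximalideal I R using IJ by simp
  have rc: "r \<in> carrier R" using I.Icarr r by simp
  show "z \<in> J"
  proof (rule ccontr)
    assume "z \<notin> J"
    then obtain s where s: "s \<in> carrier S" "h r \<otimes>\<^bsub>S\<^esub> s = \<one>\<^bsub>S\<^esub>"
      using local_ring_nonunit[OF S conjunct2[OF IJ], of "h r"] r rc by auto
    then obtain q where q: "q \<in> carrier R" "s = h q" using surj by blast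
    let ?u = "\<one>\<^bsub>R\<^esub> \<ominus>\<^bsub>R\<^esub> r \<otimes>\<^bsub>R\<^esub> q"
    have u: "?u \<in> carrier R" using q rc by simp
    have hu: "h ?u = \<zero>\<^bsub>S\<^esub>"
      using s q rc by (simp add: R.minus_eq S.r_neg)
    have "?u \<in> I"
    proof (rule ccontr)
      assume "?u \<notin> I"
      then obtain v where v: "v \<in> carrier R" "?u \<otimes>\<^bsub>R\<^esub> v = \<one>\<^bsub>R\<^esub>"
        using local_ring_nonunit[OF R conjunct1[OF IJ] u] by auto
      have "\<one>\<^bsub>S\<^esub> = h (?u \<otimes>\<^bsub>R\<^esub> v)" using v by simp
      also have "\<dots> = \<zero>\<^bsub>S\<^esub>" using hu u v(1) by (simp del: v(2))
      finally show False using local_ring_one_not_zero[OF S] by simp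
    qed
    moreover have "r \<otimes>\<^bsub>R\<^esub> q \<in> I" using I.I_r_closed r q by simp
    ultimately have "?u \<oplus>\<^bsub>R\<^esub> r \<otimes>\<^bsub>R\<^esub> q \<in> I" by (rule I.a_closed)
    also have "?u \<oplus>\<^bsub>R\<^esub> r \<otimes>\<^bsub>R\<^esub> q = \<one>\<^bsub>R\<^esub>" using q rc by algebra
    finally show False using maximalideal_one_notin[OF conjunct1[OF IJ]] by simp
  qed
qed

locale lrs = sheaf +
  assumes local_stalks: "x \<in> points X \<Longrightarrow> local_ring (stalk X x)"
begin

text \<open>Otherwise 1 = 0 in the local ring at \<open>x\<close>. It is the means of showing that
  an open set is empty.\<close>

lemma nonempty_one_not_zero:
  assumes U: "is_open X U" "x \<in> U"
  shows "\<one>\<^bsub>sections X U\<^esub> \<noteq> \<zero>\<^bsub>sections X U\<^esub>"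
  using local_ring_one_not_zero[OF local_stalks, of x] U openin_subset[OF U(1)]
  by (auto simp: germ_one[OF U] germ_zero[OF U])

text \<open>An inverse of the germ is represented by a section, and the equation between germs holds
  on a whole neighbourhood: being a unit at a point spreads to being a unit near it.\<close>

lemma unit_locusI:
  assumes U: "is_open X U" "x \<in> U" "f \<in> carrier (sections X U)"
    and g: "g \<in> carrier (stalk X x)" "germ X x U f \<otimes>\<^bsub>stalk X x\<^esub> g = \<one>\<^bsub>stalk X x\<^esub>"
  shows "x \<in> unit_locus X U f"
proof -
  obtain V s t where V: "is_open X V" "x \<in> V" "s \<in> carrier (sections X V)"
    "t \<in> carrier (sections X V)" "germ X x U f = germ X x V s" "g = germ X x V t"
    using in_stalkE2[OF germ_in_stalk[OF U] g(1)] .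
  obtain N where N: "is_open X N" "x \<in> N" "N \<subseteq> U \<inter> V" "restr X U N f = restr X V N s"
    using V(5) germ_eq_iff[OF U V(1-3)] by auto
  interpret R: cring "sections X V" using sections_cring[OF V(1)] .
  have "germ X x V (s \<otimes>\<^bsub>sections X V\<^esub> t) = germ X x V \<one>\<^bsub>sections X V\<^esub>"
    using g(2) germ_mult[OF V(1-4)] germ_one[OF V(1,2)] V(5,6) by simp
  then obtain M where M: "is_open X M" "x \<in> M" "M \<subseteq> V"
    "restr X V M (s \<otimes>\<^bsub>sections X V\<^esub> t) = restr X V M \<one>\<^bsub>sections X V\<^esub>"
    using germ_eq_iff[OF V(1,2) _ V(1,2)] V(3,4) by auto
  let ?W = "N \<inter> M"
  have W: "is_open X ?W" "x \<in> ?W" "?W \<subseteq> U" "?W \<subseteq> V" using N M by auto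
  have "restr X U ?W f = restr X V ?W s"
    using N U V W by (intro restr_eq_mono[of U V N ?W]) auto
  moreover have "restr X V ?W (s \<otimes>\<^bsub>sections X V\<^esub> t) = restr X V ?W \<one>\<^bsub>sections X V\<^esub>"
    using M V W by (intro restr_eq_mono[of V V M ?W]) auto
  ultimately have "restr X U ?W f \<otimes>\<^bsub>sections X ?W\<^esub> restr X V ?W t = \<one>\<^bsub>sections X ?W\<^esub>"
    using V W by (simp add: restr_mult restr_one)
  moreover have "restr X V ?W t \<in> carrier (sections X ?W)" using V W by (simp add: restr_closed)
  ultimately show ?thesis using W unfolding unit_locus_def by auto
qed

lemma unit_locusE:
  assumes "x \<in> unit_locus X U f" "is_open X U" "f \<in> carrier (sections X U)"
  obtains W g where "is_open X W" "x \<in> W" "W \<subseteq> U" "g \<in> carrier (sections X W)"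
    "restr X U W f \<otimes>\<^bsub>sections X W\<^esub> g = \<one>\<^bsub>sections X W\<^esub>"
    "germ X x U f \<otimes>\<^bsub>stalk X x\<^esub> germ X x W g = \<one>\<^bsub>stalk X x\<^esub>"
proof -
  obtain W g where W: "is_open X W" "x \<in> W" "W \<subseteq> U" "g \<in> carrier (sections X W)"
    "restr X U W f \<otimes>\<^bsub>sections X W\<^esub> g = \<one>\<^bsub>sections X W\<^esub>"
    using assms(1) unfolding unit_locus_def by auto
  have "germ X x U f \<otimes>\<^bsub>stalk X x\<^esub> germ X x W g = \<one>\<^bsub>stalk X x\<^esub>"
    using germ_mult[OF W(1,2) restr_closed[OF assms(2) W(1,3) assms(3)] W(4)]
      germ_restr[OF assms(2) W(1,3,2) assms(3)] germ_one[OF W(1,2)] W(5) by simp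
  then show ?thesis using that W by auto
qed

end

locale lrs_morphism = Y: lrs Y + X: lrs X
  for Y :: "('b, 's) ringed_space" and X :: "('a, 'r) ringed_space" +
  fixes \<phi> :: "('b, 's, 'a, 'r) space_map"
  assumes morphism: "morphism Y X \<phi>"

sublocale lrs_morphism \<subseteq> presheaf_map
  using morphism unfolding morphism_def by unfold_locales simp_all

context lrs_morphism
begin

text \<open>Here locality of the stalk maps enters: a germ in the maximal ideal at the image of
  \<open>y\<close> is sent into the maximal ideal at \<open>y\<close> and cannot become a unit
  there.\<close>

lemma unit_locus_preimage:
  assumes U: "is_open X U" and f: "f \<in> carrier (sections X U)"
    and y: "y \<in> unit_locus Y (preimage Y \<phi> U) (section_map \<phi> U f)"
  shows "point_map \<phi> y \<in> unit_locus X U f"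
proof (rule ccontr)
  let ?x = "point_map \<phi> y" and ?h = "stalk_map Y \<phi> y"
  assume n: "?x \<notin> unit_locus X U f"
  have yU: "y \<in> preimage Y \<phi> U" using y unit_locus_subset by fast
  then have x: "y \<in> points Y" "?x \<in> U" unfolding preimage_def by auto
  note loc = X.local_stalks[OF point_closed[OF x(1)]] Y.local_stalks[OF x(1)]
  obtain I J where I: "maximalideal I (stalk X ?x)" and J: "maximalideal J (stalk Y y)"
    using loc unfolding local_ring_def by auto
  have "germ X ?x U f \<in> I"
  proof (rule ccontr)
    assume "germ X ?x U f \<notin> I"
    then show False
      using local_ring_nonunit[OF loc(1) I X.germ_in_stalk[OF U x(2) f]] X.unit_locusI[OF U x(2) f] n
      by metis
  qed
  then have "?h (germ X ?x U f) \<in> J"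
    using morphism x(1) I J unfolding morphism_def local_hom_def by (simp add: image_subset_iff)
  then have "germ Y y (preimage Y \<phi> U) (section_map \<phi> U f) \<in> J"
    using stalk_map_germ[OF x(1) U x(2) f] by simp
  moreover obtain W g where "is_open Y W" "y \<in> W" "g \<in> carrier (sections Y W)"
    "germ Y y (preimage Y \<phi> U) (section_map \<phi> U f) \<otimes>\<^bsub>stalk Y y\<^esub> germ Y y W g = \<one>\<^bsub>stalk Y y\<^esub>"
    using Y.unit_locusE[OF y preimage_open[OF U] section_closed[OF U f]] .
  ultimately have "\<one>\<^bsub>stalk Y y\<^esub> \<in> J"
    using ideal.I_r_closed[OF maximalideal.axioms(1)[OF J]] Y.germ_in_stalk by metis
  then show False using maximalideal_one_notin[OF J] by simp
qed

end

section \<open>Affine open sets\<close>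

lemma points_Spec: "points (Spec A) = {P. primeideal P A}"
proof
  show "points (Spec A) \<subseteq> {P. primeideal P A}"
    unfolding topspace_def Spec_def by (auto simp: openin_zariski_topology)
  have "\<not> carrier A \<subseteq> P" if "primeideal P A" for P
    using that by (metis ideal.Icarr primeideal.I_notcarr primeideal.axioms(1) subset_antisym subsetI)
  then have "openin (zariski_topology A) {P. primeideal P A}"
    unfolding openin_zariski_topology by (intro exI[of _ "carrier A"]) auto
  then show "{P. primeideal P A} \<subseteq> points (Spec A)"
    using openin_subset[of "zariski_topology A"] by (simp add: Spec_def)
qed

lemma (in presheaf) restr_pow:
  assumes "is_open X U" "is_open X V" "V \<subseteq> U" "s \<in> carrier (sections X U)"
  shows "restr X U V (s [^]\<^bsub>sections X U\<^esub> (n::nat)) = restr X U V s [^]\<^bsub>sections X V\<^esub> n"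
proof -
  interpret U: cring "sections X U" using sections_cring assms by simp
  interpret V: cring "sections X V" using sections_cring assms by simp
  show ?thesis using assms by (induction n) (simp_all add: restr_one restr_mult)
qed

text \<open>An isomorphism of \<open>U\<close> with \<open>Spec A\<close>, reduced to its action on
  points, open sets and sections. The map \<open>p\<close> belongs to the isomorphism and
  \<open>h\<close> to its inverse, so that both lead from \<open>X\<close> to the spectrum.\<close>

locale affine_chart = presheaf X + cring A
  for X :: "('a, 'r) ringed_space" and A :: "'r ring" (structure) +
  fixes U :: "'a set" and p :: "'a \<Rightarrow> 'r set"
    and h :: "'a set \<Rightarrow> 'r \<Rightarrow> 'r set \<Rightarrow> ('r \<times> 'r) set"
  assumes U_open: "is_open X U"
    and p_bij: "bij_betw p U {P. primeideal P A}"
    and p_open: "W \<subseteq> U \<Longrightarrow> is_open X W \<longleftrightarrow> openin (zariski_topology A) (p ` W)"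
    and h_bij: "is_open X W \<Longrightarrow> W \<subseteq> U \<Longrightarrow>
      bij_betw (h W) (carrier (sections X W)) (carrier (spec_sections A (p ` W)))"
    and h_hom: "is_open X W \<Longrightarrow> W \<subseteq> U \<Longrightarrow>
      h W \<in> ring_hom (sections X W) (spec_sections A (p ` W))"
    and h_restr: "is_open X V \<Longrightarrow> is_open X W \<Longrightarrow> W \<subseteq> V \<Longrightarrow> V \<subseteq> U \<Longrightarrow>
      s \<in> carrier (sections X V) \<Longrightarrow> h W (restr X V W s) = restrict (h V s) (p ` W)"

lemma (in presheaf) affine_open_chart:
  assumes "affine_open X U"
  obtains A p h where "affine_chart X A U p h"
proof -
  let ?XU = "open_subspace X U"
  have U: "is_open X U" using assms unfolding affine_open_def by simp
  obtain A :: "'r ring" and \<alpha> where A: "cring A" and iso: "isomorphism ?XU (Spec A) \<alpha>"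
    using assms unfolding affine_open_def affine_scheme_def by auto
  obtain \<beta> where \<alpha>: "morphism ?XU (Spec A) \<alpha>" and \<beta>: "morphism (Spec A) ?XU \<beta>"
    and e1: "morphism_eq ?XU ?XU (compose_map (Spec A) \<beta> \<alpha>) identity_map"
    and e2: "morphism_eq (Spec A) (Spec A) (compose_map ?XU \<alpha> \<beta>) identity_map"
    using iso unfolding isomorphism_def by auto
  let ?p = "point_map \<alpha>" and ?q = "point_map \<beta>"
  have pts: "points ?XU = U" using openin_subset[OF U] by (auto simp: open_subspace_def)
  have opn: "is_open ?XU W \<longleftrightarrow> is_open X W \<and> W \<subseteq> U" for W
    using U by (simp add: open_subspace_def openin_open_subtopology)
  have sec: "sections ?XU = sections X" "restr ?XU = restr X" by (simp_all add: open_subspace_def)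
  have spec: "space_top (Spec A) = zariski_topology A" "sections (Spec A) = spec_sections A"
    "restr (Spec A) = (\<lambda>U V s. restrict s V)" by (simp_all add: Spec_def)
  have ca: "continuous_map (space_top ?XU) (zariski_topology A) ?p"
    and cb: "continuous_map (zariski_topology A) (space_top ?XU) ?q"
    using \<alpha> \<beta> spec unfolding morphism_def by simp_all
  have pU: "primeideal (?p x) A" "?q (?p x) = x" if "x \<in> U" for x
    using that ca e1 pts points_Spec[of A] spec
    unfolding continuous_map_def morphism_eq_def compose_map_def identity_map_def by auto
  have qS: "?q P \<in> U" "?p (?q P) = P" if "primeideal P A" for P
    using that cb e2 pts points_Spec[of A] spec
    unfolding continuous_map_def morphism_eq_def compose_map_def identity_map_def by auto
  \<comment> \<open>The point maps are mutually inverse, so preimages under \<beta> are images under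
    the point map of \<alpha>. This lets the section maps of \<alpha> and \<beta> be inverse maps
    between the same two rings.\<close>
  have pb: "preimage (Spec A) \<beta> W = ?p ` W" if "W \<subseteq> U" for W
  proof -
    have "P \<in> preimage (Spec A) \<beta> W \<longleftrightarrow> primeideal P A \<and> ?q P \<in> W" for P
      using points_Spec[of A] unfolding preimage_def by auto
    then show ?thesis using pU qS that by (auto simp: image_iff) (metis qS(2))
  qed
  have pa: "preimage ?XU \<alpha> (?p ` W) = W" if "W \<subseteq> U" for W
    using pU that unfolding preimage_def pts by auto (metis subsetD)
  have opens: "is_open X W \<longleftrightarrow> openin (zariski_topology A) (?p ` W)" if W: "W \<subseteq> U" for W
  proof
    assume "is_open X W"
    then have "is_open ?XU W" using opn W by simp
    then have "openin (zariski_topology A) {P \<in> topspace (zariski_topology A). ?q P \<in> W}"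
      using openin_continuous_map_preimage[OF cb] by simp
    then show "openin (zariski_topology A) (?p ` W)"
      using pb[OF W] spec unfolding preimage_def by simp
  next
    assume "openin (zariski_topology A) (?p ` W)"
    then have "is_open ?XU {x \<in> topspace (space_top ?XU). ?p x \<in> ?p ` W}"
      using openin_continuous_map_preimage[OF ca] by simp
    then show "is_open X W" using pa[OF W] opn unfolding preimage_def by simp
  qed
  have b_hom: "section_map \<beta> W \<in> ring_hom (sections X W) (spec_sections A (?p ` W))"
    if "is_open X W" "W \<subseteq> U" for W
    using \<beta> that opn[of W] pb[of W] spec sec unfolding morphism_def by metis
  have a_hom: "section_map \<alpha> (?p ` W) \<in> ring_hom (spec_sections A (?p ` W)) (sections X W)"
    if "is_open X W" "W \<subseteq> U" for W
    using \<alpha> that opens[of W] pa[of W] spec sec unfolding morphism_def by metis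
  have ab: "section_map \<alpha> (?p ` W) (section_map \<beta> W s) = s"
    if "is_open X W" "W \<subseteq> U" "s \<in> carrier (sections X W)" for W s
  proof -
    have "section_map (compose_map (Spec A) \<beta> \<alpha>) W s = section_map identity_map W s"
      using e1 that opn[of W] sec unfolding morphism_eq_def by simp
    then show ?thesis using pb[OF that(2)] by (simp add: compose_map_def identity_map_def)
  qed
  have ba: "section_map \<beta> W (section_map \<alpha> (?p ` W) t) = t"
    if "is_open X W" "W \<subseteq> U" "t \<in> carrier (spec_sections A (?p ` W))" for W t
  proof -
    have "section_map (compose_map ?XU \<alpha> \<beta>) (?p ` W) t = section_map identity_map (?p ` W) t"
      using e2 that opens[of W] spec unfolding morphism_eq_def by simp
    then show ?thesis using pa[OF that(2)] by (simp add: compose_map_def identity_map_def)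
  qed
  have "affine_chart X A U ?p (section_map \<beta>)"
  proof (intro affine_chart.intro affine_chart_axioms.intro)
    show "presheaf X" by (rule presheaf_axioms)
    show "bij_betw ?p U {P. primeideal P A}"
      by (rule bij_betw_byWitness[of _ ?q]) (use pU qS in auto)
    show "bij_betw (section_map \<beta> W) (carrier (sections X W)) (carrier (spec_sections A (?p ` W)))"
      if W: "is_open X W" "W \<subseteq> U" for W
      by (rule bij_betw_byWitness[of _ "section_map \<alpha> (?p ` W)"])
        (use ab[OF W] ba[OF W] ring_hom_closed[OF a_hom[OF W]] ring_hom_closed[OF b_hom[OF W]]
          in auto)
    show "section_map \<beta> W (restr X V W s) = restrict (section_map \<beta> V s) (?p ` W)"
      if "is_open X V" "is_open X W" "W \<subseteq> V" "V \<subseteq> U" "s \<in> carrier (sections X V)" for V W s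
    proof -
      have "\<forall>U V s. is_open ?XU U \<and> is_open ?XU V \<and> V \<subseteq> U \<and> s \<in> carrier (sections ?XU U) \<longrightarrow>
        section_map \<beta> V (restr ?XU U V s) =
        restr (Spec A) (preimage (Spec A) \<beta> U) (preimage (Spec A) \<beta> V) (section_map \<beta> U s)"
        using \<beta> unfolding morphism_def by simp
      moreover have "W \<subseteq> U" using that by simp
      ultimately show ?thesis using that opn[of V] opn[of W] pb[of W] sec spec(3) by simp
    qed
  qed (use U A opens b_hom in auto)
  then show ?thesis by (rule that)
qed

context affine_chart
begin

lemma prime: "x \<in> U \<Longrightarrow> primeideal (p x) A"
  using p_bij unfolding bij_betw_def by auto

lemma point: "x \<in> U \<Longrightarrow> spec_point (p x) A"
  using prime unfolding spec_point_def .

lemma h_closed: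
  "is_open X W \<Longrightarrow> W \<subseteq> U \<Longrightarrow> s \<in> carrier (sections X W) \<Longrightarrow>
    h W s \<in> carrier (spec_sections A (p ` W))"
  by (rule ring_hom_closed[OF h_hom])

lemma h_mult:
  assumes "is_open X W" "W \<subseteq> U" "s \<in> carrier (sections X W)" "t \<in> carrier (sections X W)" "y \<in> W"
  shows "h W (s \<otimes>\<^bsub>sections X W\<^esub> t) (p y) = h W s (p y) \<otimes>\<^bsub>localization A (p y)\<^esub> h W t (p y)"
  using ring_hom_mult[OF h_hom[OF assms(1,2)] assms(3,4)] assms(5)
  by (simp add: spec_sections_def)

lemma h_one:
  assumes "is_open X W" "W \<subseteq> U" "y \<in> W"
  shows "h W \<one>\<^bsub>sections X W\<^esub> (p y) = fraction A (p y) \<one> \<one>"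
  using ring_hom_one[OF h_hom[OF assms(1,2)]] assms(3)
  by (simp add: spec_sections_def localization_def)

lemma h_restr_apply:
  "is_open X V \<Longrightarrow> is_open X W \<Longrightarrow> W \<subseteq> V \<Longrightarrow> V \<subseteq> U \<Longrightarrow> s \<in> carrier (sections X V) \<Longrightarrow> y \<in> W \<Longrightarrow>
    h W (restr X V W s) (p y) = h V s (p y)"
  by (simp add: h_restr)

text \<open>Sections of the structure sheaf are extensional functions on the points of the open set,
  and \<open>h\<close> is injective, so equality may be tested in the localizations.\<close>

lemma h_eqI:
  assumes W: "is_open X W" "W \<subseteq> U" and s: "s \<in> carrier (sections X W)"
    and t: "t \<in> carrier (sections X W)" and eq: "\<And>y. y \<in> W \<Longrightarrow> h W s (p y) = h W t (p y)"
  shows "s = t"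
proof -
  have "h W s \<in> (\<Pi>\<^sub>E P\<in>p ` W. carrier (localization A P))"
    "h W t \<in> (\<Pi>\<^sub>E P\<in>p ` W. carrier (localization A P))"
    using h_closed[OF W s] h_closed[OF W t] by (simp_all add: spec_sections_def)
  then have "h W s = h W t" by (rule PiE_ext) (use eq in auto)
  then show ?thesis using h_bij[OF W] s t unfolding bij_betw_def inj_on_def by auto
qed

lemma local_fraction:
  assumes W: "is_open X W" "W \<subseteq> U" and s: "s \<in> carrier (sections X W)" and x: "x \<in> W"
  obtains V a f where "is_open X V" "x \<in> V" "V \<subseteq> W" "a \<in> carrier A" "f \<in> carrier A"
    "\<And>y. y \<in> V \<Longrightarrow> f \<notin> p y \<and> h W s (p y) = fraction A (p y) a f"
proof -
  have "\<forall>P\<in>p ` W. \<exists>V a f. openin (zariski_topology A) V \<and> P \<in> V \<and> V \<subseteq> p ` W \<and>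
      a \<in> carrier A \<and> f \<in> carrier A \<and> (\<forall>Q\<in>V. f \<notin> Q \<and> h W s Q = fraction A Q a f)"
    using h_closed[OF W s] by (simp add: spec_sections_def)
  then obtain V a f where V: "openin (zariski_topology A) V" "p x \<in> V" "V \<subseteq> p ` W"
      "a \<in> carrier A" "f \<in> carrier A" "\<forall>Q\<in>V. f \<notin> Q \<and> h W s Q = fraction A Q a f"
    using x by (metis imageI)
  let ?V = "{y \<in> W. p y \<in> V}"
  have "p ` ?V = V" using V(3) by auto
  then have "is_open X ?V" using p_open[of ?V] W(2) V(1) by auto
  then show ?thesis using that[of ?V a f] V x by auto
qed

text \<open>The assignment of a/f to each point is a section of the structure sheaf, all of the open
  set being the required neighbourhood of each point; \<open>h\<close> is onto.\<close>

lemma fraction_section: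
  assumes W: "is_open X W" "W \<subseteq> U" and a: "a \<in> carrier A" and f: "f \<in> carrier A"
    and nz: "\<And>y. y \<in> W \<Longrightarrow> f \<notin> p y"
  obtains s where "s \<in> carrier (sections X W)" "\<And>y. y \<in> W \<Longrightarrow> h W s (p y) = fraction A (p y) a f"
proof -
  let ?t = "\<lambda>P\<in>p ` W. fraction A P a f"
  have "openin (zariski_topology A) (p ` W)" using p_open W by auto
  then have "?t \<in> carrier (spec_sections A (p ` W))"
    using a f nz unfolding spec_sections_def localization_def by auto blast+
  then obtain s where "s \<in> carrier (sections X W)" "h W s = ?t"
    using h_bij[OF W] unfolding bij_betw_def by (metis imageE)
  then show ?thesis using that by auto
qed

text \<open>\<open>spec_sections\<close> is not known to be a ring here, so preservation of zero is deduced from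
  \<open>0 + 0 = 0\<close> on both sides.\<close>

lemma h_zero:
  assumes W: "is_open X W" "W \<subseteq> U" and y: "y \<in> W"
  shows "h W \<zero>\<^bsub>sections X W\<^esub> (p y) = fraction A (p y) \<zero> \<one>"
proof -
  interpret R: cring "sections X W" using sections_cring[OF W(1)] .
  have pr: "primeideal (p y) A" if "y \<in> W" for y using prime that W(2) by auto
  have pt: "spec_point (p y) A" if "y \<in> W" for y using point that W(2) by auto
  obtain z where z: "z \<in> carrier (sections X W)" "\<And>y. y \<in> W \<Longrightarrow> h W z (p y) = fraction A (p y) \<zero> \<one>"
    by (rule fraction_section[OF W zero_closed one_closed])
      (use primeideal.one_notin[OF pr] in auto)
  have "z \<oplus>\<^bsub>sections X W\<^esub> z = z"
  proof (rule h_eqI[OF W _ z(1)])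
    show "z \<oplus>\<^bsub>sections X W\<^esub> z \<in> carrier (sections X W)" using z by simp
    fix y assume y: "y \<in> W"
    have "h W (z \<oplus>\<^bsub>sections X W\<^esub> z) (p y) = h W z (p y) \<oplus>\<^bsub>localization A (p y)\<^esub> h W z (p y)"
      using ring_hom_add[OF h_hom[OF W] z(1) z(1)] y by (simp add: spec_sections_def)
    then show "h W (z \<oplus>\<^bsub>sections X W\<^esub> z) (p y) = h W z (p y)"
      using z(2)[OF y] spec_point.zero_fraction_add[OF pt[OF y]] by simp
  qed
  then have "z = \<zero>\<^bsub>sections X W\<^esub>" using z(1) by simp
  then show ?thesis using z(2)[OF y] by simp
qed

section \<open>Basic open sets and fractions in a chart\<close>

definition basic :: "'r \<Rightarrow> 'a set" where "basic f = {x \<in> U. f \<notin> p x}"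

lemma basic_subset: "basic f \<subseteq> U"
  unfolding basic_def by auto

lemma basic_open:
  assumes "f \<in> carrier A"
  shows "is_open X (basic f)"
proof -
  have "p ` basic f = {P. primeideal P A \<and> \<not> {f} \<subseteq> P}"
    using p_bij unfolding basic_def bij_betw_def by auto
  then have "openin (zariski_topology A) (p ` basic f)"
    unfolding openin_zariski_topology using assms by (intro exI[of _ "{f}"]) auto
  then show ?thesis using p_open basic_subset by auto
qed

text \<open>An open set of the spectrum consists of the primes not containing a set
  \<open>E\<close>, and any \<open>f\<close> in \<open>E\<close> outside the prime of
  \<open>x\<close> serves.\<close>

lemma basic_basis:
  assumes W: "is_open X W" "W \<subseteq> U" "x \<in> W"
  obtains f where "f \<in> carrier A" "x \<in> basic f" "basic f \<subseteq> W"
proof -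
  have "openin (zariski_topology A) (p ` W)" using p_open W by auto
  then obtain E where E: "E \<subseteq> carrier A" "p ` W = {P. primeideal P A \<and> \<not> E \<subseteq> P}"
    unfolding openin_zariski_topology by auto
  then obtain f where f: "f \<in> E" "f \<notin> p x" using W(3) by blast
  have "basic f \<subseteq> W"
  proof
    fix y assume "y \<in> basic f"
    then have y: "y \<in> U" "f \<notin> p y" unfolding basic_def by auto
    then have "p y \<in> p ` W" using E f prime by auto
    then show "y \<in> W" using y(1) W(2) p_bij unfolding bij_betw_def inj_on_def by auto
  qed
  moreover have "x \<in> basic f" using f(2) W unfolding basic_def by auto
  moreover have "f \<in> carrier A" using f(1) E(1) by auto
  ultimately show ?thesis by (intro that)
qed

text \<open>The elements \<open>f\<close> for which D(f) is covered by finitely many members of \<U>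
  form an ideal. A prime containing this ideal would be a point of \<open>U\<close>; a basic
  neighbourhood D(f) of that point inside one member of \<U> gives an \<open>f\<close> in the ideal
  but outside the prime. Hence the ideal contains 1, and D(1) = \<open>U\<close>.\<close>

lemma compact: "compactin (space_top X) U"
  unfolding compactin_def
proof (intro conjI allI impI)
  show "U \<subseteq> points X" using openin_subset[OF U_open] .
  fix \<U> assume "(\<forall>V\<in>\<U>. is_open X V) \<and> U \<subseteq> \<Union>\<U>"
  then have \<U>: "\<And>V. V \<in> \<U> \<Longrightarrow> is_open X V" "U \<subseteq> \<Union>\<U>" by auto
  let ?J = "{f \<in> carrier A. \<exists>\<V>. finite \<V> \<and> \<V> \<subseteq> \<U> \<and> basic f \<subseteq> \<Union>\<V>}"
  \<comment> \<open>The condition on primes says that D(g) is contained in D(f); negatives and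
    multiples are both of this kind.\<close>
  have mono: "g \<in> ?J"
    if f: "f \<in> ?J" and g: "g \<in> carrier A" and sub: "\<And>P. primeideal P A \<Longrightarrow> f \<in> P \<Longrightarrow> g \<in> P" for f g
  proof -
    have "basic g \<subseteq> basic f" using sub prime unfolding basic_def by auto
    moreover obtain \<V> where "finite \<V>" "\<V> \<subseteq> \<U>" "basic f \<subseteq> \<Union>\<V>" using f by auto
    ultimately have "\<exists>\<V>. finite \<V> \<and> \<V> \<subseteq> \<U> \<and> basic g \<subseteq> \<Union>\<V>"
      by (intro exI[of _ \<V>] conjI) (assumption, assumption, rule order_trans)
    then show ?thesis using g by simp
  qed
  have J: "ideal ?J A"
  proof (rule idealI[OF ring_axioms])
    show "subgroup ?J (add_monoid A)"
    proof (rule add.subgroupI)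
      have "basic \<zero> \<subseteq> \<Union>{}"
        using additive_subgroup.zero_closed[OF ideal.axioms(1)[OF primeideal.axioms(1)[OF prime]]]
        unfolding basic_def by auto
      then have "\<zero> \<in> ?J" by (intro CollectI conjI exI[of _ "{}"]) auto
      then show "?J \<noteq> {}" by auto
      show "\<ominus> a \<in> ?J" if a: "a \<in> ?J" for a
      proof (rule mono[OF a])
        show "\<ominus> a \<in> carrier A" using a by simp
        show "\<ominus> a \<in> P" if "primeideal P A" "a \<in> P" for P
          using additive_subgroup.a_inv_closed[OF ideal.axioms(1)[OF primeideal.axioms(1)]] that by fast
      qed
      fix a b assume ab: "a \<in> ?J" "b \<in> ?J"
      then obtain \<V> \<W> where VW: "finite \<V>" "\<V> \<subseteq> \<U>" "basic a \<subseteq> \<Union>\<V>" "finite \<W>" "\<W> \<subseteq> \<U>" "basic b \<subseteq> \<Union>\<W>"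
        by auto
      have "a \<oplus> b \<in> p x" if "x \<in> U" "a \<in> p x" "b \<in> p x" for x
        using additive_subgroup.a_closed[OF ideal.axioms(1)[OF primeideal.axioms(1)[OF prime]]] that by metis
      then have "basic (a \<oplus> b) \<subseteq> basic a \<union> basic b" unfolding basic_def by auto
      also have "\<dots> \<subseteq> \<Union>(\<V> \<union> \<W>)" using VW by auto
      finally show "a \<oplus> b \<in> ?J" using ab VW by (intro CollectI conjI exI[of _ "\<V> \<union> \<W>"]) auto
    qed auto
  next
    fix a x assume a: "a \<in> ?J" and x: "x \<in> carrier A"
    show "x \<otimes> a \<in> ?J"
      by (rule mono[OF a]) (use a x ideal.I_l_closed[OF primeideal.axioms(1)] in auto)
    show "a \<otimes> x \<in> ?J"
      by (rule mono[OF a]) (use a x ideal.I_r_closed[OF primeideal.axioms(1)] in auto)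
  qed
  have "\<one> \<in> ?J"
  proof (rule ccontr)
    assume "\<one> \<notin> ?J"
    then have "?J \<inter> {\<one>} = {}" by auto
    then obtain P where P: "primeideal P A" "?J \<subseteq> P"
      by (rule prime_avoiding[OF J]) auto
    then have "P \<in> p ` U" using p_bij unfolding bij_betw_def by simp
    then obtain x where x: "x \<in> U" "p x = P" by auto
    then obtain V where V: "V \<in> \<U>" "x \<in> V" using \<U>(2) by auto
    have "is_open X (V \<inter> U)" using \<U>(1)[OF V(1)] U_open by auto
    then obtain f where f: "f \<in> carrier A" "x \<in> basic f" "basic f \<subseteq> V \<inter> U"
      by (rule basic_basis) (use x V in auto)
    have "f \<in> ?J" using f V by (intro CollectI conjI exI[of _ "{V}"]) auto
    then show False using f(2) x P(2) unfolding basic_def by auto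
  qed
  moreover have "basic \<one> = U"
    using primeideal.one_notin[OF prime] unfolding basic_def by auto
  ultimately show "\<exists>\<F>. finite \<F> \<and> \<F> \<subseteq> \<U> \<and> U \<subseteq> \<Union>\<F>" by auto
qed

text \<open>Where \<open>s\<close> equals c/k with both \<open>c\<close> and \<open>k\<close>
  nonvanishing, k/c is an inverse section. Only \<open>W\<close> has to lie in the chart, whereas
  \<open>T\<close> may reach beyond it.\<close>

lemma fraction_in_unit_locus:
  assumes T: "is_open X T" "s \<in> carrier (sections X T)" and W: "is_open X W" "W \<subseteq> T \<inter> U"
    and c: "c \<in> carrier A" "k \<in> carrier A" "\<And>y. y \<in> W \<Longrightarrow> c \<notin> p y \<and> k \<notin> p y"
    and s: "\<And>y. y \<in> W \<Longrightarrow> h W (restr X T W s) (p y) = fraction A (p y) c k"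
  shows "W \<subseteq> unit_locus X T s"
proof -
  interpret R: cring "sections X W" using sections_cring[OF W(1)] .
  have WU: "W \<subseteq> U" using W by auto
  obtain t where t: "t \<in> carrier (sections X W)" "\<And>y. y \<in> W \<Longrightarrow> h W t (p y) = fraction A (p y) k c"
    by (rule fraction_section[OF W(1) WU c(2,1)]) (use c(3) in auto)
  have rs: "restr X T W s \<in> carrier (sections X W)" using T W restr_closed by auto
  have "restr X T W s \<otimes>\<^bsub>sections X W\<^esub> t = \<one>\<^bsub>sections X W\<^esub>"
  proof (rule h_eqI[OF W(1) WU])
    fix y assume y: "y \<in> W"
    interpret P: spec_point "p y" A using point WU y by auto
    show "h W (restr X T W s \<otimes>\<^bsub>sections X W\<^esub> t) (p y) = h W \<one>\<^bsub>sections X W\<^esub> (p y)"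
      using c(1,2) c(3)[OF y] P.one_notin P.mult_notin[of k c]
      by (simp add: h_mult[OF W(1) WU rs t(1) y] s[OF y] t(2)[OF y] P.fraction_mult h_one[OF W(1) WU y]
        P.fraction_eq_iff m_comm) (metis DiffI P.one_notin one_closed)
  qed (use rs t in auto)
  then show ?thesis using W t unfolding unit_locus_def by auto
qed

text \<open>This links the chart-free \<open>unit_locus\<close> with D(f). An inverse of f/1 near
  \<open>x\<close> is a fraction a/k, so q(fa) = qk for some \<open>q\<close> outside the prime of
  \<open>x\<close>; the right side avoids that prime, hence so does \<open>f\<close>.\<close>

lemma unit_locus_fraction:
  assumes s: "s \<in> carrier (sections X U)" and f: "f \<in> carrier A"
    and eq: "\<And>y. y \<in> U \<Longrightarrow> h U s (p y) = fraction A (p y) f \<one>"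
  shows "unit_locus X U s = basic f"
proof
  show "unit_locus X U s \<subseteq> basic f"
  proof
    fix x assume "x \<in> unit_locus X U s"
    then obtain W g where W: "is_open X W" "x \<in> W" "W \<subseteq> U" "g \<in> carrier (sections X W)"
      "restr X U W s \<otimes>\<^bsub>sections X W\<^esub> g = \<one>\<^bsub>sections X W\<^esub>"
      unfolding unit_locus_def by auto
    have x: "x \<in> U" using W by auto
    interpret P: spec_point "p x" A using point x .
    obtain V a k where V: "x \<in> V" "a \<in> carrier A" "k \<in> carrier A"
      "\<And>y. y \<in> V \<Longrightarrow> k \<notin> p y \<and> h W g (p y) = fraction A (p y) a k"
      using local_fraction[OF W(1,3,4,2)] by metis
    have "fraction A (p x) f \<one> \<otimes>\<^bsub>localization A (p x)\<^esub> fraction A (p x) a k = fraction A (p x) \<one> \<one>"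
      using h_mult[OF W(1,3) restr_closed[OF U_open W(1,3) s] W(4,2)]
      unfolding W(5) h_one[OF W(1,3,2)] h_restr_apply[OF U_open W(1,3) order_refl s W(2)] eq[OF x]
      using V(4)[OF V(1)] by simp
    then have "fraction A (p x) (f \<otimes> a) k = fraction A (p x) \<one> \<one>"
      using P.fraction_mult[of f \<one> a k] f V P.one_notin by simp
    then obtain q where q: "q \<in> carrier A - p x" "q \<otimes> (\<one> \<otimes> (f \<otimes> a)) = q \<otimes> (k \<otimes> \<one>)"
      using P.fraction_eq_iff[of "f \<otimes> a" k \<one> \<one>] f V P.one_notin by auto
    have "f \<notin> p x"
    proof
      assume "f \<in> p x"
      then have "f \<otimes> a \<in> p x" using V(2) by (rule P.I_r_closed)
      then have "q \<otimes> (f \<otimes> a) \<in> p x" using q(1) P.I_l_closed[of "f \<otimes> a" q] by simp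
      moreover have "q \<otimes> (f \<otimes> a) = q \<otimes> k" using q(2) f V by simp
      ultimately show False using q(1) V P.mult_notin[of q k] by auto
    qed
    then show "x \<in> basic f" using x unfolding basic_def by simp
  qed
  show "basic f \<subseteq> unit_locus X U s"
  proof (rule fraction_in_unit_locus[OF U_open s basic_open[OF f] _ f one_closed])
    show "f \<notin> p y \<and> \<one> \<notin> p y" if "y \<in> basic f" for y
      using that primeideal.one_notin[OF prime] unfolding basic_def by auto
    show "h (basic f) (restr X U (basic f) s) (p y) = fraction A (p y) f \<one>" if "y \<in> basic f" for y
      using h_restr_apply[OF U_open basic_open[OF f] basic_subset order_refl s that]
        eq[of y] basic_subset that by auto
  qed (use basic_subset in auto)
qed

lemma global_section:
  assumes "f \<in> carrier A"
  obtains s where "s \<in> carrier (sections X U)"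
    "\<And>y. y \<in> U \<Longrightarrow> h U s (p y) = fraction A (p y) f \<one>"
  by (rule fraction_section[OF U_open order_refl assms one_closed])
    (use primeideal.one_notin[OF prime] in auto)

lemma unit_locus_basis:
  assumes W: "is_open X W" "W \<subseteq> U" "x \<in> W"
  obtains s where "s \<in> carrier (sections X U)" "x \<in> unit_locus X U s" "unit_locus X U s \<subseteq> W"
proof -
  obtain f where f: "f \<in> carrier A" "x \<in> basic f" "basic f \<subseteq> W" using basic_basis[OF W] .
  obtain s where "s \<in> carrier (sections X U)"
    "\<And>y. y \<in> U \<Longrightarrow> h U s (p y) = fraction A (p y) f \<one>" using global_section[OF f(1)] by auto
  then show ?thesis using that unit_locus_fraction[OF _ f(1)] f by auto
qed

text \<open>Near \<open>x\<close> the section \<open>r\<close> is a fraction b/k, and both b/1 and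
  k/1 come from sections over all of \<open>U\<close>. The quotient is expressed as a product
  equation with \<open>f\<close> invertible on \<open>V\<close>, a form preserved by any ring
  homomorphism.\<close>

lemma local_quotient:
  assumes W: "is_open X W" "x \<in> W" "x \<in> U" and r: "r \<in> carrier (sections X W)"
  obtains V a f where "is_open X V" "x \<in> V" "V \<subseteq> W \<inter> U"
    "a \<in> carrier (sections X U)" "f \<in> carrier (sections X U)" "V \<subseteq> unit_locus X U f"
    "restr X U V f \<otimes>\<^bsub>sections X V\<^esub> restr X W V r = restr X U V a"
proof -
  let ?W = "W \<inter> U"
  have Wo: "is_open X ?W" "?W \<subseteq> U" "?W \<subseteq> W" using W U_open by auto
  have r': "restr X W ?W r \<in> carrier (sections X ?W)" using Wo W r restr_closed by auto
  obtain V b k where V: "is_open X V" "x \<in> V" "V \<subseteq> ?W" "b \<in> carrier A" "k \<in> carrier A"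
    "\<And>y. y \<in> V \<Longrightarrow> k \<notin> p y \<and> h ?W (restr X W ?W r) (p y) = fraction A (p y) b k"
    using local_fraction[OF Wo(1,2) r', of x] W by (metis IntI)
  obtain a where a: "a \<in> carrier (sections X U)"
    "\<And>y. y \<in> U \<Longrightarrow> h U a (p y) = fraction A (p y) b \<one>" using global_section[OF V(4)] by auto
  obtain f where f: "f \<in> carrier (sections X U)"
    "\<And>y. y \<in> U \<Longrightarrow> h U f (p y) = fraction A (p y) k \<one>" using global_section[OF V(5)] by auto
  have VU: "V \<subseteq> U" "V \<subseteq> W" using V by auto
  have "unit_locus X U f = basic k" by (rule unit_locus_fraction[OF f(1) V(5)]) (rule f(2))
  then have ul: "V \<subseteq> unit_locus X U f" using V(6) VU(1) unfolding basic_def by auto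
  interpret R: cring "sections X V" using sections_cring[OF V(1)] .
  have c: "restr X U V f \<in> carrier (sections X V)" "restr X U V a \<in> carrier (sections X V)"
    "restr X W V r \<in> carrier (sections X V)"
    using f a r V W VU U_open restr_closed by auto
  have "restr X U V f \<otimes>\<^bsub>sections X V\<^esub> restr X W V r = restr X U V a"
  proof (rule h_eqI[OF V(1) VU(1)])
    fix y assume y: "y \<in> V"
    interpret P: spec_point "p y" A using point VU y by auto
    have yU: "y \<in> U" using y VU by auto
    have "restr X W V r = restr X ?W V (restr X W ?W r)"
      using restr_restr[of W ?W V r] W Wo V r by simp
    then have "h V (restr X W V r) (p y) = fraction A (p y) b k"
      using h_restr_apply[OF Wo(1) V(1,3) Wo(2) r' y] V(6)[OF y] by simp
    moreover have "h V (restr X U V f) (p y) = fraction A (p y) k \<one>"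
      "h V (restr X U V a) (p y) = fraction A (p y) b \<one>"
      using h_restr_apply[OF U_open V(1) VU(1) order_refl _ y] f a yU by auto
    moreover have "fraction A (p y) (k \<otimes> b) k = fraction A (p y) b \<one>"
      using V(4,5) V(6)[OF y] P.one_notin
      by (subst P.fraction_eq_iff) auto
    ultimately show "h V (restr X U V f \<otimes>\<^bsub>sections X V\<^esub> restr X W V r) (p y) = h V (restr X U V a) (p y)"
      using V(4,5) V(6)[OF y] P.one_notin
      by (simp add: h_mult[OF V(1) VU(1) c(1,3) y] P.fraction_mult)
  qed (use c in auto)
  then show ?thesis using that V a f ul by metis
qed

text \<open>Fractions are multiplied two at a time, hence the induction; that the denominator stays
  outside the prime is carried along because each multiplication needs it.\<close>

lemma h_pow_mult:
  assumes W: "is_open X W" "W \<subseteq> U" and f: "f \<in> carrier (sections X W)"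
    and s: "s \<in> carrier (sections X W)" and y: "y \<in> W"
    and c: "b \<in> carrier A" "g \<in> carrier A - p y" "c \<in> carrier A" "k \<in> carrier A - p y"
    and eq: "h W s (p y) = fraction A (p y) b g" "h W f (p y) = fraction A (p y) c k"
  shows "k [^] (n::nat) \<otimes> g \<in> carrier A - p y \<and>
    h W (f [^]\<^bsub>sections X W\<^esub> n \<otimes>\<^bsub>sections X W\<^esub> s) (p y) =
      fraction A (p y) (c [^] n \<otimes> b) (k [^] n \<otimes> g)"
proof -
  interpret R: cring "sections X W" using sections_cring[OF W(1)] .
  interpret P: spec_point "p y" A using point W y by auto
  show ?thesis
  proof (induction n)
    case 0
    then show ?case using c s eq by auto
  next
    case (Suc n)
    let ?t = "f [^]\<^bsub>sections X W\<^esub> n \<otimes>\<^bsub>sections X W\<^esub> s"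
    have "f [^]\<^bsub>sections X W\<^esub> Suc n \<otimes>\<^bsub>sections X W\<^esub> s = f \<otimes>\<^bsub>sections X W\<^esub> ?t"
      using f s by (simp add: R.m_ac)
    moreover have "c [^] Suc n \<otimes> b = c \<otimes> (c [^] n \<otimes> b)" "k [^] Suc n \<otimes> g = k \<otimes> (k [^] n \<otimes> g)"
      using c by (simp_all add: m_ac)
    moreover have "?t \<in> carrier (sections X W)" using f s by simp
    ultimately show ?case
      using Suc c P.mult_notin[OF c(4)] by (simp add: h_mult[OF W f _ y] eq P.fraction_mult)
  qed
qed

text \<open>On a small D(e) write s = b/g and f = c/k. On D(ec) the section \<open>f\<close> is a
  unit, so b/g = 0 there and some (ec)^n kills \<open>b\<close>. Since \<open>e\<close> vanishes
  nowhere on D(e), c^n b becomes zero in every localization at a point of D(e), which means that f^n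
  s = 0 on D(e).\<close>

lemma local_annihilation:
  assumes T: "is_open X T" "x \<in> T" "x \<in> U"
    and s: "s \<in> carrier (sections X T)" and f: "f \<in> carrier (sections X T)"
    and zero: "restr X T (unit_locus X T f) s = \<zero>\<^bsub>sections X (unit_locus X T f)\<^esub>"
  obtains W and n :: nat where "is_open X W" "x \<in> W" "W \<subseteq> T"
    "restr X T W (f [^]\<^bsub>sections X T\<^esub> n \<otimes>\<^bsub>sections X T\<^esub> s) = \<zero>\<^bsub>sections X W\<^esub>"
proof -
  let ?T = "T \<inter> U"
  have T': "is_open X ?T" "?T \<subseteq> U" "?T \<subseteq> T" "x \<in> ?T" using T U_open by auto
  have c': "restr X T ?T s \<in> carrier (sections X ?T)" "restr X T ?T f \<in> carrier (sections X ?T)"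
    using T' T s f restr_closed by auto
  obtain V b g where V: "is_open X V" "x \<in> V" "V \<subseteq> ?T" "b \<in> carrier A" "g \<in> carrier A"
    "\<And>y. y \<in> V \<Longrightarrow> g \<notin> p y \<and> h ?T (restr X T ?T s) (p y) = fraction A (p y) b g"
    using local_fraction[OF T'(1,2) c'(1) T'(4)] by metis
  obtain V' c k where V': "is_open X V'" "x \<in> V'" "V' \<subseteq> ?T" "c \<in> carrier A" "k \<in> carrier A"
    "\<And>y. y \<in> V' \<Longrightarrow> k \<notin> p y \<and> h ?T (restr X T ?T f) (p y) = fraction A (p y) c k"
    using local_fraction[OF T'(1,2) c'(2) T'(4)] by metis
  have "is_open X (V \<inter> V')" "V \<inter> V' \<subseteq> U" "x \<in> V \<inter> V'" using V(1-3) V'(1-3) by auto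
  then obtain e where e: "e \<in> carrier A" "x \<in> basic e" "basic e \<subseteq> V \<inter> V'"
    by (rule basic_basis)
  have frac: "h W (restr X T W s) (p y) = fraction A (p y) b g"
    "h W (restr X T W f) (p y) = fraction A (p y) c k" "g \<notin> p y" "k \<notin> p y"
    if W: "is_open X W" "W \<subseteq> basic e" "y \<in> W" for W y
  proof -
    have WT: "W \<subseteq> ?T" "y \<in> V" "y \<in> V'" using W e V by auto
    have "restr X T W s = restr X ?T W (restr X T ?T s)" "restr X T W f = restr X ?T W (restr X T ?T f)"
      using restr_restr[OF T(1) T'(1) W(1) WT(1) T'(3)] s f by auto
    then show "h W (restr X T W s) (p y) = fraction A (p y) b g"
      "h W (restr X T W f) (p y) = fraction A (p y) c k" "g \<notin> p y" "k \<notin> p y"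
      using h_restr_apply[OF T'(1) W(1) WT(1) T'(2) _ W(3)] c' V(6)[OF WT(2)] V'(6)[OF WT(3)] by auto
  qed
  have eT: "basic e \<subseteq> T" using e V by auto
  \<comment> \<open>The part of D(e) on which the numerator of \<open>f\<close> does not
    vanish.\<close>
  let ?E = "basic (e \<otimes> c)"
  have ec: "e \<otimes> c \<in> carrier A" using e V' by simp
  have E: "is_open X ?E" using basic_open[OF ec] .
  have E_iff: "y \<in> ?E \<longleftrightarrow> y \<in> basic e \<and> c \<notin> p y" for y
  proof (cases "y \<in> U")
    case True
    then interpret P: spec_point "p y" A using point by auto
    show ?thesis
      using True P.I_prime P.I_l_closed P.I_r_closed e V' unfolding basic_def by auto
  qed (simp add: basic_def)
  have Ee: "?E \<subseteq> basic e" using E_iff by auto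
  have EL: "?E \<subseteq> unit_locus X T f"
  proof (rule fraction_in_unit_locus[OF T(1) f E _ V'(4,5)])
    show "?E \<subseteq> T \<inter> U" using Ee eT basic_subset by auto
    show "c \<notin> p y \<and> k \<notin> p y" if "y \<in> ?E" for y using that E_iff frac(4)[OF E Ee that] by auto
  qed (use frac[OF E Ee] in auto)
  have sE: "restr X T ?E s = \<zero>\<^bsub>sections X ?E\<^esub>"
  proof -
    have "restr X T ?E s = restr X (unit_locus X T f) ?E (restr X T (unit_locus X T f) s)"
      using restr_restr[OF T(1) unit_locus_open E EL unit_locus_subset s] by simp
    then show ?thesis using zero restr_zero[OF unit_locus_open E EL] by simp
  qed
  \<comment> \<open>The primes avoiding ec are the points of \<open>?E\<close>, and vanishing of b/g
    there supplies the multiplier that kills \<open>b\<close>.\<close>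
  obtain n :: nat where n: "(e \<otimes> c) [^] n \<otimes> b = \<zero>"
  proof (rule power_annihilates[OF ec V(4)])
    fix P assume P: "primeideal P A" "e \<otimes> c \<notin> P"
    then obtain y where y: "y \<in> U" "P = p y" using p_bij unfolding bij_betw_def by auto
    interpret P: spec_point "p y" A using point y by auto
    have yE: "y \<in> ?E" using y P unfolding basic_def by simp
    have "fraction A (p y) b g = fraction A (p y) \<zero> \<one>"
      using frac(1)[OF E Ee yE] sE h_zero[OF E basic_subset yE] by simp
    then show "\<exists>q\<in>carrier A - P. q \<otimes> b = \<zero>"
      using P.fraction_eq_iff[of b g \<zero> \<one>] V frac(3)[OF E Ee yE] P.one_notin y by auto
  qed
  have Be: "is_open X (basic e)" using basic_open[OF e(1)] .
  interpret R: cring "sections X (basic e)" using sections_cring[OF Be] .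
  interpret RT: cring "sections X T" using sections_cring[OF T(1)] .
  have re: "restr X T (basic e) f \<in> carrier (sections X (basic e))"
    "restr X T (basic e) s \<in> carrier (sections X (basic e))"
    using restr_closed[OF T(1) Be eT] f s by auto
  have "restr X T (basic e) f [^]\<^bsub>sections X (basic e)\<^esub> n \<otimes>\<^bsub>sections X (basic e)\<^esub> restr X T (basic e) s =
      \<zero>\<^bsub>sections X (basic e)\<^esub>"
  proof (rule h_eqI[OF Be basic_subset])
    fix y assume y: "y \<in> basic e"
    then interpret P: spec_point "p y" A using point basic_subset by auto
    note fr = frac[OF Be order_refl y]
    have pw: "k [^] n \<otimes> g \<in> carrier A - p y"
      "h (basic e) (restr X T (basic e) f [^]\<^bsub>sections X (basic e)\<^esub> n
        \<otimes>\<^bsub>sections X (basic e)\<^esub> restr X T (basic e) s) (p y) = fraction A (p y) (c [^] n \<otimes> b) (k [^] n \<otimes> g)"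
      using h_pow_mult[OF Be basic_subset re y _ _ _ _ fr(1,2), of n] V(4,5) V'(4,5) fr(3,4) by auto
    have en: "e [^] n \<in> carrier A - p y"
    proof (induction n)
      case (Suc n)
      then show ?case using P.mult_notin[of "e [^] n" e] e y unfolding basic_def by simp
    qed (use P.one_notin in simp)
    \<comment> \<open>The factor e^n is split off to act as the multiplier outside the prime that
      witnesses equality with 0/1.\<close>
    have "e [^] n \<otimes> (\<one> \<otimes> (c [^] n \<otimes> b)) = (e \<otimes> c) [^] n \<otimes> b"
      using e V V' by (simp add: nat_pow_distrib m_assoc)
    then have "e [^] n \<otimes> (\<one> \<otimes> (c [^] n \<otimes> b)) = e [^] n \<otimes> ((k [^] n \<otimes> g) \<otimes> \<zero>)"
      using n e V V' by simp
    then have "fraction A (p y) (c [^] n \<otimes> b) (k [^] n \<otimes> g) = fraction A (p y) \<zero> \<one>"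
      using en pw(1) P.one_notin V V' by (subst P.fraction_eq_iff) auto
    then show "h (basic e) (restr X T (basic e) f [^]\<^bsub>sections X (basic e)\<^esub> n
        \<otimes>\<^bsub>sections X (basic e)\<^esub> restr X T (basic e) s) (p y) = h (basic e) \<zero>\<^bsub>sections X (basic e)\<^esub> (p y)"
      using pw(2) h_zero[OF Be basic_subset y] by simp
  qed (use re in auto)
  then have "restr X T (basic e) (f [^]\<^bsub>sections X T\<^esub> n \<otimes>\<^bsub>sections X T\<^esub> s) = \<zero>\<^bsub>sections X (basic e)\<^esub>"
    using T Be eT f s by (simp add: restr_mult restr_pow)
  then show ?thesis using that[OF Be e(2) eT] by simp
qed

end

section \<open>Kernels of closed immersions\<close>

lemma (in cring) unit_power_mult_eq_zero:
  assumes "u \<in> carrier R" "v \<in> carrier R" "u \<otimes> v = \<one>" "a \<in> carrier R"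
    and "u [^] (n::nat) \<otimes> a = \<zero>"
  shows "a = \<zero>"
proof -
  have "v [^] n \<otimes> (u [^] n \<otimes> a) = (u \<otimes> v) [^] n \<otimes> a"
    using assms(1,2,4) by (simp add: nat_pow_distrib m_ac)
  then show ?thesis using assms by simp
qed

lemma (in presheaf) unit_locus_restr:
  assumes U: "is_open X U" "f \<in> carrier (sections X U)" and V: "is_open X V" "V \<subseteq> U"
    and x: "x \<in> unit_locus X U f" "x \<in> V"
  shows "x \<in> unit_locus X V (restr X U V f)"
proof -
  obtain W g where W: "is_open X W" "x \<in> W" "W \<subseteq> U" "g \<in> carrier (sections X W)"
    "restr X U W f \<otimes>\<^bsub>sections X W\<^esub> g = \<one>\<^bsub>sections X W\<^esub>"
    using x(1) unfolding unit_locus_def by auto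
  let ?N = "W \<inter> V"
  have N: "is_open X ?N" "?N \<subseteq> W" "?N \<subseteq> V" "?N \<subseteq> U" using W V by auto
  have "restr X U ?N f \<otimes>\<^bsub>sections X ?N\<^esub> restr X W ?N g = \<one>\<^bsub>sections X ?N\<^esub>"
    using restr_mult[OF W(1) N(1,2) restr_closed[OF U(1) W(1,3) U(2)] W(4)]
      restr_restr[OF U(1) W(1) N(1,2) W(3) U(2)] restr_one[OF W(1) N(1,2)] W(5) by simp
  then have "restr X V ?N (restr X U V f) \<otimes>\<^bsub>sections X ?N\<^esub> restr X W ?N g = \<one>\<^bsub>sections X ?N\<^esub>"
    using restr_restr[OF U(1) V(1) N(1,3) V(2) U(2)] by simp
  moreover have "restr X W ?N g \<in> carrier (sections X ?N)" using restr_closed[OF W(1) N(1,2) W(4)] .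
  ultimately show ?thesis using N x(2) W(2) unfolding unit_locus_def by auto
qed

lemma (in presheaf_map) section_restr_zero:
  assumes "is_open X U" "is_open X V" "V \<subseteq> U" "a \<in> carrier (sections X U)"
    and "section_map \<phi> U a = \<zero>\<^bsub>sections Y (preimage Y \<phi> U)\<^esub>"
  shows "section_map \<phi> V (restr X U V a) = \<zero>\<^bsub>sections Y (preimage Y \<phi> V)\<^esub>"
proof -
  have "preimage Y \<phi> V \<subseteq> preimage Y \<phi> U" using assms(3) unfolding preimage_def by auto
  then show ?thesis
    using assms(5) section_restr[OF assms(1-4)]
      Y.restr_zero[OF preimage_open[OF assms(1)] preimage_open[OF assms(2)]] by simp
qed

text \<open>Near \<open>x\<close> the section \<open>e\<close> has an inverse, which is pulled back
  along with it and cancels the power. It undoes the multiplication that \<open>kernel_power\<close>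
  introduces.\<close>

lemma (in presheaf_map) cancel_unit_power:
  assumes U: "is_open X U" and e: "e \<in> carrier (sections X U)" and a: "a \<in> carrier (sections X U)"
    and zero: "section_map \<phi> U (e [^]\<^bsub>sections X U\<^esub> (n::nat) \<otimes>\<^bsub>sections X U\<^esub> a) =
      \<zero>\<^bsub>sections Y (preimage Y \<phi> U)\<^esub>"
    and x: "x \<in> unit_locus X U e"
  obtains V where "is_open X V" "x \<in> V" "V \<subseteq> U"
    "section_map \<phi> V (restr X U V a) = \<zero>\<^bsub>sections Y (preimage Y \<phi> V)\<^esub>"
proof -
  obtain V g where V: "is_open X V" "x \<in> V" "V \<subseteq> U" "g \<in> carrier (sections X V)"
    "restr X U V e \<otimes>\<^bsub>sections X V\<^esub> g = \<one>\<^bsub>sections X V\<^esub>"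
    using x unfolding unit_locus_def by auto
  interpret U: cring "sections X U" using X.sections_cring[OF U] .
  interpret V: cring "sections X V" using X.sections_cring[OF V(1)] .
  interpret S: cring "sections Y (preimage Y \<phi> V)" using Y.sections_cring[OF preimage_open[OF V(1)]] .
  interpret hom: ring_hom_ring "sections X V" "sections Y (preimage Y \<phi> V)" "section_map \<phi> V"
    using section_ring_hom[OF V(1)] .
  have c: "restr X U V e \<in> carrier (sections X V)" "restr X U V a \<in> carrier (sections X V)"
    using X.restr_closed[OF U V(1,3)] e a by auto
  let ?u = "section_map \<phi> V (restr X U V e)" and ?b = "section_map \<phi> V (restr X U V a)"
  have "section_map \<phi> V (restr X U V (e [^]\<^bsub>sections X U\<^esub> n \<otimes>\<^bsub>sections X U\<^esub> a)) =
      \<zero>\<^bsub>sections Y (preimage Y \<phi> V)\<^esub>"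
    using section_restr_zero[OF U V(1,3) _ zero] e a by simp
  then have "?u [^]\<^bsub>sections Y (preimage Y \<phi> V)\<^esub> n \<otimes>\<^bsub>sections Y (preimage Y \<phi> V)\<^esub> ?b =
      \<zero>\<^bsub>sections Y (preimage Y \<phi> V)\<^esub>"
    using e a c by (simp add: X.restr_mult[OF U V(1,3)] X.restr_pow[OF U V(1,3)] hom.hom_nat_pow)
  moreover have "?u \<otimes>\<^bsub>sections Y (preimage Y \<phi> V)\<^esub> section_map \<phi> V g = \<one>\<^bsub>sections Y (preimage Y \<phi> V)\<^esub>"
    using V(4,5) c hom.hom_mult[of "restr X U V e" g] by simp
  ultimately have "?b = \<zero>\<^bsub>sections Y (preimage Y \<phi> V)\<^esub>"
    using S.unit_power_mult_eq_zero c V(4) hom.hom_closed by metis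
  then show ?thesis using that V by auto
qed

section \<open>Annihilation by powers along one closed immersion\<close>

locale closed_imm = lrs_morphism Y X \<phi>
  for Y :: "('b, 's) ringed_space" and X :: "('a, 'r) ringed_space" and \<phi> +
  assumes immersion: "closed_immersion Y X \<phi>"
begin

lemma inj: "y \<in> points Y \<Longrightarrow> y' \<in> points Y \<Longrightarrow> point_map \<phi> y = point_map \<phi> y' \<Longrightarrow> y = y'"
  using immersion unfolding closed_immersion_def inj_on_def by simp

lemma image_closed: "closedin (space_top Y) C \<Longrightarrow> closedin (space_top X) (point_map \<phi> ` C)"
  using immersion unfolding closed_immersion_def closed_map_def by simp

text \<open>The complement of the image of the closed set points Y - W is open, and by injectivity
  its preimage is \<open>W\<close>. So the source carries the topology induced from
  \<open>X\<close>.\<close>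

lemma open_is_preimage:
  assumes "is_open Y W"
  obtains N where "is_open X N" "preimage Y \<phi> N = W"
proof -
  let ?N = "points X - point_map \<phi> ` (points Y - W)"
  have "closedin (space_top Y) (points Y - W)" using assms by auto
  then have "is_open X ?N" using image_closed by auto
  moreover have "preimage Y \<phi> ?N = W"
    using openin_subset[OF assms] point_closed inj unfolding preimage_def by auto
  ultimately show ?thesis by (rule that)
qed

text \<open>At a point of the image this is the computation in an affine chart of the source, whose
  neighbourhood is then written as the preimage of one in \<open>X\<close>. Off the image the
  preimage of a neighbourhood is empty and the exponent 0 will do.\<close>

lemma local_annihilation:
  assumes U: "is_open X U" and f: "f \<in> carrier (sections X U)" and a: "a \<in> carrier (sections X U)"
    and zero: "restr Y (preimage Y \<phi> U) (preimage Y \<phi> (unit_locus X U f)) (section_map \<phi> U a) =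
      \<zero>\<^bsub>sections Y (preimage Y \<phi> (unit_locus X U f))\<^esub>"
    and x: "x \<in> U"
  obtains N and n :: nat where "is_open X N" "x \<in> N" "N \<subseteq> U"
    "restr Y (preimage Y \<phi> U) (preimage Y \<phi> N)
      (section_map \<phi> U f [^]\<^bsub>sections Y (preimage Y \<phi> U)\<^esub> n
        \<otimes>\<^bsub>sections Y (preimage Y \<phi> U)\<^esub> section_map \<phi> U a) = \<zero>\<^bsub>sections Y (preimage Y \<phi> N)\<^esub>"
proof (cases "x \<in> point_map \<phi> ` points Y")
  case False
  let ?T = "preimage Y \<phi> U" and ?N = "U - point_map \<phi> ` points Y"
  let ?s = "section_map \<phi> U f [^]\<^bsub>sections Y ?T\<^esub> (0::nat) \<otimes>\<^bsub>sections Y ?T\<^esub> section_map \<phi> U a"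
  have "closedin (space_top X) (point_map \<phi> ` points Y)" using image_closed by auto
  then have N: "is_open X ?N" using U by auto
  have emp: "preimage Y \<phi> ?N = {}" unfolding preimage_def by auto
  interpret R: cring "sections Y ?T" using Y.sections_cring[OF preimage_open[OF U]] .
  interpret E: cring "sections Y {}" using Y.sections_cring by auto
  have "restr Y ?T {} ?s = \<zero>\<^bsub>sections Y {}\<^esub>"
    using section_closed[OF U] f a
    by (intro Y.empty_section_eq Y.restr_closed[OF preimage_open[OF U]]) auto
  then show ?thesis using that[of ?N 0] N False x unfolding emp by auto
next
  case True
  let ?T = "preimage Y \<phi> U" and ?f = "section_map \<phi> U f" and ?a = "section_map \<phi> U a"
  obtain y where y: "y \<in> points Y" "x = point_map \<phi> y" using True by auto
  have yT: "y \<in> ?T" using x y unfolding preimage_def by auto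
  obtain V where V: "y \<in> V" "affine_open Y V"
    using immersion y unfolding closed_immersion_def scheme_def by auto
  obtain A p h where "affine_chart Y A V p h" using Y.affine_open_chart[OF V(2)] .
  then interpret C: affine_chart Y A V p h .
  let ?L = "unit_locus Y ?T ?f"
  have LT: "?L \<subseteq> ?T" by (rule unit_locus_subset)
  \<comment> \<open>The chart computation asks for vanishing on the unit locus of the pulled back
    section, whereas \<open>zero\<close> speaks of the preimage of the unit locus of
    \<open>f\<close>; locality supplies the inclusion needed to restrict.\<close>
  have sub: "?L \<subseteq> preimage Y \<phi> (unit_locus X U f)"
    using unit_locus_preimage[OF U f] LT unfolding preimage_def by auto
  have "preimage Y \<phi> (unit_locus X U f) \<subseteq> ?T"
    using unit_locus_subset[of X U f] unfolding preimage_def by auto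
  then have "restr Y ?T ?L ?a = \<zero>\<^bsub>sections Y ?L\<^esub>"
    using Y.restr_restr[OF preimage_open[OF U] preimage_open[OF unit_locus_open] unit_locus_open sub _
        section_closed[OF U a]]
      zero Y.restr_zero[OF preimage_open[OF unit_locus_open] unit_locus_open sub] by simp
  then obtain W and n :: nat where W: "is_open Y W" "y \<in> W" "W \<subseteq> ?T"
    "restr Y ?T W (?f [^]\<^bsub>sections Y ?T\<^esub> n \<otimes>\<^bsub>sections Y ?T\<^esub> ?a) = \<zero>\<^bsub>sections Y W\<^esub>"
    using C.local_annihilation[OF preimage_open[OF U] yT V(1) section_closed[OF U a] section_closed[OF U f]]
    by auto
  obtain N where N: "is_open X N" "preimage Y \<phi> N = W" using open_is_preimage[OF W(1)] .
  have "preimage Y \<phi> (N \<inter> U) = W" using N(2) W(3) unfolding preimage_def by auto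
  moreover have "x \<in> N \<inter> U" using x y W(2) N(2) unfolding preimage_def by auto
  ultimately show ?thesis using that[of "N \<inter> U" n] N(1) U W(4) by auto
qed

text \<open>The neighbourhoods in the local statement are open in \<open>X\<close>, so
  quasi-compactness of \<open>U\<close> leaves finitely many exponents, and the largest serves for
  all of them.\<close>

lemma kernel_power:
  assumes U: "affine_open X U" and f: "f \<in> carrier (sections X U)" and a: "a \<in> carrier (sections X U)"
    and zero: "restr Y (preimage Y \<phi> U) (preimage Y \<phi> (unit_locus X U f)) (section_map \<phi> U a) =
      \<zero>\<^bsub>sections Y (preimage Y \<phi> (unit_locus X U f))\<^esub>"
  obtains n :: nat where "section_map \<phi> U (f [^]\<^bsub>sections X U\<^esub> n \<otimes>\<^bsub>sections X U\<^esub> a) =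
    \<zero>\<^bsub>sections Y (preimage Y \<phi> U)\<^esub>"
proof -
  have Uo: "is_open X U" using U unfolding affine_open_def by simp
  obtain A p h where "affine_chart X A U p h" using X.affine_open_chart[OF U] .
  then interpret C: affine_chart X A U p h .
  let ?T = "preimage Y \<phi> U" and ?f = "section_map \<phi> U f" and ?a = "section_map \<phi> U a"
  let ?s = "\<lambda>n::nat. ?f [^]\<^bsub>sections Y ?T\<^esub> n \<otimes>\<^bsub>sections Y ?T\<^esub> ?a"
  have To: "is_open Y ?T" using preimage_open[OF Uo] .
  interpret R: cring "sections X U" using X.sections_cring[OF Uo] .
  interpret T: cring "sections Y ?T" using Y.sections_cring[OF To] .
  interpret hom: ring_hom_ring "sections X U" "sections Y ?T" "section_map \<phi> U"
    using section_ring_hom[OF Uo] .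
  have fa: "?f \<in> carrier (sections Y ?T)" "?a \<in> carrier (sections Y ?T)" using f a by simp_all
  let ?P = "\<lambda>N n. is_open X N \<and> N \<subseteq> U \<and>
    restr Y ?T (preimage Y \<phi> N) (?s n) = \<zero>\<^bsub>sections Y (preimage Y \<phi> N)\<^esub>"
  have cov: "U \<subseteq> \<Union>{N. \<exists>n. ?P N n}"
  proof
    fix x assume "x \<in> U"
    then obtain N n where "x \<in> N" "?P N n" using local_annihilation[OF Uo f a zero] by metis
    then show "x \<in> \<Union>{N. \<exists>n. ?P N n}" by (intro UnionI[of N] CollectI exI[of _ n])
  qed
  have opn: "\<And>N. N \<in> {N. \<exists>n. ?P N n} \<Longrightarrow> is_open X N" by auto
  obtain \<F> where \<F>: "finite \<F>" "\<F> \<subseteq> {N. \<exists>n. ?P N n}" "U \<subseteq> \<Union>\<F>"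
    using compactinD[OF C.compact opn cov] by auto
  have "\<forall>N\<in>\<F>. \<exists>n. ?P N n" using \<F>(2) by auto
  then obtain n where n: "\<And>N. N \<in> \<F> \<Longrightarrow> ?P N (n N)" by metis
  \<comment> \<open>The inserted 0 gives the maximum a meaning when the finite cover is
    empty.\<close>
  let ?m = "Max (insert 0 (n ` \<F>))"
  have "?s ?m = \<zero>\<^bsub>sections Y ?T\<^esub>"
  proof (rule Y.section_eqI[OF To])
    fix y assume y: "y \<in> ?T"
    then obtain N where N: "N \<in> \<F>" "point_map \<phi> y \<in> N" using \<F>(3) unfolding preimage_def by auto
    have le: "n N \<le> ?m" using \<F>(1) N(1) by (intro Max_ge) auto
    let ?V = "preimage Y \<phi> N"
    have No: "is_open X N" "N \<subseteq> U" "restr Y ?T ?V (?s (n N)) = \<zero>\<^bsub>sections Y ?V\<^esub>" using n[OF N(1)] by auto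
    have V: "is_open Y ?V" "?V \<subseteq> ?T" "y \<in> ?V"
      using preimage_open[OF No(1)] No(2) N(2) y unfolding preimage_def by auto
    interpret V: cring "sections Y ?V" using Y.sections_cring[OF V(1)] .
    have "?s ?m = ?f [^]\<^bsub>sections Y ?T\<^esub> (?m - n N) \<otimes>\<^bsub>sections Y ?T\<^esub> ?s (n N)"
      using fa le T.nat_pow_mult[OF fa(1), of "?m - n N" "n N"]
      by (simp add: T.m_assoc[symmetric])
    then have "restr Y ?T ?V (?s ?m) = restr Y ?T ?V (?f [^]\<^bsub>sections Y ?T\<^esub> (?m - n N)) \<otimes>\<^bsub>sections Y ?V\<^esub> \<zero>\<^bsub>sections Y ?V\<^esub>"
      using Y.restr_mult[OF To V(1,2)] fa No(3) by simp
    also have "\<dots> = \<zero>\<^bsub>sections Y ?V\<^esub>" using Y.restr_closed[OF To V(1,2)] fa by simp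
    finally have "restr Y ?T ?V (?s ?m) = restr Y ?T ?V \<zero>\<^bsub>sections Y ?T\<^esub>"
      using Y.restr_zero[OF To V(1,2)] by simp
    then show "\<exists>W. is_open Y W \<and> y \<in> W \<and> W \<subseteq> ?T \<and> restr Y ?T W (?s ?m) = restr Y ?T W \<zero>\<^bsub>sections Y ?T\<^esub>"
      using V by (intro exI[of _ ?V]) simp
  qed (use fa in auto)
  then have "section_map \<phi> U (f [^]\<^bsub>sections X U\<^esub> ?m \<otimes>\<^bsub>sections X U\<^esub> a) = \<zero>\<^bsub>sections Y ?T\<^esub>"
    using f a by (simp add: hom.hom_nat_pow)
  then show ?thesis by (rule that)
qed

end

section \<open>Transfer of kernels and images between two closed immersions\<close>

locale two_imm = \<phi>: closed_imm Y X \<phi> + \<psi>: closed_imm Z X \<psi>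
  for Y :: "('b, 's) ringed_space" and X :: "('a, 'r) ringed_space" and \<phi>
    and Z :: "('c, 't) ringed_space" and \<psi>
begin

text \<open>The hypothesis \<open>ker\<close> speaks only of sections over the whole of
  \<open>U\<close>, while \<open>a\<close> is killed merely near \<open>x\<close>. Inside that
  neighbourhood lies some D(e) around \<open>x\<close>; multiplying by a power of \<open>e\<close>
  moves the question to \<open>U\<close>, and for \<psi> the power is cancelled again near
  \<open>x\<close>.\<close>

lemma kernel_power_transfer:
  assumes U: "affine_open X U"
    and ker: "\<And>a. a \<in> carrier (sections X U) \<Longrightarrow>
      section_map \<phi> U a = \<zero>\<^bsub>sections Y (preimage Y \<phi> U)\<^esub> \<Longrightarrow>
      section_map \<psi> U a = \<zero>\<^bsub>sections Z (preimage Z \<psi> U)\<^esub>"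
    and a: "a \<in> carrier (sections X U)" and V: "is_open X V" "V \<subseteq> U" "x \<in> V"
    and zero: "section_map \<phi> V (restr X U V a) = \<zero>\<^bsub>sections Y (preimage Y \<phi> V)\<^esub>"
  obtains N where "is_open X N" "x \<in> N" "N \<subseteq> U"
    "section_map \<psi> N (restr X U N a) = \<zero>\<^bsub>sections Z (preimage Z \<psi> N)\<^esub>"
proof -
  have Uo: "is_open X U" using U unfolding affine_open_def by simp
  obtain A p h where "affine_chart X A U p h" using \<phi>.X.affine_open_chart[OF U] .
  then interpret C: affine_chart X A U p h .
  obtain e where e: "e \<in> carrier (sections X U)" "x \<in> unit_locus X U e" "unit_locus X U e \<subseteq> V"
    using C.unit_locus_basis[OF V] .
  let ?L = "unit_locus X U e"
  interpret R: cring "sections X U" using \<phi>.X.sections_cring[OF Uo] .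
  have rL: "restr X V ?L (restr X U V a) = restr X U ?L a"
    using \<phi>.X.restr_restr[OF Uo V(1) unit_locus_open e(3) V(2) a] .
  have "section_map \<phi> ?L (restr X U ?L a) = \<zero>\<^bsub>sections Y (preimage Y \<phi> ?L)\<^esub>"
    using \<phi>.section_restr_zero[OF V(1) unit_locus_open e(3) \<phi>.X.restr_closed[OF Uo V(1,2) a] zero] rL
    by simp
  then have "restr Y (preimage Y \<phi> U) (preimage Y \<phi> ?L) (section_map \<phi> U a) = \<zero>\<^bsub>sections Y (preimage Y \<phi> ?L)\<^esub>"
    using \<phi>.section_restr[OF Uo unit_locus_open unit_locus_subset a] by simp
  then obtain n :: nat where "section_map \<phi> U (e [^]\<^bsub>sections X U\<^esub> n \<otimes>\<^bsub>sections X U\<^esub> a) =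
      \<zero>\<^bsub>sections Y (preimage Y \<phi> U)\<^esub>"
    by (rule \<phi>.kernel_power[OF U e(1) a])
  then have "section_map \<psi> U (e [^]\<^bsub>sections X U\<^esub> n \<otimes>\<^bsub>sections X U\<^esub> a) =
      \<zero>\<^bsub>sections Z (preimage Z \<psi> U)\<^esub>"
    using ker e a by simp
  then show ?thesis using \<psi>.cancel_unit_power[OF Uo e(1) a _ e(2)] that by metis
qed

text \<open>The complement of the image of \<phi> in \<open>U\<close> has empty preimage, so \<phi>
  kills 1 over it. If the image of \<open>z\<close> lay there, \<psi> would kill 1 near that point
  as well, which the local ring at \<open>z\<close> forbids.\<close>

lemma image_transfer:
  assumes U: "affine_open X U"
    and ker: "\<And>a. a \<in> carrier (sections X U) \<Longrightarrow>
      section_map \<phi> U a = \<zero>\<^bsub>sections Y (preimage Y \<phi> U)\<^esub> \<Longrightarrow>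
      section_map \<psi> U a = \<zero>\<^bsub>sections Z (preimage Z \<psi> U)\<^esub>"
    and z: "z \<in> points Z" "point_map \<psi> z \<in> U"
  shows "point_map \<psi> z \<in> point_map \<phi> ` points Y"
proof (rule ccontr)
  assume n: "point_map \<psi> z \<notin> point_map \<phi> ` points Y"
  have Uo: "is_open X U" using U unfolding affine_open_def by simp
  let ?V = "U - point_map \<phi> ` points Y"
  have "closedin (space_top X) (point_map \<phi> ` points Y)" using \<phi>.image_closed by auto
  then have V: "is_open X ?V" "?V \<subseteq> U" "point_map \<psi> z \<in> ?V" using Uo n z by auto
  have emp: "preimage Y \<phi> ?V = {}" unfolding preimage_def by auto
  interpret R: cring "sections X U" using \<phi>.X.sections_cring[OF Uo] .
  interpret E: cring "sections Y {}" using \<phi>.Y.sections_cring by auto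
  have "section_map \<phi> ?V (restr X U ?V \<one>\<^bsub>sections X U\<^esub>) = \<zero>\<^bsub>sections Y (preimage Y \<phi> ?V)\<^esub>"
    unfolding emp using \<phi>.section_closed[OF V(1)] \<phi>.X.restr_closed[OF Uo V(1,2)]
    by (intro \<phi>.Y.empty_section_eq) (auto simp: emp)
  then obtain N where N: "is_open X N" "point_map \<psi> z \<in> N" "N \<subseteq> U"
    "section_map \<psi> N (restr X U N \<one>\<^bsub>sections X U\<^esub>) = \<zero>\<^bsub>sections Z (preimage Z \<psi> N)\<^esub>"
    using kernel_power_transfer[OF U ker R.one_closed V] by metis
  then have "\<one>\<^bsub>sections Z (preimage Z \<psi> N)\<^esub> = \<zero>\<^bsub>sections Z (preimage Z \<psi> N)\<^esub>"
    using \<phi>.X.restr_one[OF Uo N(1,3)] ring_hom_one[OF \<psi>.section_hom[OF N(1)]] by simp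
  moreover have "z \<in> preimage Z \<psi> N" using z N unfolding preimage_def by auto
  ultimately show False using \<psi>.Y.nonempty_one_not_zero[OF \<psi>.preimage_open[OF N(1)]] by simp
qed

text \<open>Near each point write r = a/f with \<open>a\<close> and \<open>f\<close> over a member
  of the cover. Then \<phi> kills a = fr locally, so by \<open>kernel_power_transfer\<close> \<psi>
  does too, and the unit \<open>f\<close> is cancelled from fr.\<close>

lemma kernel_transfer:
  assumes \<C>: "affine_open_cover X \<C>"
    and ker: "\<And>U a. U \<in> \<C> \<Longrightarrow> a \<in> carrier (sections X U) \<Longrightarrow>
      section_map \<phi> U a = \<zero>\<^bsub>sections Y (preimage Y \<phi> U)\<^esub> \<Longrightarrow>
      section_map \<psi> U a = \<zero>\<^bsub>sections Z (preimage Z \<psi> U)\<^esub>"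
    and W: "is_open X W" and r: "r \<in> carrier (sections X W)"
    and zero: "section_map \<phi> W r = \<zero>\<^bsub>sections Y (preimage Y \<phi> W)\<^esub>"
  shows "section_map \<psi> W r = \<zero>\<^bsub>sections Z (preimage Z \<psi> W)\<^esub>"
proof (rule \<psi>.Y.section_eqI[OF \<psi>.preimage_open[OF W] \<psi>.section_closed[OF W r]])
  interpret ZW: cring "sections Z (preimage Z \<psi> W)" using \<psi>.Y.sections_cring[OF \<psi>.preimage_open[OF W]] .
  show "\<zero>\<^bsub>sections Z (preimage Z \<psi> W)\<^esub> \<in> carrier (sections Z (preimage Z \<psi> W))" by simp
  fix z assume z: "z \<in> preimage Z \<psi> W"
  let ?x = "point_map \<psi> z"
  have zx: "z \<in> points Z" "?x \<in> W" using z unfolding preimage_def by auto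
  then have "?x \<in> \<Union>\<C>" using \<C> \<psi>.point_closed unfolding affine_open_cover_def by simp
  then obtain U where U: "U \<in> \<C>" "?x \<in> U" by auto
  then have aff: "affine_open X U" using \<C> unfolding affine_open_cover_def by simp
  then have Uo: "is_open X U" unfolding affine_open_def by simp
  obtain A p h where "affine_chart X A U p h" using \<phi>.X.affine_open_chart[OF aff] .
  then interpret C: affine_chart X A U p h .
  obtain V a f where V: "is_open X V" "?x \<in> V" "V \<subseteq> W \<inter> U"
    "a \<in> carrier (sections X U)" "f \<in> carrier (sections X U)" "V \<subseteq> unit_locus X U f"
    "restr X U V f \<otimes>\<^bsub>sections X V\<^esub> restr X W V r = restr X U V a"
    using C.local_quotient[OF W zx(2) U(2) r] .
  have VU: "V \<subseteq> U" "V \<subseteq> W" using V(3) by auto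
  have c: "restr X U V f \<in> carrier (sections X V)" "restr X W V r \<in> carrier (sections X V)"
    using \<phi>.X.restr_closed V VU Uo W r by auto
  interpret V: cring "sections X V" using \<phi>.X.sections_cring[OF V(1)] .
  interpret YV: cring "sections Y (preimage Y \<phi> V)" using \<phi>.Y.sections_cring[OF \<phi>.preimage_open[OF V(1)]] .
  have "section_map \<phi> V (restr X U V a) = \<zero>\<^bsub>sections Y (preimage Y \<phi> V)\<^esub>"
    using ring_hom_mult[OF \<phi>.section_hom[OF V(1)] c] \<phi>.section_restr_zero[OF W V(1) VU(2) r zero]
      \<phi>.section_closed[OF V(1) c(1)] V(7) by simp
  then obtain M where M: "is_open X M" "?x \<in> M" "M \<subseteq> U"
    "section_map \<psi> M (restr X U M a) = \<zero>\<^bsub>sections Z (preimage Z \<psi> M)\<^esub>"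
    using kernel_power_transfer[OF aff ker[OF U(1)] V(4) V(1) VU(1) V(2)] by metis
  let ?N = "M \<inter> V"
  have N: "is_open X ?N" "?x \<in> ?N" "?N \<subseteq> M" "?N \<subseteq> V" "?N \<subseteq> U" "?N \<subseteq> W" using M V by auto
  have cN: "restr X U ?N f \<in> carrier (sections X ?N)" "restr X W ?N r \<in> carrier (sections X ?N)"
    using \<phi>.X.restr_closed N V Uo W r by auto
  have "restr X U ?N a = restr X V ?N (restr X U V f \<otimes>\<^bsub>sections X V\<^esub> restr X W V r)"
    using \<phi>.X.restr_restr[OF Uo V(1) N(1,4) VU(1) V(4)] V(7) by simp
  also have "\<dots> = restr X U ?N f \<otimes>\<^bsub>sections X ?N\<^esub> restr X W ?N r"
    using \<phi>.X.restr_mult[OF V(1) N(1,4) c] \<phi>.X.restr_restr[OF Uo V(1) N(1,4) VU(1) V(5)]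
      \<phi>.X.restr_restr[OF W V(1) N(1,4) VU(2) r] by simp
  finally have "restr X M ?N (restr X U M a) = restr X U ?N f \<otimes>\<^bsub>sections X ?N\<^esub> restr X W ?N r"
    using \<phi>.X.restr_restr[OF Uo M(1) N(1,3) M(3) V(4)] by simp
  then have "section_map \<psi> ?N (restr X U ?N f \<otimes>\<^bsub>sections X ?N\<^esub> restr X W ?N r) =
      \<zero>\<^bsub>sections Z (preimage Z \<psi> ?N)\<^esub>"
    using \<psi>.section_restr_zero[OF M(1) N(1,3) \<phi>.X.restr_closed[OF Uo M(1,3) V(4)] M(4)] by simp
  moreover interpret N: cring "sections X ?N" using \<phi>.X.sections_cring[OF N(1)] .
  \<comment> \<open>The denominator is brought into the form of a first power, since
    \<open>cancel_unit_power\<close> cancels powers.\<close>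
  have "restr X U ?N f [^]\<^bsub>sections X ?N\<^esub> (1::nat) = restr X U ?N f" using cN by simp
  ultimately have "section_map \<psi> ?N (restr X U ?N f [^]\<^bsub>sections X ?N\<^esub> (1::nat)
      \<otimes>\<^bsub>sections X ?N\<^esub> restr X W ?N r) = \<zero>\<^bsub>sections Z (preimage Z \<psi> ?N)\<^esub>" by simp
  moreover have "?x \<in> unit_locus X ?N (restr X U ?N f)"
    using \<phi>.X.unit_locus_restr[OF Uo V(5) N(1,5) _ N(2)] V(2,6) by auto
  ultimately obtain Q where Q: "is_open X Q" "?x \<in> Q" "Q \<subseteq> ?N"
    "section_map \<psi> Q (restr X ?N Q (restr X W ?N r)) = \<zero>\<^bsub>sections Z (preimage Z \<psi> Q)\<^esub>"
    using \<psi>.cancel_unit_power[OF N(1) cN, of 1 ?x] by metis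
  have QW: "Q \<subseteq> W" using Q(3) N(6) by auto
  have pQ: "preimage Z \<psi> Q \<subseteq> preimage Z \<psi> W" using QW unfolding preimage_def by auto
  have "restr Z (preimage Z \<psi> W) (preimage Z \<psi> Q) (section_map \<psi> W r) = \<zero>\<^bsub>sections Z (preimage Z \<psi> Q)\<^esub>"
    using Q(4) \<phi>.X.restr_restr[OF W N(1) Q(1,3) N(6) r] \<psi>.section_restr[OF W Q(1) QW r] by simp
  then show "\<exists>M. is_open Z M \<and> z \<in> M \<and> M \<subseteq> preimage Z \<psi> W \<and>
      restr Z (preimage Z \<psi> W) M (section_map \<psi> W r) =
      restr Z (preimage Z \<psi> W) M \<zero>\<^bsub>sections Z (preimage Z \<psi> W)\<^esub>"
    using \<psi>.Y.restr_zero[OF \<psi>.preimage_open[OF W] \<psi>.preimage_open[OF Q(1)] pQ] pQ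
      \<psi>.preimage_open[OF Q(1)] Q(2) zx(1)
    by (intro exI[of _ "preimage Z \<psi> Q"]) (simp add: preimage_def)
qed

end

section \<open>Comparison of closed immersions with equal kernels\<close>

text \<open>Surjectivity on stalks provides \<open>r\<close> whose pullback has the germ of
  \<open>s\<close> at \<open>y\<close>. The two agree on an open set of the source, and that set is
  again the preimage of an open set of \<open>X\<close>.\<close>

lemma (in closed_imm) local_lift:
  assumes W: "is_open Y W" and s: "s \<in> carrier (sections Y W)" and y: "y \<in> W"
  obtains U r where "is_open X U" "point_map \<phi> y \<in> U" "r \<in> carrier (sections X U)"
    "preimage Y \<phi> U \<subseteq> W" "restr Y W (preimage Y \<phi> U) s = section_map \<phi> U r"
proof -
  have yY: "y \<in> points Y" using openin_subset[OF W] y by auto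
  have "germ Y y W s \<in> stalk_map Y \<phi> y ` carrier (stalk X (point_map \<phi> y))"
    using immersion Y.germ_in_stalk[OF W y s] yY unfolding closed_immersion_def by simp
  then obtain a where a: "a \<in> carrier (stalk X (point_map \<phi> y))" "germ Y y W s = stalk_map Y \<phi> y a"
    by auto
  obtain U r where U: "is_open X U" "point_map \<phi> y \<in> U" "r \<in> carrier (sections X U)"
    "a = germ X (point_map \<phi> y) U r"
    using X.in_stalkE[OF a(1)] .
  have yU: "y \<in> preimage Y \<phi> U" using yY U(2) unfolding preimage_def by simp
  have "germ Y y W s = germ Y y (preimage Y \<phi> U) (section_map \<phi> U r)"
    using a(2) U(4) stalk_map_germ[OF yY U(1-3)] by simp
  then obtain M where M: "is_open Y M" "y \<in> M" "M \<subseteq> W \<inter> preimage Y \<phi> U"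
    "restr Y W M s = restr Y (preimage Y \<phi> U) M (section_map \<phi> U r)"
    using Y.germ_eq_iff[OF W y s preimage_open[OF U(1)] yU section_closed[OF U(1,3)]] by auto
  obtain N where N: "is_open X N" "preimage Y \<phi> N = M" using open_is_preimage[OF M(1)] .
  let ?N = "N \<inter> U"
  have No: "is_open X ?N" "?N \<subseteq> U" using N U by auto
  have pN: "preimage Y \<phi> ?N = M" using N(2) M(3) unfolding preimage_def by auto
  show ?thesis
  proof (rule that[OF No(1)])
    show "point_map \<phi> y \<in> ?N" using N(2) M(2) U(2) unfolding preimage_def by auto
    show "restr X U ?N r \<in> carrier (sections X ?N)" using X.restr_closed[OF U(1) No U(3)] .
    show "preimage Y \<phi> ?N \<subseteq> W" using pN M(3) by simp
    show "restr Y W (preimage Y \<phi> ?N) s = section_map \<phi> ?N (restr X U ?N r)"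
      using M(4) section_restr[OF U(1) No U(3)] pN by simp
  qed
qed

section \<open>Matching the points and sections of two sources\<close>

definition comparison_point ::
    "('b, 's, 'a, 'r) space_map \<Rightarrow> ('c, 't) ringed_space \<Rightarrow> ('c, 't, 'a, 'r) space_map \<Rightarrow> 'b \<Rightarrow> 'c"
  where "comparison_point \<phi> Z \<psi> y = inv_into (points Z) (point_map \<psi>) (point_map \<phi> y)"

text \<open>This will be the preimage under the comparison map. It is introduced separately because
  the section maps of \<open>comparison\<close> must refer to it before that record exists.\<close>

definition comparison_preimage :: "('b, 's) ringed_space \<Rightarrow> ('b, 's, 'a, 'r) space_map \<Rightarrow>
    ('c, 't) ringed_space \<Rightarrow> ('c, 't, 'a, 'r) space_map \<Rightarrow> 'c set \<Rightarrow> 'b set"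
  where "comparison_preimage Y \<phi> Z \<psi> V = {y \<in> points Y. comparison_point \<phi> Z \<psi> y \<in> V}"

text \<open>The graph of the comparison on sections. It is symmetric in the two immersions, so the inverse of
  the comparison comes for free.\<close>

definition corresponds :: "('b, 's) ringed_space \<Rightarrow> ('a, 'r) ringed_space \<Rightarrow>
    ('b, 's, 'a, 'r) space_map \<Rightarrow> ('c, 't) ringed_space \<Rightarrow> ('c, 't, 'a, 'r) space_map \<Rightarrow>
    'b set \<Rightarrow> 's \<Rightarrow> 'c set \<Rightarrow> 't \<Rightarrow> bool"
  where "corresponds Y X \<phi> Z \<psi> S s V t \<longleftrightarrow>
    s \<in> carrier (sections Y S) \<and> t \<in> carrier (sections Z V) \<and>
    (\<forall>x\<in>point_map \<phi> ` S. \<exists>U r. is_open X U \<and> x \<in> U \<and> r \<in> carrier (sections X U) \<and>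
      preimage Y \<phi> U \<subseteq> S \<and> preimage Z \<psi> U \<subseteq> V \<and>
      restr Y S (preimage Y \<phi> U) s = section_map \<phi> U r \<and>
      restr Z V (preimage Z \<psi> U) t = section_map \<psi> U r)"

text \<open>The section map is read off from its graph; the description is meaningful, in the
  situation of \<open>equal_kernels\<close>, by \<open>corr_exists\<close> and
  \<open>corr_unique\<close>.\<close>

definition comparison :: "('b, 's) ringed_space \<Rightarrow> ('a, 'r) ringed_space \<Rightarrow>
    ('b, 's, 'a, 'r) space_map \<Rightarrow> ('c, 't) ringed_space \<Rightarrow> ('c, 't, 'a, 'r) space_map \<Rightarrow>
    ('b, 's, 'c, 't) space_map"
  where "comparison Y X \<phi> Z \<psi> = \<lparr>point_map = comparison_point \<phi> Z \<psi>,
    section_map = (\<lambda>V t. THE s. corresponds Y X \<phi> Z \<psi> (comparison_preimage Y \<phi> Z \<psi> V) s V t)\<rparr>"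

text \<open>What the transfer lemmas yield from equal ideals on a cover: agreement of kernels over
  every open set. Both conditions are symmetric, so each result below also holds with the immersions
  exchanged.\<close>

locale equal_kernels = two_imm +
  assumes image_eq: "point_map \<phi> ` points Y = point_map \<psi> ` points Z"
    and kernel_iff: "is_open X U \<Longrightarrow> r \<in> carrier (sections X U) \<Longrightarrow>
      section_map \<phi> U r = \<zero>\<^bsub>sections Y (preimage Y \<phi> U)\<^esub> \<longleftrightarrow>
      section_map \<psi> U r = \<zero>\<^bsub>sections Z (preimage Z \<psi> U)\<^esub>"
begin

lemma swap: "equal_kernels Z X \<psi> Y \<phi>"
proof -
  interpret s: two_imm Z X \<psi> Y \<phi> by unfold_locales
  show ?thesis by unfold_locales (simp_all add: image_eq kernel_iff)
qed

abbreviation "corr \<equiv> corresponds Y X \<phi> Z \<psi>"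
abbreviation "point \<equiv> comparison_point \<phi> Z \<psi>"
abbreviation "pre \<equiv> comparison_preimage Y \<phi> Z \<psi>"

lemma point_in: "y \<in> points Y \<Longrightarrow> point y \<in> points Z"
  and \<psi>_point: "y \<in> points Y \<Longrightarrow> point_map \<psi> (point y) = point_map \<phi> y"
proof -
  assume "y \<in> points Y"
  then have "point_map \<phi> y \<in> point_map \<psi> ` points Z" using image_eq by auto
  then show "point y \<in> points Z" "point_map \<psi> (point y) = point_map \<phi> y"
    unfolding comparison_point_def by (rule inv_into_into, rule f_inv_into_f)
qed

lemma point_point: "y \<in> points Y \<Longrightarrow> comparison_point \<psi> Y \<phi> (point y) = y"
  using \<psi>_point \<phi>.inj unfolding comparison_point_def[of \<psi> Y \<phi>]
  by (simp add: inv_into_f_eq inj_on_def)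

lemma pre_preimage: "pre (preimage Z \<psi> U) = preimage Y \<phi> U"
  using \<psi>_point point_in unfolding comparison_preimage_def preimage_def by auto

text \<open>Every open set of \<open>Z\<close> is the preimage of one of \<open>X\<close>, so
  continuity of \<phi> gives continuity of the comparison of points.\<close>

lemma pre_open:
  assumes "is_open Z V"
  shows "is_open Y (pre V)"
proof -
  obtain N where "is_open X N" "preimage Z \<psi> N = V" using \<psi>.open_is_preimage[OF assms] .
  then show ?thesis using pre_preimage[of N] \<phi>.preimage_open by simp
qed

lemma image_pre:
  assumes "V \<subseteq> points Z"
  shows "point_map \<phi> ` pre V = point_map \<psi> ` V"
proof
  show "point_map \<phi> ` pre V \<subseteq> point_map \<psi> ` V"
    using \<psi>_point unfolding comparison_preimage_def by (auto simp: image_iff) metis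
  show "point_map \<psi> ` V \<subseteq> point_map \<phi> ` pre V"
  proof
    fix x assume "x \<in> point_map \<psi> ` V"
    then obtain z where z: "z \<in> V" "x = point_map \<psi> z" by auto
    then have "x \<in> point_map \<phi> ` points Y" using image_eq assms by auto
    then obtain y where y: "y \<in> points Y" "x = point_map \<phi> y" by auto
    have "point y = z" using \<psi>.inj[OF point_in[OF y(1)]] \<psi>_point[OF y(1)] y z assms by auto
    then show "x \<in> point_map \<phi> ` pre V" using y z unfolding comparison_preimage_def by auto
  qed
qed

text \<open>Equality of kernels, applied to the difference r - r'.\<close>

lemma section_eq_iff:
  assumes U: "is_open X U" and r: "r \<in> carrier (sections X U)" "r' \<in> carrier (sections X U)"
  shows "section_map \<phi> U r = section_map \<phi> U r' \<longleftrightarrow> section_map \<psi> U r = section_map \<psi> U r'"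
proof -
  interpret R: cring "sections X U" using \<phi>.X.sections_cring[OF U] .
  interpret f: ring_hom_ring "sections X U" "sections Y (preimage Y \<phi> U)" "section_map \<phi> U"
    using \<phi>.section_ring_hom[OF U] .
  interpret g: ring_hom_ring "sections X U" "sections Z (preimage Z \<psi> U)" "section_map \<psi> U"
    using \<psi>.section_ring_hom[OF U] .
  have "section_map \<phi> U (r \<ominus>\<^bsub>sections X U\<^esub> r') =
      section_map \<phi> U r \<ominus>\<^bsub>sections Y (preimage Y \<phi> U)\<^esub> section_map \<phi> U r'"
    using r by (simp add: R.minus_eq f.S.minus_eq)
  moreover have "section_map \<psi> U (r \<ominus>\<^bsub>sections X U\<^esub> r') =
      section_map \<psi> U r \<ominus>\<^bsub>sections Z (preimage Z \<psi> U)\<^esub> section_map \<psi> U r'"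
    using r by (simp add: R.minus_eq g.S.minus_eq)
  ultimately show ?thesis using kernel_iff[OF U R.minus_closed[OF r]] r by simp
qed

text \<open>Two lifts of the same \<open>t\<close> have equal \<psi>-pullbacks on \<open>N\<close>,
  hence equal \<phi>-pullbacks. So the section of \<open>Y\<close> built from \<open>t\<close> does
  not depend on the lifts; both gluing and uniqueness rest on this.\<close>

lemma lifts_agree:
  assumes V: "is_open Z V" "t \<in> carrier (sections Z V)"
    and U: "is_open X U" "r \<in> carrier (sections X U)" "preimage Z \<psi> U \<subseteq> V"
      "restr Z V (preimage Z \<psi> U) t = section_map \<psi> U r"
    and U': "is_open X U'" "r' \<in> carrier (sections X U')" "preimage Z \<psi> U' \<subseteq> V"
      "restr Z V (preimage Z \<psi> U') t = section_map \<psi> U' r'"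
    and N: "is_open X N" "N \<subseteq> U" "N \<subseteq> U'"
  shows "restr Y (preimage Y \<phi> U) (preimage Y \<phi> N) (section_map \<phi> U r) =
    restr Y (preimage Y \<phi> U') (preimage Y \<phi> N) (section_map \<phi> U' r')"
proof -
  have sub: "preimage Z \<psi> N \<subseteq> preimage Z \<psi> U" "preimage Z \<psi> N \<subseteq> preimage Z \<psi> U'"
    using N unfolding preimage_def by auto
  have "section_map \<psi> N (restr X U N r) = restr Z V (preimage Z \<psi> N) t"
    using \<psi>.section_restr[OF U(1) N(1,2) U(2)] U(4)
      \<psi>.Y.restr_restr[OF V(1) \<psi>.preimage_open[OF U(1)] \<psi>.preimage_open[OF N(1)] sub(1) U(3) V(2)] by simp
  moreover have "section_map \<psi> N (restr X U' N r') = restr Z V (preimage Z \<psi> N) t"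
    using \<psi>.section_restr[OF U'(1) N(1,3) U'(2)] U'(4)
      \<psi>.Y.restr_restr[OF V(1) \<psi>.preimage_open[OF U'(1)] \<psi>.preimage_open[OF N(1)] sub(2) U'(3) V(2)] by simp
  ultimately have "section_map \<phi> N (restr X U N r) = section_map \<phi> N (restr X U' N r')"
    using section_eq_iff[OF N(1) \<phi>.X.restr_closed[OF U(1) N(1,2) U(2)] \<phi>.X.restr_closed[OF U'(1) N(1,3) U'(2)]]
    by simp
  then show ?thesis using \<phi>.section_restr[OF U(1) N(1,2) U(2)] \<phi>.section_restr[OF U'(1) N(1,3) U'(2)] by simp
qed

lemma corrE:
  assumes "corr S s V t" "y \<in> S"
  obtains U r where "is_open X U" "point_map \<phi> y \<in> U" "r \<in> carrier (sections X U)"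
    "preimage Y \<phi> U \<subseteq> S" "preimage Z \<psi> U \<subseteq> V"
    "restr Y S (preimage Y \<phi> U) s = section_map \<phi> U r"
    "restr Z V (preimage Z \<psi> U) t = section_map \<psi> U r"
  using assms unfolding corresponds_def by auto

lemma corr_closed:
  "corr S s V t \<Longrightarrow> s \<in> carrier (sections Y S)" "corr S s V t \<Longrightarrow> t \<in> carrier (sections Z V)"
  unfolding corresponds_def by simp_all

text \<open>Near each point both candidates are \<phi>-pullbacks of lifts of the same
  \<open>t\<close>, so \<open>lifts_agree\<close> applies on the intersection of the two
  domains.\<close>

lemma corr_unique:
  assumes S: "is_open Y S" and V: "is_open Z V" and s: "corr S s V t" "corr S s' V t"
  shows "s = s'"
proof (rule \<phi>.Y.section_eqI[OF S corr_closed(1)[OF s(1)] corr_closed(1)[OF s(2)]])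
  fix y assume y: "y \<in> S"
  obtain U r where U: "is_open X U" "point_map \<phi> y \<in> U" "r \<in> carrier (sections X U)"
    "preimage Y \<phi> U \<subseteq> S" "preimage Z \<psi> U \<subseteq> V"
    "restr Y S (preimage Y \<phi> U) s = section_map \<phi> U r"
    "restr Z V (preimage Z \<psi> U) t = section_map \<psi> U r"
    using corrE[OF s(1) y] .
  obtain U' r' where U': "is_open X U'" "point_map \<phi> y \<in> U'" "r' \<in> carrier (sections X U')"
    "preimage Y \<phi> U' \<subseteq> S" "preimage Z \<psi> U' \<subseteq> V"
    "restr Y S (preimage Y \<phi> U') s' = section_map \<phi> U' r'"
    "restr Z V (preimage Z \<psi> U') t = section_map \<psi> U' r'"
    using corrE[OF s(2) y] .
  let ?N = "U \<inter> U'" and ?P = "preimage Y \<phi> (U \<inter> U')"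
  have N: "is_open X ?N" "?N \<subseteq> U" "?N \<subseteq> U'" using U U' by auto
  have P: "is_open Y ?P" "?P \<subseteq> preimage Y \<phi> U" "?P \<subseteq> preimage Y \<phi> U'" "y \<in> ?P" "?P \<subseteq> S"
    using \<phi>.preimage_open[OF N(1)] U(2,4) U'(2) openin_subset[OF S] y unfolding preimage_def by auto
  have "restr Y S ?P s = restr Y S ?P s'"
    using lifts_agree[OF V corr_closed(2)[OF s(1)] U(1,3,5,7) U'(1,3,5,7) N]
      \<phi>.Y.restr_restr[OF S \<phi>.preimage_open[OF U(1)] P(1,2) U(4) corr_closed(1)[OF s(1)]]
      \<phi>.Y.restr_restr[OF S \<phi>.preimage_open[OF U'(1)] P(1,3) U'(4) corr_closed(1)[OF s(2)]] U(6) U'(6)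
    by simp
  then show "\<exists>W. is_open Y W \<and> y \<in> W \<and> W \<subseteq> S \<and> restr Y S W s = restr Y S W s'"
    using P by (intro exI[of _ ?P]) simp
qed

text \<open>For each \<open>y\<close> a lift of \<open>t\<close> near the corresponding point of
  \<open>Z\<close> is chosen; the \<phi>-pullbacks of these lifts are compatible by
  \<open>lifts_agree\<close> and glue.\<close>

lemma corr_exists:
  assumes V: "is_open Z V" and t: "t \<in> carrier (sections Z V)"
  obtains s where "corr (pre V) s V t"
proof -
  have ptV: "point y \<in> V" "y \<in> points Y" if "y \<in> pre V" for y
    using that unfolding comparison_preimage_def by auto
  let ?L = "\<lambda>y U r. is_open X U \<and> point_map \<phi> y \<in> U \<and> r \<in> carrier (sections X U) \<and>
    preimage Z \<psi> U \<subseteq> V \<and> restr Z V (preimage Z \<psi> U) t = section_map \<psi> U r"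
  have "\<exists>U r. ?L y U r" if "y \<in> pre V" for y
    using \<psi>.local_lift[OF V t ptV(1)[OF that]] unfolding \<psi>_point[OF ptV(2)[OF that]] by metis
  then obtain U r where L: "\<And>y. y \<in> pre V \<Longrightarrow> ?L y (U y) (r y)" by metis
  let ?N = "\<lambda>y. preimage Y \<phi> (U y)" and ?s = "\<lambda>y. section_map \<phi> (U y) (r y)"
  have sub: "?N y \<subseteq> pre V" if "y \<in> pre V" for y
    unfolding pre_preimage[symmetric] using L[OF that] unfolding comparison_preimage_def by auto
  have "\<exists>s. s \<in> carrier (sections Y (pre V)) \<and> (\<forall>y\<in>pre V. restr Y (pre V) (?N y) s = ?s y)"
  proof (rule \<phi>.Y.glue[of "pre V" ?N ?s])
    show "is_open Y (pre V)" using pre_open[OF V] .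
    fix y assume y: "y \<in> pre V"
    show "is_open Y (?N y)" using L[OF y] \<phi>.preimage_open by simp
    show "y \<in> ?N y" using L[OF y] ptV(2)[OF y] unfolding preimage_def by simp
    show "?N y \<subseteq> pre V" using sub[OF y] .
    show "?s y \<in> carrier (sections Y (?N y))" using L[OF y] \<phi>.section_closed by simp
    fix y' assume y': "y' \<in> pre V"
    have "?N y \<inter> ?N y' = preimage Y \<phi> (U y \<inter> U y')" unfolding preimage_def by auto
    then show "restr Y (?N y) (?N y \<inter> ?N y') (?s y) = restr Y (?N y') (?N y \<inter> ?N y') (?s y')"
      using lifts_agree[OF V t, of "U y" "r y" "U y'" "r y'" "U y \<inter> U y'"] L[OF y] L[OF y'] by auto
  qed auto
  then obtain s where s: "s \<in> carrier (sections Y (pre V))"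
    "\<And>y. y \<in> pre V \<Longrightarrow> restr Y (pre V) (?N y) s = ?s y" by auto
  have "corr (pre V) s V t"
    unfolding corresponds_def
  proof (intro conjI ballI s(1) t)
    fix x assume "x \<in> point_map \<phi> ` pre V"
    then obtain y where y: "y \<in> pre V" "x = point_map \<phi> y" by auto
    show "\<exists>U r. is_open X U \<and> x \<in> U \<and> r \<in> carrier (sections X U) \<and>
      preimage Y \<phi> U \<subseteq> pre V \<and> preimage Z \<psi> U \<subseteq> V \<and>
      restr Y (pre V) (preimage Y \<phi> U) s = section_map \<phi> U r \<and>
      restr Z V (preimage Z \<psi> U) t = section_map \<psi> U r"
      using L[OF y(1)] sub[OF y(1)] s(2)[OF y(1)] y(2) by (intro exI[of _ "U y"] exI[of _ "r y"]) simp
  qed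
  then show ?thesis by (rule that)
qed

text \<open>Each of the two open sets is the preimage of an open set of \<open>X\<close>. The
  equality of images puts \<open>x\<close> in both of these, and their intersection serves.\<close>

lemma common_nbhd:
  assumes S: "is_open Y S" and V: "is_open Z V" and im: "point_map \<phi> ` S = point_map \<psi> ` V"
    and x: "x \<in> point_map \<phi> ` S"
  obtains N where "is_open X N" "x \<in> N" "preimage Y \<phi> N \<subseteq> S" "preimage Z \<psi> N \<subseteq> V"
proof -
  obtain M where M: "is_open X M" "preimage Y \<phi> M = S" using \<phi>.open_is_preimage[OF S] .
  obtain N where N: "is_open X N" "preimage Z \<psi> N = V" using \<psi>.open_is_preimage[OF V] .
  have "x \<in> M" using x M(2) unfolding preimage_def by auto
  moreover have "x \<in> N" using x N(2) unfolding im preimage_def by auto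
  moreover have "preimage Y \<phi> (M \<inter> N) \<subseteq> S" "preimage Z \<psi> (M \<inter> N) \<subseteq> V"
    using M N unfolding preimage_def by auto
  ultimately show ?thesis using that[of "M \<inter> N"] M N by auto
qed

lemma corr_restr:
  assumes S: "is_open Y S" and V: "is_open Z V" and c: "corr S s V t"
    and S': "is_open Y S'" "S' \<subseteq> S" and V': "is_open Z V'" "V' \<subseteq> V"
    and im: "point_map \<phi> ` S' = point_map \<psi> ` V'"
  shows "corr S' (restr Y S S' s) V' (restr Z V V' t)"
  unfolding corresponds_def
proof (intro conjI ballI)
  note st = corr_closed[OF c]
  show "restr Y S S' s \<in> carrier (sections Y S')" "restr Z V V' t \<in> carrier (sections Z V')"
    using \<phi>.Y.restr_closed[OF S S' st(1)] \<psi>.Y.restr_closed[OF V V' st(2)] .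
  fix x assume x: "x \<in> point_map \<phi> ` S'"
  then obtain y where y: "y \<in> S" "x = point_map \<phi> y" using S'(2) by auto
  obtain U r where U: "is_open X U" "point_map \<phi> y \<in> U" "r \<in> carrier (sections X U)"
    "preimage Y \<phi> U \<subseteq> S" "preimage Z \<psi> U \<subseteq> V"
    "restr Y S (preimage Y \<phi> U) s = section_map \<phi> U r"
    "restr Z V (preimage Z \<psi> U) t = section_map \<psi> U r"
    using corrE[OF c y(1)] .
  obtain N where N: "is_open X N" "x \<in> N" "preimage Y \<phi> N \<subseteq> S'" "preimage Z \<psi> N \<subseteq> V'"
    using common_nbhd[OF S'(1) V'(1) im x] .
  let ?M = "U \<inter> N"
  have M: "is_open X ?M" "?M \<subseteq> U" using U N by auto
  have p: "preimage Y \<phi> ?M \<subseteq> S'" "preimage Z \<psi> ?M \<subseteq> V'"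
    "preimage Y \<phi> ?M \<subseteq> preimage Y \<phi> U" "preimage Z \<psi> ?M \<subseteq> preimage Z \<psi> U"
    using N unfolding preimage_def by auto
  note po = \<phi>.preimage_open \<psi>.preimage_open
  have "restr Y S' (preimage Y \<phi> ?M) (restr Y S S' s) = section_map \<phi> ?M (restr X U ?M r)"
    using \<phi>.section_restr[OF U(1) M U(3)] U(6)
      \<phi>.Y.restr_restr[OF S S'(1) po(1)[OF M(1)] p(1) S'(2) st(1)]
      \<phi>.Y.restr_restr[OF S po(1)[OF U(1)] po(1)[OF M(1)] p(3) U(4) st(1)] by simp
  moreover have "restr Z V' (preimage Z \<psi> ?M) (restr Z V V' t) = section_map \<psi> ?M (restr X U ?M r)"
    using \<psi>.section_restr[OF U(1) M U(3)] U(7)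
      \<psi>.Y.restr_restr[OF V V'(1) po(2)[OF M(1)] p(2) V'(2) st(2)]
      \<psi>.Y.restr_restr[OF V po(2)[OF U(1)] po(2)[OF M(1)] p(4) U(5) st(2)] by simp
  ultimately show "\<exists>U r. is_open X U \<and> x \<in> U \<and> r \<in> carrier (sections X U) \<and>
      preimage Y \<phi> U \<subseteq> S' \<and> preimage Z \<psi> U \<subseteq> V' \<and>
      restr Y S' (preimage Y \<phi> U) (restr Y S S' s) = section_map \<phi> U r \<and>
      restr Z V' (preimage Z \<psi> U) (restr Z V V' t) = section_map \<psi> U r"
    using M p(1,2) y U(2) N(2) \<phi>.X.restr_closed[OF U(1) M U(3)]
    by (intro exI[of _ ?M] exI[of _ "restr X U ?M r"]) simp
qed

lemma corr_sections:
  assumes "is_open X U" "r \<in> carrier (sections X U)"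
  shows "corr (preimage Y \<phi> U) (section_map \<phi> U r) (preimage Z \<psi> U) (section_map \<psi> U r)"
  unfolding corresponds_def
  using assms \<phi>.section_closed[OF assms] \<psi>.section_closed[OF assms]
    \<phi>.Y.restr_id[OF \<phi>.preimage_open[OF assms(1)] \<phi>.section_closed[OF assms]]
    \<psi>.Y.restr_id[OF \<psi>.preimage_open[OF assms(1)] \<psi>.section_closed[OF assms]]
  by (intro conjI ballI exI[of _ U] exI[of _ r]) (auto simp: preimage_def)

text \<open>Sum and product are handled together as operations commuting with restriction and with
  both pullbacks: the lifts of the two pairs are restricted to the intersection of their domains and
  combined there.\<close>

lemma corr_op:
  assumes S: "is_open Y S" and V: "is_open Z V" and c: "corr S s V t" "corr S s' V t'"
    and closed: "bY S s s' \<in> carrier (sections Y S)" "bZ V t t' \<in> carrier (sections Z V)"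
      "\<And>U r r'. is_open X U \<Longrightarrow> r \<in> carrier (sections X U) \<Longrightarrow> r' \<in> carrier (sections X U) \<Longrightarrow>
        bX U r r' \<in> carrier (sections X U)"
    and nat: "\<And>W. is_open Y W \<Longrightarrow> W \<subseteq> S \<Longrightarrow>
        restr Y S W (bY S s s') = bY W (restr Y S W s) (restr Y S W s')"
      "\<And>W. is_open Z W \<Longrightarrow> W \<subseteq> V \<Longrightarrow>
        restr Z V W (bZ V t t') = bZ W (restr Z V W t) (restr Z V W t')"
    and hom: "\<And>U r r'. is_open X U \<Longrightarrow> r \<in> carrier (sections X U) \<Longrightarrow> r' \<in> carrier (sections X U) \<Longrightarrow>
        section_map \<phi> U (bX U r r') = bY (preimage Y \<phi> U) (section_map \<phi> U r) (section_map \<phi> U r')"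
      "\<And>U r r'. is_open X U \<Longrightarrow> r \<in> carrier (sections X U) \<Longrightarrow> r' \<in> carrier (sections X U) \<Longrightarrow>
        section_map \<psi> U (bX U r r') = bZ (preimage Z \<psi> U) (section_map \<psi> U r) (section_map \<psi> U r')"
  shows "corr S (bY S s s') V (bZ V t t')"
  unfolding corresponds_def
proof (intro conjI ballI closed(1,2))
  fix x assume x: "x \<in> point_map \<phi> ` S"
  then obtain y where y: "y \<in> S" "x = point_map \<phi> y" by auto
  obtain U r where U: "is_open X U" "point_map \<phi> y \<in> U" "r \<in> carrier (sections X U)"
    "preimage Y \<phi> U \<subseteq> S" "preimage Z \<psi> U \<subseteq> V"
    "restr Y S (preimage Y \<phi> U) s = section_map \<phi> U r"
    "restr Z V (preimage Z \<psi> U) t = section_map \<psi> U r"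
    using corrE[OF c(1) y(1)] .
  obtain U' r' where U': "is_open X U'" "point_map \<phi> y \<in> U'" "r' \<in> carrier (sections X U')"
    "preimage Y \<phi> U' \<subseteq> S" "preimage Z \<psi> U' \<subseteq> V"
    "restr Y S (preimage Y \<phi> U') s' = section_map \<phi> U' r'"
    "restr Z V (preimage Z \<psi> U') t' = section_map \<psi> U' r'"
    using corrE[OF c(2) y(1)] .
  let ?M = "U \<inter> U'" and ?q = "restr X U (U \<inter> U') r" and ?q' = "restr X U' (U \<inter> U') r'"
  have M: "is_open X ?M" "?M \<subseteq> U" "?M \<subseteq> U'" using U U' by auto
  have p: "preimage Y \<phi> ?M \<subseteq> preimage Y \<phi> U" "preimage Z \<psi> ?M \<subseteq> preimage Z \<psi> U"
    "preimage Y \<phi> ?M \<subseteq> preimage Y \<phi> U'" "preimage Z \<psi> ?M \<subseteq> preimage Z \<psi> U'"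
    "preimage Y \<phi> ?M \<subseteq> S" "preimage Z \<psi> ?M \<subseteq> V"
    using U(4,5) unfolding preimage_def by auto
  have q: "?q \<in> carrier (sections X ?M)" "?q' \<in> carrier (sections X ?M)"
    using \<phi>.X.restr_closed[OF U(1) M(1,2) U(3)] \<phi>.X.restr_closed[OF U'(1) M(1,3) U'(3)] .
  note po = \<phi>.preimage_open \<psi>.preimage_open
  have "restr Y S (preimage Y \<phi> ?M) s = section_map \<phi> ?M ?q"
    "restr Y S (preimage Y \<phi> ?M) s' = section_map \<phi> ?M ?q'"
    using \<phi>.section_restr[OF U(1) M(1,2) U(3)] U(6) \<phi>.section_restr[OF U'(1) M(1,3) U'(3)] U'(6)
      \<phi>.Y.restr_restr[OF S po(1)[OF U(1)] po(1)[OF M(1)] p(1) U(4) corr_closed(1)[OF c(1)]]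
      \<phi>.Y.restr_restr[OF S po(1)[OF U'(1)] po(1)[OF M(1)] p(3) U'(4) corr_closed(1)[OF c(2)]] by simp_all
  then have "restr Y S (preimage Y \<phi> ?M) (bY S s s') = section_map \<phi> ?M (bX ?M ?q ?q')"
    using nat(1)[OF po(1)[OF M(1)] p(5)] hom(1)[OF M(1) q] by simp
  moreover have "restr Z V (preimage Z \<psi> ?M) t = section_map \<psi> ?M ?q"
    "restr Z V (preimage Z \<psi> ?M) t' = section_map \<psi> ?M ?q'"
    using \<psi>.section_restr[OF U(1) M(1,2) U(3)] U(7) \<psi>.section_restr[OF U'(1) M(1,3) U'(3)] U'(7)
      \<psi>.Y.restr_restr[OF V po(2)[OF U(1)] po(2)[OF M(1)] p(2) U(5) corr_closed(2)[OF c(1)]]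
      \<psi>.Y.restr_restr[OF V po(2)[OF U'(1)] po(2)[OF M(1)] p(4) U'(5) corr_closed(2)[OF c(2)]] by simp_all
  then have "restr Z V (preimage Z \<psi> ?M) (bZ V t t') = section_map \<psi> ?M (bX ?M ?q ?q')"
    using nat(2)[OF po(2)[OF M(1)] p(6)] hom(2)[OF M(1) q] by simp
  ultimately show "\<exists>U r. is_open X U \<and> x \<in> U \<and> r \<in> carrier (sections X U) \<and>
      preimage Y \<phi> U \<subseteq> S \<and> preimage Z \<psi> U \<subseteq> V \<and>
      restr Y S (preimage Y \<phi> U) (bY S s s') = section_map \<phi> U r \<and>
      restr Z V (preimage Z \<psi> U) (bZ V t t') = section_map \<psi> U r"
    using M p(5,6) y U(2) U'(2) closed(3)[OF M(1) q]
    by (intro exI[of _ ?M] exI[of _ "bX ?M ?q ?q'"]) simp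
qed

lemma corr_mult:
  assumes S: "is_open Y S" and V: "is_open Z V" and c: "corr S s V t" "corr S s' V t'"
  shows "corr S (s \<otimes>\<^bsub>sections Y S\<^esub> s') V (t \<otimes>\<^bsub>sections Z V\<^esub> t')"
proof -
  interpret YS: ring "sections Y S" using \<phi>.Y.sections_ring[OF S] .
  interpret ZV: ring "sections Z V" using \<psi>.Y.sections_ring[OF V] .
  show ?thesis
    by (rule corr_op[OF S V c, of "\<lambda>W. mult (sections Y W)" "\<lambda>W. mult (sections Z W)"
          "\<lambda>W. mult (sections X W)"])
      (use corr_closed[OF c(1)] corr_closed[OF c(2)] in
        \<open>simp_all add: \<phi>.Y.restr_mult[OF S] \<psi>.Y.restr_mult[OF V] ring_hom_mult[OF \<phi>.section_hom]
          ring_hom_mult[OF \<psi>.section_hom] monoid.m_closed[OF ring.is_monoid[OF \<phi>.X.sections_ring]]\<close>)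
qed

lemma corr_add:
  assumes S: "is_open Y S" and V: "is_open Z V" and c: "corr S s V t" "corr S s' V t'"
  shows "corr S (s \<oplus>\<^bsub>sections Y S\<^esub> s') V (t \<oplus>\<^bsub>sections Z V\<^esub> t')"
proof -
  interpret YS: ring "sections Y S" using \<phi>.Y.sections_ring[OF S] .
  interpret ZV: ring "sections Z V" using \<psi>.Y.sections_ring[OF V] .
  show ?thesis
    by (rule corr_op[OF S V c, of "\<lambda>W. add (sections Y W)" "\<lambda>W. add (sections Z W)"
          "\<lambda>W. add (sections X W)"])
      (use corr_closed[OF c(1)] corr_closed[OF c(2)] in
        \<open>simp_all add: \<phi>.Y.restr_add[OF S] \<psi>.Y.restr_add[OF V] ring_hom_add[OF \<phi>.section_hom]
          ring_hom_add[OF \<psi>.section_hom] ring.ring_simprules(1)[OF \<phi>.X.sections_ring]\<close>)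
qed

lemma corr_one:
  assumes S: "is_open Y S" and V: "is_open Z V" and im: "point_map \<phi> ` S = point_map \<psi> ` V"
  shows "corr S \<one>\<^bsub>sections Y S\<^esub> V \<one>\<^bsub>sections Z V\<^esub>"
  unfolding corresponds_def
proof (intro conjI ballI)
  interpret YS: ring "sections Y S" using \<phi>.Y.sections_ring[OF S] .
  interpret ZV: ring "sections Z V" using \<psi>.Y.sections_ring[OF V] .
  show "\<one>\<^bsub>sections Y S\<^esub> \<in> carrier (sections Y S)" "\<one>\<^bsub>sections Z V\<^esub> \<in> carrier (sections Z V)" by simp_all
  fix x assume "x \<in> point_map \<phi> ` S"
  then obtain N where N: "is_open X N" "x \<in> N" "preimage Y \<phi> N \<subseteq> S" "preimage Z \<psi> N \<subseteq> V"
    using common_nbhd[OF S V im] by auto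
  interpret XN: ring "sections X N" using \<phi>.X.sections_ring[OF N(1)] .
  show "\<exists>U r. is_open X U \<and> x \<in> U \<and> r \<in> carrier (sections X U) \<and>
      preimage Y \<phi> U \<subseteq> S \<and> preimage Z \<psi> U \<subseteq> V \<and>
      restr Y S (preimage Y \<phi> U) \<one>\<^bsub>sections Y S\<^esub> = section_map \<phi> U r \<and>
      restr Z V (preimage Z \<psi> U) \<one>\<^bsub>sections Z V\<^esub> = section_map \<psi> U r"
    using N \<phi>.Y.restr_one[OF S \<phi>.preimage_open[OF N(1)] N(3)]
      \<psi>.Y.restr_one[OF V \<psi>.preimage_open[OF N(1)] N(4)]
      ring_hom_one[OF \<phi>.section_hom[OF N(1)]] ring_hom_one[OF \<psi>.section_hom[OF N(1)]]
    by (intro exI[of _ N] exI[of _ "\<one>\<^bsub>sections X N\<^esub>"]) simp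
qed

text \<open>The relation quantifies over the image in \<open>X\<close> of its first open set only;
  for equal images the condition is the same read from either side.\<close>

lemma corr_swap:
  assumes c: "corresponds Z X \<psi> Y \<phi> V t S s" and im: "point_map \<phi> ` S = point_map \<psi> ` V"
  shows "corr S s V t"
  unfolding corresponds_def
proof (intro conjI ballI)
  show "s \<in> carrier (sections Y S)" "t \<in> carrier (sections Z V)"
    using c unfolding corresponds_def by simp_all
  fix x assume "x \<in> point_map \<phi> ` S"
  then have "x \<in> point_map \<psi> ` V" using im by simp
  then have "\<exists>U r. is_open X U \<and> x \<in> U \<and> r \<in> carrier (sections X U) \<and>
      preimage Z \<psi> U \<subseteq> V \<and> preimage Y \<phi> U \<subseteq> S \<and>
      restr Z V (preimage Z \<psi> U) t = section_map \<psi> U r \<and>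
      restr Y S (preimage Y \<phi> U) s = section_map \<phi> U r"
    by (rule bspec[OF c[unfolded corresponds_def, THEN conjunct2, THEN conjunct2]])
  then show "\<exists>U r. is_open X U \<and> x \<in> U \<and> r \<in> carrier (sections X U) \<and>
      preimage Y \<phi> U \<subseteq> S \<and> preimage Z \<psi> U \<subseteq> V \<and>
      restr Y S (preimage Y \<phi> U) s = section_map \<phi> U r \<and>
      restr Z V (preimage Z \<psi> U) t = section_map \<psi> U r"
    by (elim exE conjE) (intro exI conjI; assumption)
qed

section \<open>The comparison is an isomorphism over the common target\<close>

abbreviation "\<theta> \<equiv> comparison Y X \<phi> Z \<psi>"

lemma preimage_\<theta>: "preimage Y \<theta> V = pre V"
  unfolding preimage_def comparison_preimage_def comparison_def by simp

lemma \<theta>_corr: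
  assumes V: "is_open Z V" and t: "t \<in> carrier (sections Z V)"
  shows "corr (pre V) (section_map \<theta> V t) V t"
proof -
  obtain s where s: "corr (pre V) s V t" using corr_exists[OF V t] .
  then have "(THE s. corr (pre V) s V t) = s"
    using corr_unique[OF pre_open[OF V] V] by auto
  then show ?thesis using s unfolding comparison_def by simp
qed

text \<open>Values of \<theta> are computed by exhibiting a corresponding section; the homomorphism
  laws, naturality and the inverse laws all reduce to closure properties of \<open>corr\<close> in
  this way.\<close>

lemma \<theta>_eqI:
  "is_open Z V \<Longrightarrow> corr (pre V) s V t \<Longrightarrow> section_map \<theta> V t = s"
  using corr_unique[OF pre_open] \<theta>_corr corr_closed(2) by metis

lemma pre_mono: "V' \<subseteq> V \<Longrightarrow> pre V' \<subseteq> pre V"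
  unfolding comparison_preimage_def by auto

lemma \<theta>_presheaf_map: "presheaf_map Y Z \<theta>"
proof (unfold_locales, unfold preimage_\<theta>)
  show "continuous_map (space_top Y) (space_top Z) (point_map \<theta>)"
    unfolding continuous_map_def
  proof (intro conjI allI impI)
    show "point_map \<theta> \<in> points Y \<rightarrow> points Z" using point_in by (simp add: comparison_def)
    fix V assume "is_open Z V"
    then show "is_open Y {y \<in> points Y. point_map \<theta> y \<in> V}"
      using pre_open preimage_\<theta>[of V] unfolding preimage_def by simp
  qed
  fix V assume V: "is_open Z V"
  have im: "point_map \<phi> ` pre V = point_map \<psi> ` V" using image_pre[OF openin_subset[OF V]] .
  show "section_map \<theta> V \<in> ring_hom (sections Z V) (sections Y (pre V))"
  proof (rule ring_hom_memI)
    show "section_map \<theta> V t \<in> carrier (sections Y (pre V))" if "t \<in> carrier (sections Z V)" for t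
      using corr_closed(1)[OF \<theta>_corr[OF V that]] .
    show "section_map \<theta> V (t \<otimes>\<^bsub>sections Z V\<^esub> t') =
        section_map \<theta> V t \<otimes>\<^bsub>sections Y (pre V)\<^esub> section_map \<theta> V t'"
      if "t \<in> carrier (sections Z V)" "t' \<in> carrier (sections Z V)" for t t'
      using \<theta>_eqI[OF V corr_mult[OF pre_open[OF V] V \<theta>_corr[OF V that(1)] \<theta>_corr[OF V that(2)]]] .
    show "section_map \<theta> V (t \<oplus>\<^bsub>sections Z V\<^esub> t') =
        section_map \<theta> V t \<oplus>\<^bsub>sections Y (pre V)\<^esub> section_map \<theta> V t'"
      if "t \<in> carrier (sections Z V)" "t' \<in> carrier (sections Z V)" for t t'
      using \<theta>_eqI[OF V corr_add[OF pre_open[OF V] V \<theta>_corr[OF V that(1)] \<theta>_corr[OF V that(2)]]] .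
    show "section_map \<theta> V \<one>\<^bsub>sections Z V\<^esub> = \<one>\<^bsub>sections Y (pre V)\<^esub>"
      using \<theta>_eqI[OF V corr_one[OF pre_open[OF V] V im]] .
  qed
  fix V' t assume V': "is_open Z V'" "V' \<subseteq> V" and t: "t \<in> carrier (sections Z V)"
  show "section_map \<theta> V' (restr Z V V' t) = restr Y (pre V) (pre V') (section_map \<theta> V t)"
    by (rule \<theta>_eqI[OF V'(1) corr_restr[OF pre_open[OF V] V \<theta>_corr[OF V t] pre_open[OF V'(1)]
      pre_mono[OF V'(2)] V' image_pre[OF openin_subset[OF V'(1)]]]])
qed

lemma \<theta>_section: "is_open X U \<Longrightarrow> r \<in> carrier (sections X U) \<Longrightarrow>
    section_map \<theta> (preimage Z \<psi> U) (section_map \<psi> U r) = section_map \<phi> U r"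
  using \<theta>_eqI[OF \<psi>.preimage_open] corr_sections pre_preimage by metis

text \<open>Locality comes from surjectivity on stalks: near \<open>y\<close> a section of
  \<open>Y\<close> is the \<phi>-pullback of some \<open>r\<close>, hence the \<theta>-pullback of
  the \<psi>-pullback of \<open>r\<close>.\<close>

lemma \<theta>_morphism: "morphism Y Z \<theta>"
proof -
  interpret \<theta>: presheaf_map Y Z \<theta> by (rule \<theta>_presheaf_map)
  have "local_hom (stalk Z (point_map \<theta> y)) (stalk Y y) (stalk_map Y \<theta> y)" if y: "y \<in> points Y" for y
  proof (rule local_hom_surjI[OF \<theta>.stalk_map_hom[OF y] \<psi>.Y.local_stalks[OF \<theta>.point_closed[OF y]]
        \<phi>.Y.local_stalks[OF y]], rule subsetI)
    let ?z = "point_map \<theta> y"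
    have z: "?z \<in> points Z" "point_map \<psi> ?z = point_map \<phi> y"
      using \<theta>.point_closed[OF y] \<psi>_point[OF y] by (simp_all add: comparison_def)
    fix a assume "a \<in> carrier (stalk Y y)"
    then obtain W s where W: "is_open Y W" "y \<in> W" "s \<in> carrier (sections Y W)" "a = germ Y y W s"
      by (rule \<phi>.Y.in_stalkE)
    obtain U r where U: "is_open X U" "point_map \<phi> y \<in> U" "r \<in> carrier (sections X U)"
      "preimage Y \<phi> U \<subseteq> W" "restr Y W (preimage Y \<phi> U) s = section_map \<phi> U r"
      using \<phi>.local_lift[OF W(1,3,2)] .
    have yU: "y \<in> preimage Y \<phi> U" using y U(2) unfolding preimage_def by simp
    let ?V = "preimage Z \<psi> U" and ?t = "section_map \<psi> U r"
    have V: "is_open Z ?V" "?z \<in> ?V" "?t \<in> carrier (sections Z ?V)"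
      using \<psi>.preimage_open[OF U(1)] z U(2) \<psi>.section_closed[OF U(1,3)] unfolding preimage_def by simp_all
    have "stalk_map Y \<theta> y (germ Z ?z ?V ?t) = germ Y y (preimage Y \<phi> U) (section_map \<phi> U r)"
      using \<theta>.stalk_map_germ[OF y V] \<theta>_section[OF U(1,3)] unfolding preimage_\<theta> pre_preimage by simp
    also have "\<dots> = a"
      using \<phi>.Y.germ_restr[OF W(1) \<phi>.preimage_open[OF U(1)] U(4) yU W(3)] U(5) W(4) by simp
    finally show "a \<in> stalk_map Y \<theta> y ` carrier (stalk Z ?z)"
      using \<psi>.Y.germ_in_stalk[OF V] by (intro image_eqI[of _ _ "germ Z ?z ?V ?t"]) simp_all
  qed
  then show ?thesis
    unfolding morphism_def using \<theta>.continuous \<theta>.section_hom \<theta>.section_restr by simp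
qed

text \<open>The reverse comparison sends \<open>s\<close> to a section corresponding to it. Read the
  other way, the same correspondence says that \<theta> sends this section back to
  \<open>s\<close>.\<close>

lemma \<theta>_left_inverse: "morphism_eq Y Y (compose_map Z (comparison Z X \<psi> Y \<phi>) \<theta>) identity_map"
  unfolding morphism_eq_def
proof (intro conjI ballI allI impI)
  interpret s: equal_kernels Z X \<psi> Y \<phi> by (rule swap)
  show "point_map (compose_map Z s.\<theta> \<theta>) y = point_map identity_map y" if "y \<in> points Y" for y
    using point_point[OF that] by (simp add: compose_map_def identity_map_def comparison_def)
  fix S s assume *: "is_open Y S \<and> s \<in> carrier (sections Y S)"
  then have S: "is_open Y S" and s: "s \<in> carrier (sections Y S)" by auto
  have ss: "pre (s.pre S) = S"
    using openin_subset[OF S] point_point point_in unfolding comparison_preimage_def by auto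
  have im: "point_map \<psi> ` s.pre S = point_map \<phi> ` S" using s.image_pre[OF openin_subset[OF S]] .
  have "corr S s (s.pre S) (section_map s.\<theta> S s)"
    by (rule corr_swap[OF s.\<theta>_corr[OF S s] im[symmetric]])
  then have "section_map \<theta> (s.pre S) (section_map s.\<theta> S s) = s"
    using \<theta>_eqI[OF s.pre_open[OF S]] ss by simp
  then show "section_map (compose_map Z s.\<theta> \<theta>) S s = section_map identity_map S s"
    unfolding compose_map_def identity_map_def by (simp add: s.preimage_\<theta>)
qed

lemma \<theta>_isomorphism: "isomorphism Y Z \<theta>"
proof -
  interpret s: equal_kernels Z X \<psi> Y \<phi> by (rule swap)
  show ?thesis
    unfolding isomorphism_def
    using \<theta>_morphism s.\<theta>_morphism \<theta>_left_inverse s.\<theta>_left_inverse by auto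
qed

lemma \<theta>_commutes: "morphism_eq Y X \<phi> (compose_map Z \<psi> \<theta>)"
  unfolding morphism_eq_def compose_map_def using \<psi>_point \<theta>_section
  by (simp add: comparison_def)

end

section \<open>Kernels decide equivalence of closed immersions\<close>

lemma scheme_lrs: "scheme X \<Longrightarrow> lrs X"
  unfolding scheme_def locally_ringed_space_def
  by (simp add: lrs_def lrs_axioms_def sheaf_def)

lemma closed_imm_iff: "closed_imm Y X \<phi> \<longleftrightarrow> closed_immersion Y X \<phi>"
proof
  show "closed_immersion Y X \<phi>" if "closed_imm Y X \<phi>" using closed_imm.immersion[OF that] .
  show "closed_imm Y X \<phi>" if "closed_immersion Y X \<phi>"
    using that
    by (intro closed_imm.intro closed_imm_axioms.intro lrs_morphism.intro lrs_morphism_axioms.intro)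
      (simp_all add: closed_immersion_def scheme_lrs)
qed

lemma section_kernel_eq:
  "section_kernel Y X \<phi> U = {a \<in> carrier (sections X U). section_map \<phi> U a = \<zero>\<^bsub>sections Y (preimage Y \<phi> U)\<^esub>}"
  unfolding section_kernel_def a_kernel_def' ..

text \<open>The pullback along \<phi> is the pullback along \<psi> followed by the section map of
  the isomorphism \<theta>, which is injective and so leaves the kernel unchanged.\<close>

lemma equivalent_same_kernel:
  assumes equiv: "((Y, \<phi>), (Z, \<psi>)) \<in> immersion_equiv X" and U: "is_open X U"
  shows "section_kernel Y X \<phi> U = section_kernel Z X \<psi> U"
proof -
  obtain \<theta> where Y: "closed_immersion Y X \<phi>" and Z: "closed_immersion Z X \<psi>"
    and iso: "isomorphism Y Z \<theta>" and eq: "morphism_eq Y X \<phi> (compose_map Z \<psi> \<theta>)"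
    using equiv unfolding immersion_equiv_def by auto
  obtain \<theta>' where \<theta>': "morphism Y Z \<theta>" "morphism_eq Z Z (compose_map Y \<theta> \<theta>') identity_map"
    using iso unfolding isomorphism_def by auto
  interpret Y: closed_imm Y X \<phi> using Y closed_imm_iff by auto
  interpret Z: closed_imm Z X \<psi> using Z closed_imm_iff by auto
  interpret T: lrs_morphism Y Z \<theta> by unfold_locales (rule \<theta>')
  let ?V = "preimage Z \<psi> U"
  have V: "is_open Z ?V" using Z.preimage_open[OF U] .
  have pre: "preimage Y \<theta> ?V = preimage Y \<phi> U"
    using eq T.point_closed unfolding morphism_eq_def compose_map_def preimage_def by auto
  interpret h: ring_hom_ring "sections Z ?V" "sections Y (preimage Y \<theta> ?V)" "section_map \<theta> ?V"
    using T.section_ring_hom[OF V] .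
  \<comment> \<open>In \<open>compose_map Y \<theta> \<theta>'\<close> the section map of \<theta>
    is applied before that of \<theta>', so the identity on \<open>Z\<close> gives it a left
    inverse.\<close>
  have inj: "t = t'"
    if "t \<in> carrier (sections Z ?V)" "t' \<in> carrier (sections Z ?V)" "section_map \<theta> ?V t = section_map \<theta> ?V t'"
    for t t'
  proof -
    have "section_map (compose_map Y \<theta> \<theta>') ?V u = u" if "u \<in> carrier (sections Z ?V)" for u
      using \<theta>'(2) that V unfolding morphism_eq_def identity_map_def by simp
    then show ?thesis using that unfolding compose_map_def by simp (metis)
  qed
  have "section_map \<phi> U a = \<zero>\<^bsub>sections Y (preimage Y \<phi> U)\<^esub> \<longleftrightarrow> section_map \<psi> U a = \<zero>\<^bsub>sections Z ?V\<^esub>"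
    if a: "a \<in> carrier (sections X U)" for a
  proof -
    have "section_map \<phi> U a = section_map \<theta> ?V (section_map \<psi> U a)"
      using eq U a unfolding morphism_eq_def compose_map_def by simp
    moreover have "section_map \<psi> U a \<in> carrier (sections Z ?V)" using Z.section_closed[OF U a] .
    moreover have "section_map \<theta> ?V \<zero>\<^bsub>sections Z ?V\<^esub> = \<zero>\<^bsub>sections Y (preimage Y \<phi> U)\<^esub>"
      using h.hom_zero pre by simp
    ultimately show ?thesis using inj h.R.zero_closed by metis
  qed
  then show ?thesis unfolding section_kernel_eq by auto
qed

text \<open>Each transfer lemma is applied in both directions, \<open>YZ\<close> and
  \<open>ZY\<close>, to turn inclusions of images and kernels into equalities.\<close>

lemma same_kernel_equivalent:
  assumes \<C>: "affine_open_cover X \<C>" and Y: "closed_immersion Y X \<phi>" and Z: "closed_immersion Z X \<psi>"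
    and ker: "\<And>U. U \<in> \<C> \<Longrightarrow> section_kernel Y X \<phi> U = section_kernel Z X \<psi> U"
  shows "((Y, \<phi>), (Z, \<psi>)) \<in> immersion_equiv X"
proof -
  interpret Y: closed_imm Y X \<phi> using Y closed_imm_iff by auto
  interpret Z: closed_imm Z X \<psi> using Z closed_imm_iff by auto
  interpret YZ: two_imm Y X \<phi> Z \<psi> by unfold_locales
  interpret ZY: two_imm Z X \<psi> Y \<phi> by unfold_locales
  have k: "section_map \<phi> U a = \<zero>\<^bsub>sections Y (preimage Y \<phi> U)\<^esub> \<longleftrightarrow>
      section_map \<psi> U a = \<zero>\<^bsub>sections Z (preimage Z \<psi> U)\<^esub>"
    if "U \<in> \<C>" "a \<in> carrier (sections X U)" for U a
    using ker[OF that(1)] that(2) unfolding section_kernel_eq by auto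
  have cov: "\<exists>U\<in>\<C>. x \<in> U \<and> affine_open X U" if "x \<in> points X" for x
    using \<C> that unfolding affine_open_cover_def by auto
  have sub1: "point_map \<psi> ` points Z \<subseteq> point_map \<phi> ` points Y"
  proof
    fix x assume "x \<in> point_map \<psi> ` points Z"
    then obtain z where z: "z \<in> points Z" "x = point_map \<psi> z" by auto
    then obtain U where U: "U \<in> \<C>" "x \<in> U" "affine_open X U" using cov Z.point_closed by metis
    show "x \<in> point_map \<phi> ` points Y"
      using YZ.image_transfer[OF U(3) _ z(1)] k[OF U(1)] z(2) U(2) by auto
  qed
  have sub2: "point_map \<phi> ` points Y \<subseteq> point_map \<psi> ` points Z"
  proof
    fix x assume "x \<in> point_map \<phi> ` points Y"
    then obtain y where y: "y \<in> points Y" "x = point_map \<phi> y" by auto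
    then obtain U where U: "U \<in> \<C>" "x \<in> U" "affine_open X U" using cov Y.point_closed by metis
    show "x \<in> point_map \<psi> ` points Z"
      using ZY.image_transfer[OF U(3) _ y(1)] k[OF U(1)] y(2) U(2) by auto
  qed
  interpret E: equal_kernels Y X \<phi> Z \<psi>
  proof unfold_locales
    show "point_map \<phi> ` points Y = point_map \<psi> ` points Z" using sub1 sub2 by (rule subset_antisym[rotated])
    show "section_map \<phi> U r = \<zero>\<^bsub>sections Y (preimage Y \<phi> U)\<^esub> \<longleftrightarrow>
      section_map \<psi> U r = \<zero>\<^bsub>sections Z (preimage Z \<psi> U)\<^esub>"
      if "is_open X U" "r \<in> carrier (sections X U)" for U r
      using YZ.kernel_transfer[OF \<C> _ that] ZY.kernel_transfer[OF \<C> _ that] k by metis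
  qed
  show ?thesis
    unfolding immersion_equiv_def using Y Z E.\<theta>_isomorphism E.\<theta>_commutes by auto
qed

text \<open>In this form the relation is visibly reflexive, symmetric and transitive on closed
  immersions, so classes can be handled without composing or inverting isomorphisms of
  sources.\<close>

lemma immersion_equiv_iff:
  assumes "affine_open_cover X \<C>"
  shows "((Y, \<phi>), (Z, \<psi>)) \<in> immersion_equiv X \<longleftrightarrow>
    closed_immersion Y X \<phi> \<and> closed_immersion Z X \<psi> \<and>
    (\<forall>U\<in>\<C>. section_kernel Y X \<phi> U = section_kernel Z X \<psi> U)" (is "?L \<longleftrightarrow> ?R")
proof
  assume L: ?L
  then have "closed_immersion Y X \<phi>" "closed_immersion Z X \<psi>" unfolding immersion_equiv_def by auto
  moreover have "is_open X U" if "U \<in> \<C>" for U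
    using assms that unfolding affine_open_cover_def affine_open_def by simp
  ultimately show ?R using equivalent_same_kernel[OF L] by simp
next
  assume ?R
  then show ?L by (intro same_kernel_equivalent[OF assms]) simp_all
qed

theorem theorem3p4:
  fixes X :: "('a, 'r) ringed_space" and \<C> :: "'a set set"
    and \<eta> :: "('b, 's, 'a, 'r) map_into set \<Rightarrow> 'a set \<Rightarrow> 'r set"
  assumes "scheme X" and "affine_open_cover X \<C>"
  defines "\<eta> \<equiv> kernel_map X \<C>"
  shows "(\<forall>(Y, \<phi>)\<in>closed_immersions X.
            \<eta> (immersion_class X (Y, \<phi>)) = (\<lambda>U\<in>\<C>. section_kernel Y X \<phi> U)) \<and>
         \<eta> \<in> immersion_classes X \<rightarrow> (\<Pi>\<^sub>E U\<in>\<C>. {I. ideal I (sections X U)}) \<and>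
         inj_on \<eta> (immersion_classes X)"
proof -
  note iff = immersion_equiv_iff[OF assms(2)]
  have \<eta>: "\<eta> (immersion_class X (Y, \<phi>)) = (\<lambda>U\<in>\<C>. section_kernel Y X \<phi> U)"
    if "closed_immersion Y X \<phi>" for Y :: "('b, 's) ringed_space" and \<phi>
  proof (rule ext)
    fix U
    show "\<eta> (immersion_class X (Y, \<phi>)) U = (\<lambda>U\<in>\<C>. section_kernel Y X \<phi> U) U"
    proof (cases "U \<in> \<C>")
      case True
      \<comment> \<open>All representatives having the same kernel, the image of the class is a
        singleton, which determines the value of \<open>the_elem\<close> in
        \<open>kernel_map\<close>.\<close>
      have "(\<lambda>(Y, \<phi>). section_kernel Y X \<phi> U) ` immersion_class X (Y, \<phi>) = {section_kernel Y X \<phi> U}"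
      proof (intro subset_antisym subsetI)
        fix K assume "K \<in> (\<lambda>(Y, \<phi>). section_kernel Y X \<phi> U) ` immersion_class X (Y, \<phi>)"
        then obtain Z and \<psi> where "((Y, \<phi>), (Z, \<psi>)) \<in> immersion_equiv X" "K = section_kernel Z X \<psi> U"
          unfolding immersion_class_def by auto
        then have "\<forall>U\<in>\<C>. section_kernel Y X \<phi> U = section_kernel Z X \<psi> U"
          unfolding iff by (elim conjE)
        then show "K \<in> {section_kernel Y X \<phi> U}"
          using True \<open>K = section_kernel Z X \<psi> U\<close> by simp
      next
        fix K assume K: "K \<in> {section_kernel Y X \<phi> U}"
        have "(Y, \<phi>) \<in> immersion_class X (Y, \<phi>)"
          unfolding immersion_class_def using that by (simp add: iff)
        then show "K \<in> (\<lambda>(Y, \<phi>). section_kernel Y X \<phi> U) ` immersion_class X (Y, \<phi>)"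
          using K by (intro image_eqI[of _ _ "(Y, \<phi>)"]) simp_all
      qed
      then show ?thesis unfolding \<eta>_def kernel_map_def using True by simp
    qed (simp add: \<eta>_def kernel_map_def)
  qed
  have classE: "\<exists>Y \<phi>. closed_immersion Y X \<phi> \<and> c = immersion_class X (Y, \<phi>)"
    if "c \<in> immersion_classes X" for c :: "('b, 's, 'a, 'r) map_into set"
    using that unfolding immersion_classes_def quotient_def immersion_class_def closed_immersions_def
    by auto
  have ideal: "ideal (section_kernel Y X \<phi> U) (sections X U)"
    if "closed_immersion Y X \<phi>" "U \<in> \<C>" for Y :: "('b, 's) ringed_space" and \<phi> U
  proof -
    interpret closed_imm Y X \<phi> using that closed_imm_iff by auto
    have "is_open X U" using assms(2) that unfolding affine_open_cover_def affine_open_def by simp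
    then show ?thesis unfolding section_kernel_def
      by (intro ring_hom_ring.kernel_is_ideal section_ring_hom)
  qed
  have "\<eta> c \<in> (\<Pi>\<^sub>E U\<in>\<C>. {I. ideal I (sections X U)})"
    if c: "c \<in> immersion_classes X" for c
  proof -
    obtain Y \<phi> where "closed_immersion Y X \<phi>" "c = immersion_class X (Y, \<phi>)" using classE[OF c] by auto
    then show ?thesis using \<eta> ideal by simp
  qed
  moreover have "inj_on \<eta> (immersion_classes X)"
  proof (rule inj_onI)
    fix c d assume "c \<in> immersion_classes X" "d \<in> immersion_classes X" and eq: "\<eta> c = \<eta> d"
    then obtain Y \<phi> Z \<psi> where Y: "closed_immersion Y X \<phi>" "c = immersion_class X (Y, \<phi>)"
      and Z: "closed_immersion Z X \<psi>" "d = immersion_class X (Z, \<psi>)"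
      using classE by metis
    have ker: "section_kernel Y X \<phi> U = section_kernel Z X \<psi> U" if "U \<in> \<C>" for U
      using fun_cong[OF eq, of U] \<eta>[OF Y(1)] \<eta>[OF Z(1)] Y(2) Z(2) that by simp
    \<comment> \<open>Which \<open>i\<close> belong to a class depends on the representative only
      through its kernels over the cover.\<close>
    have "((Y, \<phi>), i) \<in> immersion_equiv X \<longleftrightarrow> ((Z, \<psi>), i) \<in> immersion_equiv X" for i
      using ker Y(1) Z(1) by (cases i) (simp add: iff)
    then show "c = d" unfolding Y(2) Z(2) immersion_class_def by auto
  qed
  ultimately show ?thesis using \<eta> unfolding closed_immersions_def by auto
qed

end
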